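(* For every integer $k\ge 3$ and every $\gamma>0$ there exist $c>0$ and $n_0>0$ such that the following holds. If $(\mathcal H,\phi)$ is an $n$-vertex colored $k$-graph with $n\ge n_0$, $\delta_{k-1}(\mathcal H)\ge (1/2+\gamma)n$ and $\Delta_{k-1}(\mathcal H_i)\le cn$ for every $i\in\mathbb N$, then $(\mathcal H,\phi)$ contains a properly colored tight Hamilton cycle $C_n^{(k)}(k-1)$.
   Context: A $k$-graph is a $k$-uniform hypergraph. A colored hypergraph is a pair $(\mathcal H,\phi)$ where $\phi:\mathcal H\to\mathbb N$ colors the edges; $\mathcal H_i=\{e\in\mathcal H:\phi(e)=i\}$. For $S\subseteq V(\mathcal H)$, $\deg(S)$ is the number of edges containing $S$; $\delta_s(\mathcal H)=\min\{\deg(S):|S|=s\}$ and $\Delta_s(\mathcal H)=\max\{\deg(S):|S|=s\}$. For $1\le \ell\le k-1$, a $(k,\ell)$-cycle $C_n^{(k)}(\ell)$ is an $n$-vertex $k$-graph whose vertices can be cyclically ordered so that every edge consists of $k$ consecutive vertices and every two consecutive edges share exactly $\ell$ vertices; a tight cycle is the case $\ell=k-1$. A Hamilton cycle in $\mathcal H$ is one that is a spanning subhypergraph. A hypergraph is properly colored if every two intersecting edges receive different colors. *)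

theory Defs
  imports Complex_Main
begin

definition kgraph :: "nat \<Rightarrow> 'a set \<Rightarrow> 'a set set \<Rightarrow> bool" where
  "kgraph k V E \<longleftrightarrow> finite V \<and> (\<forall>e\<in>E. e \<subseteq> V \<and> card e = k)"

definition deg :: "'a set set \<Rightarrow> 'a set \<Rightarrow> nat" where
  "deg E S = card {e \<in> E. S \<subseteq> e}"

(* min_deg and max_deg are unspecified when card V < s, where there is no S to range over. *)

definition min_deg :: "nat \<Rightarrow> 'a set \<Rightarrow> 'a set set \<Rightarrow> nat" where
  "min_deg s V E = Min {deg E S |S. S \<subseteq> V \<and> card S = s}"

definition max_deg :: "nat \<Rightarrow> 'a set \<Rightarrow> 'a set set \<Rightarrow> nat" where
  "max_deg s V E = Max {deg E S |S. S \<subseteq> V \<and> card S = s}"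

(* Colorings are total functions; only their values on edges are ever used.  A color class
   is regarded as a hypergraph on the full vertex set. *)

definition color_class :: "'a set set \<Rightarrow> ('a set \<Rightarrow> nat) \<Rightarrow> nat \<Rightarrow> 'a set set" where
  "color_class E \<phi> i = {e \<in> E. \<phi> e = i}"

definition properly_colored :: "'a set set \<Rightarrow> ('a set \<Rightarrow> nat) \<Rightarrow> bool" where
  "properly_colored E \<phi> \<longleftrightarrow>
     (\<forall>e\<in>E. \<forall>f\<in>E. e \<noteq> f \<longrightarrow> e \<inter> f \<noteq> {} \<longrightarrow> \<phi> e \<noteq> \<phi> f)"

(* The k cyclically consecutive entries of vs starting at position p, taken modulo the length. *)

definition window :: "nat \<Rightarrow> 'a list \<Rightarrow> nat \<Rightarrow> 'a set" where
  "window k vs p = {vs ! ((p + i) mod length vs) |i. i < k}"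

(* The list vs is the cyclic ordering.  Consecutive edges overlap in l vertices, so they are
   shifted by k - l positions and, closing up cyclically, k - l divides the number of vertices.
   The explicit intersection condition (which includes the last and the first edge) rules out
   degenerate orderings that are too short. *)

definition kl_cycle :: "nat \<Rightarrow> nat \<Rightarrow> 'a set \<Rightarrow> 'a set set \<Rightarrow> bool" where
  "kl_cycle k l V C \<longleftrightarrow>
     1 \<le> l \<and> l \<le> k - 1 \<and> kgraph k V C \<and>
     (\<exists>vs. distinct vs \<and> set vs = V \<and> (k - l) dvd length vs \<and>
        C = {window k vs (j * (k - l)) |j. j < length vs div (k - l)} \<and>
        (\<forall>j < length vs div (k - l).
           card (window k vs (j * (k - l)) \<inter> window k vs (Suc j * (k - l))) = l))"

definition hamilton_cycle :: "nat \<Rightarrow> nat \<Rightarrow> 'a set \<Rightarrow> 'a set set \<Rightarrow> 'a set set \<Rightarrow> bool" where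
  "hamilton_cycle k l V E C \<longleftrightarrow> C \<subseteq> E \<and> kl_cycle k l V C"

end

theory Submission
  imports Defs
begin

text \<open>The proof follows the absorption method, with every probabilistic step replaced by counting. Properness
  is a local condition on stretches of \<open>2 * k - 1\<close> consecutive vertices, so good walks overlapping in
  \<open>2 * k - 2\<close> vertices can be glued. Whenever an uncolored configuration exists in a positive proportion of
  all tuples, a positive proportion is also injective and properly colored, since every color clash costs
  a factor \<open>c\<close>.

  Any two ends of walks are joined by a positive proportion of the tuples of some fixed length, by induction
  on the uniformity through links of common neighbors. Every vertex \<open>v\<close> has a positive proportion of
  absorbers, walks \<open>l @ r\<close> for which \<open>l @ [v] @ r\<close> is good as well. A greedy choice driven by an exponential
  potential yields a small path containing linearly many absorbers of each vertex, and a small reservoir of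
  disjoint connectors containing linearly many for every pair of ends. A maximal family of disjoint
  good paths of a large constant length covers almost all remaining vertices. These paths and the absorbing
  path are joined to a closed walk through the reservoir, and the vertices left over are absorbed.\<close>

section \<open>Windows and walks\<close>

text \<open>The color bound only limits how a \<open>(k - 1)\<close>-set extends within one color. A
  clash of two windows can thus be charged to a freely chosen vertex of their symmetric difference,
  but not if they differ in fixed vertices alone. Every construction must keep such pairs away or
  separate them beforehand: connectors have at least \<open>k\<close> free vertices, an absorber has
  one fixed vertex, and covering paths need fixed lists \<open>D\<close> whose neighboring entries
  give different colors. Degrees above one half enter because two \<open>(k - 1)\<close>-sets have
  \<open>2 * \<gamma> * card V\<close> common neighbors (connecting, absorbing), and because the
  average tile is more than half filled by neighbors of a leftover set that has few neighbors in the
  leftover (covering). The order of constants matters. The reservoir must avoid the absorbing path,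
  which bounds the length of that path first. The number of connectors per pair of ends finally
  dictates how long the tiles are, so that there are fewer junctions than connectors.\<close>

definition win :: "nat \<Rightarrow> 'a list \<Rightarrow> nat \<Rightarrow> 'a set" where
  "win k xs i = (!) xs ` {i..<i + k}"

definition walk :: "nat \<Rightarrow> 'a set set \<Rightarrow> 'a list \<Rightarrow> bool" where
  "walk k E xs \<longleftrightarrow> (\<forall>i. i + k \<le> length xs \<longrightarrow> win k xs i \<in> E)"

text \<open>In a list without repetitions, windows starting at least \<open>k\<close> apart are
  disjoint, so only pairs with \<open>j < i + k\<close> can violate properness.\<close>

definition separated :: "nat \<Rightarrow> ('a set \<Rightarrow> nat) \<Rightarrow> 'a list \<Rightarrow> bool" where
  "separated k \<phi> xs \<longleftrightarrow>
     (\<forall>i j. i < j \<longrightarrow> j < i + k \<longrightarrow> j + k \<le> length xs \<longrightarrow> \<phi> (win k xs i) \<noteq> \<phi> (win k xs j))"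

definition good_walk :: "nat \<Rightarrow> 'a set set \<Rightarrow> ('a set \<Rightarrow> nat) \<Rightarrow> 'a list \<Rightarrow> bool" where
  "good_walk k E \<phi> xs \<longleftrightarrow> walk k E xs \<and> separated k \<phi> xs"

definition tuples :: "'a set \<Rightarrow> nat \<Rightarrow> 'a list set" where
  "tuples V m = {xs. set xs \<subseteq> V \<and> length xs = m}"

definition lastn :: "nat \<Rightarrow> 'a list \<Rightarrow> 'a list" where
  "lastn m xs = drop (length xs - m) xs"

lemma win_append1: "i + k \<le> length xs \<Longrightarrow> win k (xs @ ys) i = win k xs i"
  unfolding win_def by (rule image_cong) (auto simp: nth_append)

lemma win_append2: "length xs \<le> i \<Longrightarrow> win k (xs @ ys) i = win k ys (i - length xs)"
proof -
  assume "length xs \<le> i"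
  then obtain d where d: "i = length xs + d"
    using le_Suc_ex by blast
  have "{i..<i + k} = (+) (length xs) ` {d..<d + k}"
    unfolding d by (simp add: image_add_atLeastLessThan add_ac)
  then have "win k (xs @ ys) i = (\<lambda>j. (xs @ ys) ! (length xs + j)) ` {d..<d + k}"
    by (simp only: win_def image_image)
  then show ?thesis
    unfolding win_def d by simp
qed

lemma win_full: "win (length xs) xs 0 = set xs"
  unfolding win_def by (auto simp: set_conv_nth)

lemma win_middle: "length w = k \<Longrightarrow> win k (xs @ w @ ys) (length xs) = set w"
  using win_append2[of xs "length xs" k "w @ ys"] win_append1[of 0 k w ys] win_full[of w] by simp

text \<open>A window starting inside \<open>xs\<close> runs past \<open>xs\<close> by at most
  \<open>k - 1\<close> entries, all of them in \<open>c\<close>.\<close>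

lemma walk_glue:
  assumes "walk k E (xs @ c)" "walk k E (c @ ys)" "k \<le> Suc (length c)"
  shows "walk k E (xs @ c @ ys)"
  unfolding walk_def
proof (intro allI impI)
  fix i assume i: "i + k \<le> length (xs @ c @ ys)"
  show "win k (xs @ c @ ys) i \<in> E"
  proof (cases "length xs \<le> i")
    case True
    then have "win k (xs @ c @ ys) i = win k (c @ ys) (i - length xs)"
      by (rule win_append2)
    with assms(2) i True show ?thesis by (auto simp: walk_def)
  next
    case False
    then have *: "i + k \<le> length (xs @ c)" using assms(3) by simp
    then have "win k ((xs @ c) @ ys) i = win k (xs @ c) i"
      by (rule win_append1)
    with assms(1) * show ?thesis by (simp add: walk_def)
  qed
qed

lemma walk_infix: "walk k E (xs @ ys @ zs) \<Longrightarrow> walk k E ys"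
  unfolding walk_def
proof (intro allI impI)
  fix i
  assume *: "\<forall>i. i + k \<le> length (xs @ ys @ zs) \<longrightarrow> win k (xs @ ys @ zs) i \<in> E"
    and i: "i + k \<le> length ys"
  have "win k (xs @ ys @ zs) (length xs + i) = win k ys i"
    using win_append2[of xs "length xs + i" k "ys @ zs"] win_append1[OF i, of zs] by simp
  with *[rule_format, of "length xs + i"] i show "win k ys i \<in> E" by simp
qed

text \<open>Two windows with \<open>i < j < i + k\<close> span at most \<open>2 * k - 1\<close>
  positions. If the first starts in \<open>xs\<close>, both end within the next
  \<open>2 * k - 2\<close> entries, hence in \<open>c\<close>. This is the origin of the overlap
  length \<open>2 * k - 2\<close>.\<close>

lemma separated_glue:
  assumes "separated k \<phi> (xs @ c)" "separated k \<phi> (c @ ys)" "2 * k - 2 \<le> length c"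
  shows "separated k \<phi> (xs @ c @ ys)"
  unfolding separated_def
proof (intro allI impI)
  fix i j assume ij: "i < j" "j < i + k" "j + k \<le> length (xs @ c @ ys)"
  show "\<phi> (win k (xs @ c @ ys) i) \<noteq> \<phi> (win k (xs @ c @ ys) j)"
  proof (cases "length xs \<le> i")
    case True
    then have "win k (xs @ c @ ys) i = win k (c @ ys) (i - length xs)"
      "win k (xs @ c @ ys) j = win k (c @ ys) (j - length xs)"
      using ij by (auto intro!: win_append2)
    moreover have "i - length xs < j - length xs" "j - length xs < i - length xs + k"
      "j - length xs + k \<le> length (c @ ys)"
      using True ij by auto
    ultimately show ?thesis using assms(2) unfolding separated_def by metis
  next
    case False
    then have *: "j + k \<le> length (xs @ c)" using assms(3) ij by simp
    then have "win k ((xs @ c) @ ys) i = win k (xs @ c) i" "win k ((xs @ c) @ ys) j = win k (xs @ c) j"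
      using ij win_append1[of i k "xs @ c" ys] win_append1[of j k "xs @ c" ys] by simp_all
    with assms(1) * ij show ?thesis by (simp add: separated_def)
  qed
qed

lemma separated_infix: "separated k \<phi> (xs @ ys @ zs) \<Longrightarrow> separated k \<phi> ys"
  unfolding separated_def
proof (intro allI impI)
  fix i j
  assume *: "\<forall>i j. i < j \<longrightarrow> j < i + k \<longrightarrow> j + k \<le> length (xs @ ys @ zs) \<longrightarrow>
      \<phi> (win k (xs @ ys @ zs) i) \<noteq> \<phi> (win k (xs @ ys @ zs) j)"
    and ij: "i < j" "j < i + k" "j + k \<le> length ys"
  have "win k (xs @ ys @ zs) (length xs + i) = win k ys i" if "i + k \<le> length ys" for i
    using win_append2[of xs "length xs + i" k "ys @ zs"] win_append1[OF that, of zs] by simp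
  with *[rule_format, of "length xs + i" "length xs + j"] ij
  show "\<phi> (win k ys i) \<noteq> \<phi> (win k ys j)" by simp
qed

lemma good_walk_glue:
  assumes "good_walk k E \<phi> (xs @ c)" "good_walk k E \<phi> (c @ ys)" "2 * k - 2 \<le> length c" "2 \<le> k"
  shows "good_walk k E \<phi> (xs @ c @ ys)"
  using assms walk_glue[of k E xs c ys] separated_glue[of k \<phi> xs c ys]
  unfolding good_walk_def by simp

lemma good_walk_infix: "good_walk k E \<phi> (xs @ ys @ zs) \<Longrightarrow> good_walk k E \<phi> ys"
  unfolding good_walk_def using walk_infix separated_infix by metis

lemma good_walk_prefix: "good_walk k E \<phi> (xs @ ys) \<Longrightarrow> good_walk k E \<phi> xs"
  using good_walk_infix[of k E \<phi> "[]"] by simp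

lemma good_walk_suffix: "good_walk k E \<phi> (xs @ ys) \<Longrightarrow> good_walk k E \<phi> ys"
  using good_walk_infix[of k E \<phi> xs ys "[]"] by simp

lemma walk_prefix: "walk k E (xs @ ys) \<Longrightarrow> walk k E xs"
  using walk_infix[of k E "[]"] by simp

lemma walk_suffix: "walk k E (xs @ ys) \<Longrightarrow> walk k E ys"
  using walk_infix[of k E xs ys "[]"] by simp

lemma lastn_append: "length ys = m \<Longrightarrow> lastn m (xs @ ys) = ys"
  by (simp add: lastn_def)

lemma length_lastn: "m \<le> length xs \<Longrightarrow> length (lastn m xs) = m"
  by (simp add: lastn_def)

lemma split_lastn: "xs = take (length xs - m) xs @ lastn m xs"
  by (simp add: lastn_def)

lemma lastn_snoc:
  assumes "m \<le> length xs"
  shows "lastn m (xs @ [u]) = tl (lastn m xs @ [u])"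
proof -
  have "lastn m xs @ [u] = drop (length xs - m) (xs @ [u])" by (simp add: lastn_def)
  then have "tl (lastn m xs @ [u]) = drop (Suc (length xs - m)) (xs @ [u])"
    by (metis drop_Suc tl_drop)
  then show ?thesis using assms by (simp add: lastn_def Suc_diff_le)
qed

lemma set_lastn_subset: "set (lastn m xs) \<subseteq> set xs"
  by (simp add: lastn_def set_drop_subset)

text \<open>Appending a vertex creates at most one new window; the guard on the last premise makes
  it void while the list is too short for any window.\<close>

lemma walk_snoc:
  assumes "walk k E xs" "1 \<le> k" "k \<le> Suc (length xs) \<Longrightarrow> insert u (set (lastn (k - 1) xs)) \<in> E"
  shows "walk k E (xs @ [u])"
  unfolding walk_def
proof (intro allI impI)
  fix i assume i: "i + k \<le> length (xs @ [u])"
  show "win k (xs @ [u]) i \<in> E"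
  proof (cases "i + k \<le> length xs")
    case True
    then show ?thesis using assms(1) by (simp add: win_append1 walk_def)
  next
    case False
    then have ieq: "i = length xs - (k - 1)" "k - 1 \<le> length xs" using i assms(2) by auto
    define p where "p = take i xs"
    have xs: "xs @ [u] = p @ (lastn (k - 1) xs @ [u]) @ []"
      unfolding p_def lastn_def ieq(1) by simp
    have p: "length p = i" using ieq by (simp add: p_def)
    have "win k (p @ (lastn (k - 1) xs @ [u]) @ []) (length p) = set (lastn (k - 1) xs @ [u])"
      by (rule win_middle) (use ieq assms(2) in \<open>simp add: length_lastn\<close>)
    then have "win k (xs @ [u]) i = insert u (set (lastn (k - 1) xs))"
      unfolding xs[symmetric] p by simp
    with assms(3) ieq show ?thesis by simp
  qed
qed

section \<open>Counting tuples\<close>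

lemma finite_tuples: "finite V \<Longrightarrow> finite (tuples V m)"
  unfolding tuples_def by (rule finite_lists_length_eq)

lemma card_tuples: "finite V \<Longrightarrow> card (tuples V m) = card V ^ m"
  unfolding tuples_def by (rule card_lists_length_eq)

text \<open>Entries are chosen one at a time, and the numbers of choices multiply because a tuple
  determines its prefixes. The bound \<open>\<delta>\<close> is real so that fractions of
  \<open>card V\<close> need no rounding.\<close>

lemma greedy_count:
  fixes P :: "'a list \<Rightarrow> bool" and \<delta> :: real
  assumes "finite V" "0 \<le> \<delta>" "P []"
    and step: "\<And>xs. P xs \<Longrightarrow> set xs \<subseteq> V \<Longrightarrow> length xs < M \<Longrightarrow> \<delta> \<le> real (card {x \<in> V. P (xs @ [x])})"
  shows "\<delta> ^ M \<le> real (card {xs \<in> tuples V M. P xs})"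
proof -
  have "\<delta> ^ m \<le> real (card {xs \<in> tuples V m. P xs})" if "m \<le> M" for m
    using that
  proof (induction m)
    case 0
    have "{xs \<in> tuples V 0. P xs} = {[]}" using assms(3) by (auto simp: tuples_def)
    then show ?case by simp
  next
    case (Suc m)
    let ?A = "{xs \<in> tuples V m. P xs}"
    let ?B = "\<lambda>xs. {x \<in> V. P (xs @ [x])}"
    have fin: "finite ?A" using finite_tuples[OF assms(1)] by simp
    have "inj_on (\<lambda>(xs, x). xs @ [x]) (Sigma ?A ?B)" by (auto simp: inj_on_def)
    moreover have "(\<lambda>(xs, x). xs @ [x]) ` Sigma ?A ?B \<subseteq> {xs \<in> tuples V (Suc m). P xs}"
      by (auto simp: tuples_def)
    moreover have "finite {xs \<in> tuples V (Suc m). P xs}" using finite_tuples[OF assms(1)] by simp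
    ultimately have le: "card (Sigma ?A ?B) \<le> card {xs \<in> tuples V (Suc m). P xs}"
      by (rule card_inj_on_le)
    have "\<delta> ^ Suc m = \<delta> ^ m * \<delta>" by simp
    also have "\<dots> \<le> real (card ?A) * \<delta>" using Suc assms(2) by (simp add: mult_right_mono)
    also have "\<dots> = (\<Sum>xs\<in>?A. \<delta>)" by simp
    also have "\<dots> \<le> (\<Sum>xs\<in>?A. real (card (?B xs)))"
      using Suc.prems by (intro sum_mono step) (auto simp: tuples_def)
    also have "\<dots> = real (card (Sigma ?A ?B))"
      using fin assms(1) by (simp add: card_SigmaI)
    finally show ?case using le by linarith
  qed
  then show ?thesis by simp
qed

text \<open>By \<open>inv\<close>, \<open>B y\<close> depends only on the coordinates other than
  \<open>j\<close>. Each of the \<open>card V ^ (m - 1)\<close> choices of those leaves at most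
  \<open>t\<close> values for \<open>y ! j\<close>.\<close>

lemma card_bad_coordinate:
  assumes "finite V" "j < m"
    and inv: "\<And>y z. y \<in> tuples V m \<Longrightarrow> z \<in> V \<Longrightarrow> B (y[j := z]) = B y"
    and bd: "\<And>y. y \<in> tuples V m \<Longrightarrow> real (card (B y \<inter> V)) \<le> t"
    and "0 \<le> t"
  shows "real (card {y \<in> tuples V m. y ! j \<in> B y}) \<le> t * real (card V) ^ (m - 1)"
proof (cases "V = {}")
  case True
  then have "tuples V m = {}" using assms(2) by (auto simp: tuples_def)
  then show ?thesis using assms(5) by simp
next
  case False
  \<comment> \<open>Any vertex will do: it fills the deleted coordinate so that \<open>B\<close> can
    be evaluated on a remainder of length \<open>m - 1\<close>.\<close>
  then obtain x0 where x0: "x0 \<in> V" by auto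
  let ?ins = "\<lambda>r z. take j r @ z # drop j r"
  let ?D = "\<lambda>r. B (?ins r x0) \<inter> V"
  let ?f = "\<lambda>y. (take j y @ drop (Suc j) y, y ! j)"
  have "inj_on ?f {y \<in> tuples V m. y ! j \<in> B y}"
  proof (rule inj_onI)
    fix y y' assume y: "y \<in> {y \<in> tuples V m. y ! j \<in> B y}" "y' \<in> {y \<in> tuples V m. y ! j \<in> B y}"
      and eq: "?f y = ?f y'"
    have l: "length y = m" "length y' = m" using y by (auto simp: tuples_def)
    then have "take j y = take j y'" "drop (Suc j) y = drop (Suc j) y'" "y ! j = y' ! j"
      using eq assms(2) by (auto simp: append_eq_append_conv)
    then show "y = y'" using id_take_nth_drop[of j y] id_take_nth_drop[of j y'] l assms(2) by simp
  qed
  moreover have "?f ` {y \<in> tuples V m. y ! j \<in> B y} \<subseteq> Sigma (tuples V (m - 1)) ?D"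
  proof (rule image_subsetI)
    fix y assume "y \<in> {y \<in> tuples V m. y ! j \<in> B y}"
    then have y: "y \<in> tuples V m" "y ! j \<in> B y" by auto
    have l: "length y = m" "set y \<subseteq> V" using y by (auto simp: tuples_def)
    have "?ins (take j y @ drop (Suc j) y) x0 = y[j := x0]"
      using l assms(2) by (simp add: upd_conv_take_nth_drop)
    then have "B (?ins (take j y @ drop (Suc j) y) x0) = B y" using inv[OF y(1) x0] by simp
    moreover have "take j y @ drop (Suc j) y \<in> tuples V (m - 1)"
      using l assms(2) by (auto simp: tuples_def dest: in_set_takeD in_set_dropD)
    moreover have "y ! j \<in> V" using l assms(2) by auto
    ultimately show "(take j y @ drop (Suc j) y, y ! j) \<in> Sigma (tuples V (m - 1)) ?D"
      using y(2) by simp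
  qed
  moreover have "finite (Sigma (tuples V (m - 1)) ?D)"
    using assms(1) finite_tuples[OF assms(1)] by simp
  ultimately have "card {y \<in> tuples V m. y ! j \<in> B y} \<le> card (Sigma (tuples V (m - 1)) ?D)"
    by (rule card_inj_on_le)
  also have "\<dots> = (\<Sum>r\<in>tuples V (m - 1). card (?D r))"
    using assms(1) finite_tuples[OF assms(1)] by (simp add: card_SigmaI)
  finally have "real (card {y \<in> tuples V m. y ! j \<in> B y}) \<le> (\<Sum>r\<in>tuples V (m - 1). real (card (?D r)))"
    by (simp flip: of_nat_sum)
  also have "\<dots> \<le> (\<Sum>r\<in>tuples V (m - 1). t)"
  proof (rule sum_mono)
    fix r assume r: "r \<in> tuples V (m - 1)"
    have "?ins r x0 \<in> tuples V m"
      using r x0 assms(2) by (auto simp: tuples_def dest: in_set_takeD in_set_dropD)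
    then show "real (card (?D r)) \<le> t" by (rule bd)
  qed
  also have "\<dots> = t * real (card V) ^ (m - 1)"
    using card_tuples[OF assms(1), of "m - 1"] by simp
  finally show ?thesis .
qed

section \<open>Generic tuples\<close>

definition nbhd :: "'a set \<Rightarrow> 'a set set \<Rightarrow> 'a set \<Rightarrow> 'a set" where
  "nbhd V E S = {u \<in> V - S. insert u S \<in> E}"

text \<open>A template is a list in which \<open>Inl i\<close> stands for the \<open>i\<close>-th entry of a tuple still to be chosen and
  \<open>Inr v\<close> for a vertex that is already fixed.\<close>

definition fill :: "(nat + 'a) list \<Rightarrow> 'a list \<Rightarrow> 'a list" where
  "fill \<tau> y = map (\<lambda>s. case s of Inl i \<Rightarrow> y ! i | Inr v \<Rightarrow> v) \<tau>"

lemma length_fill [simp]: "length (fill \<tau> y) = length \<tau>"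
  by (simp add: fill_def)

lemma fill_Inl: "s < length \<tau> \<Longrightarrow> \<tau> ! s = Inl j \<Longrightarrow> fill \<tau> y ! s = y ! j"
  by (simp add: fill_def)

lemma fill_Inr: "s < length \<tau> \<Longrightarrow> \<tau> ! s = Inr v \<Longrightarrow> fill \<tau> y ! s = v"
  by (simp add: fill_def)

lemma fill_update_other:
  assumes "distinct \<tau>" "s < length \<tau>" "\<tau> ! s = Inl j" "p < length \<tau>" "p \<noteq> s"
  shows "fill \<tau> (y[j := z]) ! p = fill \<tau> y ! p"
proof (cases "\<tau> ! p")
  case (Inl i)
  have "\<tau> ! p \<noteq> \<tau> ! s" using nth_eq_iff_index_eq[OF assms(1,4,2)] assms(5) by simp
  then have "i \<noteq> j" using Inl assms(3) by auto
  then show ?thesis using assms Inl by (simp add: fill_Inl)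
next
  case (Inr v)
  then show ?thesis using assms by (simp add: fill_Inr)
qed

lemma fill_in:
  assumes "y \<in> tuples V m" "\<And>j. Inl j \<in> set \<tau> \<Longrightarrow> j < m" "\<And>v. Inr v \<in> set \<tau> \<Longrightarrow> v \<in> V"
    "p < length \<tau>"
  shows "fill \<tau> y ! p \<in> V"
proof (cases "\<tau> ! p")
  case (Inl i)
  then have "i < m" using assms(2,4) by (metis nth_mem)
  then show ?thesis using assms Inl by (auto simp: fill_Inl tuples_def)
next
  case (Inr v)
  then have "v \<in> V" using assms(3,4) by (metis nth_mem)
  then show ?thesis using assms Inr by (simp add: fill_Inr)
qed

text \<open>Once the other coordinates are fixed, the color bound leaves at most \<open>t\<close> choices for a vertex
  that lies in exactly one of two edges of the same color.\<close>

lemma card_color_clash: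
  fixes t :: real
  assumes fin: "finite V" and t: "0 \<le> t"
    and col: "\<And>S i. S \<subseteq> V \<Longrightarrow> card S = k - 1 \<Longrightarrow> real (card {u \<in> nbhd V E S. \<phi> (insert u S) = i}) \<le> t"
    and d\<tau>: "distinct \<tau>" and vars: "\<And>j. Inl j \<in> set \<tau> \<Longrightarrow> j < m"
    and cns: "\<And>v. Inr v \<in> set \<tau> \<Longrightarrow> v \<in> V"
    and P: "P \<subseteq> {..<length \<tau>}" "card P = k" and Q: "Q \<subseteq> {..<length \<tau>}"
    and s: "s \<in> P" "s \<notin> Q" "\<tau> ! s = Inl j"
  shows "real (card {y \<in> tuples V m. distinct (fill \<tau> y) \<and> (!) (fill \<tau> y) ` P \<in> E \<and>
           \<phi> ((!) (fill \<tau> y) ` P) = \<phi> ((!) (fill \<tau> y) ` Q)}) \<le> t * real (card V) ^ (m - 1)"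
proof -
  define S where "S y = (!) (fill \<tau> y) ` (P - {s})" for y
  \<comment> \<open>\<open>B y\<close> is empty when the remaining entries of \<open>P\<close>
    coincide, since the color bound speaks of \<open>(k - 1)\<close>-sets only. As \<open>s\<close>
    is not in \<open>Q\<close>, the color of \<open>Q\<close> does not depend on coordinate
    \<open>j\<close>, which gives the invariance of \<open>B\<close>.\<close>
  define B where "B y = (if card (S y) = k - 1 then
      {u \<in> nbhd V E (S y). \<phi> (insert u (S y)) = \<phi> ((!) (fill \<tau> y) ` Q)} else {})" for y
  have sl: "s < length \<tau>" using P(1) s(1) by auto
  then have j: "j < m" using vars s(3) by (metis nth_mem)
  have upd: "fill \<tau> (y[j := z]) ! p = fill \<tau> y ! p" if "p < length \<tau>" "p \<noteq> s" for y z p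
    using fill_update_other[OF d\<tau> sl s(3) that] .
  have "real (card {y \<in> tuples V m. y ! j \<in> B y}) \<le> t * real (card V) ^ (m - 1)"
  proof (rule card_bad_coordinate[OF fin j _ _ t])
    fix y z assume "y \<in> tuples V m" "z \<in> V"
    have "S (y[j := z]) = S y" unfolding S_def
      by (rule image_cong) (use P(1) in \<open>auto intro!: upd\<close>)
    moreover have "(!) (fill \<tau> (y[j := z])) ` Q = (!) (fill \<tau> y) ` Q"
      by (rule image_cong) (use Q s(2) in \<open>auto intro!: upd\<close>)
    ultimately show "B (y[j := z]) = B y" by (simp add: B_def)
  next
    fix y assume y: "y \<in> tuples V m"
    have "S y \<subseteq> V" unfolding S_def using P(1) fill_in[OF y vars cns] by auto
    moreover have "B y \<inter> V = B y" by (auto simp: B_def nbhd_def)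
    ultimately show "real (card (B y \<inter> V)) \<le> t"
      using col[of "S y"] t by (auto simp: B_def)
  qed
  moreover have "{y \<in> tuples V m. distinct (fill \<tau> y) \<and> (!) (fill \<tau> y) ` P \<in> E \<and>
           \<phi> ((!) (fill \<tau> y) ` P) = \<phi> ((!) (fill \<tau> y) ` Q)} \<subseteq> {y \<in> tuples V m. y ! j \<in> B y}"
  proof clarify
    fix y assume y: "y \<in> tuples V m" "distinct (fill \<tau> y)" "(!) (fill \<tau> y) ` P \<in> E"
      "\<phi> ((!) (fill \<tau> y) ` P) = \<phi> ((!) (fill \<tau> y) ` Q)"
    have inj: "inj_on ((!) (fill \<tau> y)) P"
      using y(2) P(1) by (intro inj_on_nth) auto
    have yj: "y ! j = fill \<tau> y ! s" using sl s(3) by (simp add: fill_Inl)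
    have ins: "insert (y ! j) (S y) = (!) (fill \<tau> y) ` P" unfolding S_def yj using s(1) by auto
    have "card (S y) = card (P - {s})" unfolding S_def
      using inj by (intro card_image) (auto intro: inj_on_subset)
    then have "card (S y) = k - 1" using P(2) s(1) by simp
    moreover have "y ! j \<notin> S y" unfolding S_def yj using inj s(1) by (auto simp: inj_on_def)
    moreover have "y ! j \<in> V" unfolding yj by (rule fill_in[OF y(1) vars cns sl])
    ultimately show "y ! j \<in> B y" using y(3,4) ins by (simp add: B_def nbhd_def)
  qed
  moreover have "finite {y \<in> tuples V m. y ! j \<in> B y}" using finite_tuples[OF fin] by simp
  ultimately show ?thesis
    by (meson card_mono of_nat_mono order_trans)
qed

text \<open>If one of the two positions is variable, its value is forced by the other coordinates;
  if both are fixed, a distinct template carries different vertices there.\<close>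

lemma card_coincidence:
  assumes fin: "finite V" and d\<tau>: "distinct \<tau>" and vars: "\<And>j. Inl j \<in> set \<tau> \<Longrightarrow> j < m"
    and p: "p < length \<tau>" "q < length \<tau>" "p \<noteq> q"
  shows "real (card {y \<in> tuples V m. fill \<tau> y ! p = fill \<tau> y ! q}) \<le> real (card V) ^ (m - 1)"
proof -
  have *: "real (card {y \<in> tuples V m. fill \<tau> y ! p = fill \<tau> y ! q}) \<le> real (card V) ^ (m - 1)"
    if "\<tau> ! p = Inl j" "p < length \<tau>" "q < length \<tau>" "p \<noteq> q" for p q j
  proof -
    have j: "j < m" using vars that by (metis nth_mem)
    have "real (card {y \<in> tuples V m. y ! j \<in> {fill \<tau> y ! q}}) \<le> 1 * real (card V) ^ (m - 1)"
    proof (rule card_bad_coordinate[OF fin j])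
      fix y z assume "y \<in> tuples V m" "z \<in> V"
      show "{fill \<tau> (y[j := z]) ! q} = {fill \<tau> y ! q}"
        using fill_update_other[OF d\<tau> that(2,1,3)] that(4) by auto
    next
      fix y
      have "card ({fill \<tau> y ! q} \<inter> V) \<le> card {fill \<tau> y ! q}" by (rule card_mono) auto
      then show "real (card ({fill \<tau> y ! q} \<inter> V)) \<le> 1" by simp
    qed simp
    then show "real (card {y \<in> tuples V m. fill \<tau> y ! p = fill \<tau> y ! q}) \<le> real (card V) ^ (m - 1)"
      using that by (simp add: fill_Inl)
  qed
  show ?thesis
  proof (cases "\<tau> ! p")
    case (Inl j)
    then show ?thesis using *[OF Inl p] by simp
  next
    case p': (Inr v)
    show ?thesis
    proof (cases "\<tau> ! q")
      case (Inl j)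
      then show ?thesis using *[OF Inl p(2,1)] p(3) by (simp add: eq_commute)
    next
      case (Inr w)
      have "\<tau> ! p \<noteq> \<tau> ! q" using nth_eq_iff_index_eq[OF d\<tau> p(1,2)] p(3) by simp
      then have "{y \<in> tuples V m. fill \<tau> y ! p = fill \<tau> y ! q} = {}"
        using p p' Inr by (auto simp: fill_Inr)
      then show ?thesis by (metis card.empty of_nat_0 of_nat_0_le_iff zero_le_power)
    qed
  qed
qed

text \<open>The two index intervals form the symmetric difference of the windows. Pairs differing
  only in fixed vertices are left out because no choice of \<open>y\<close> can be blamed for their
  clash; each application treats them separately. \<open>Z\<close> is a small set of vertices to be
  avoided.\<close>

definition generic :: "nat \<Rightarrow> 'a set set \<Rightarrow> ('a set \<Rightarrow> nat) \<Rightarrow> 'a set \<Rightarrow> (nat + 'a) list \<Rightarrow> 'a list \<Rightarrow> bool" where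
  "generic k E \<phi> Z \<tau> y \<longleftrightarrow> distinct (fill \<tau> y) \<and> set y \<inter> Z = {} \<and>
     (\<forall>p q. p < q \<longrightarrow> q < p + k \<longrightarrow> q + k \<le> length \<tau> \<longrightarrow>
        win k (fill \<tau> y) p \<in> E \<longrightarrow> win k (fill \<tau> y) q \<in> E \<longrightarrow>
        (\<exists>s\<in>{p..<q} \<union> {p + k..<q + k}. \<exists>j. \<tau> ! s = Inl j) \<longrightarrow>
        \<phi> (win k (fill \<tau> y) p) \<noteq> \<phi> (win k (fill \<tau> y) q))"

text \<open>Union bound over pairs of positions (coincidences and color clashes, hence the factor 2)
  and over the \<open>m\<close> coordinates that may fall into \<open>Z\<close>. With
  \<open>1 \<le> t\<close> the bound \<open>t\<close> also covers coincidences, which leave a single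
  value.\<close>

lemma card_not_generic:
  fixes t :: real
  assumes fin: "finite V" and t: "1 \<le> t"
    and col: "\<And>S i. S \<subseteq> V \<Longrightarrow> card S = k - 1 \<Longrightarrow> real (card {u \<in> nbhd V E S. \<phi> (insert u S) = i}) \<le> t"
    and d\<tau>: "distinct \<tau>" and vars: "\<And>j. Inl j \<in> set \<tau> \<Longrightarrow> j < m"
    and cns: "\<And>v. Inr v \<in> set \<tau> \<Longrightarrow> v \<in> V"
    and Z: "finite Z" "real (card Z) \<le> t"
  shows "real (card {y \<in> tuples V m. \<not> generic k E \<phi> Z \<tau> y})
    \<le> (2 * real (length \<tau>) ^ 2 + real m) * t * real (card V) ^ (m - 1)"
proof -
  let ?n = "real (card V) ^ (m - 1)"
  let ?I = "{..<length \<tau>} \<times> {..<length \<tau>}"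
  let ?A = "\<lambda>(p, q). if p \<noteq> q then {y \<in> tuples V m. fill \<tau> y ! p = fill \<tau> y ! q} else {}"
  let ?clash = "\<lambda>p q. p < q \<and> q < p + k \<and> q + k \<le> length \<tau> \<and>
     (\<exists>s\<in>{p..<q} \<union> {p + k..<q + k}. \<exists>j. \<tau> ! s = Inl j)"
  let ?C = "\<lambda>(p, q). if ?clash p q then
     {y \<in> tuples V m. distinct (fill \<tau> y) \<and> win k (fill \<tau> y) p \<in> E \<and> win k (fill \<tau> y) q \<in> E \<and>
        \<phi> (win k (fill \<tau> y) p) = \<phi> (win k (fill \<tau> y) q)} else {}"
  let ?B = "\<lambda>j. {y \<in> tuples V m. y ! j \<in> Z}"
  have t0: "0 \<le> t" using t by simp
  have finT: "finite (tuples V m)" by (rule finite_tuples[OF fin])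
  have A: "real (card (?A pq)) \<le> t * ?n" if "pq \<in> ?I" for pq
  proof -
    obtain p q where pq: "pq = (p, q)" by fastforce
    have "real (card (?A pq)) \<le> 1 * ?n"
      using card_coincidence[OF fin d\<tau> vars, of p q] that pq by auto
    also have "\<dots> \<le> t * ?n" using t by (intro mult_right_mono) auto
    finally show ?thesis .
  qed
  have C: "real (card (?C pq)) \<le> t * ?n" if "pq \<in> ?I" for pq
  proof -
    obtain p q where pq: "pq = (p, q)" by fastforce
    show ?thesis
    proof (cases "?clash p q")
      case False
      then have "?C pq = {}" by (simp only: pq prod.case False if_False)
      then show ?thesis using t0 by simp
    next
      case True
      then obtain s j where s: "s \<in> {p..<q} \<union> {p + k..<q + k}" "\<tau> ! s = Inl j" by blast
      let ?P = "{p..<p + k}" and ?Q = "{q..<q + k}"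
      have sub: "?P \<subseteq> {..<length \<tau>}" "?Q \<subseteq> {..<length \<tau>}" using True by auto
      have cd: "card ?P = k" "card ?Q = k" by auto
      have "s \<in> ?P \<and> s \<notin> ?Q \<or> s \<in> ?Q \<and> s \<notin> ?P" using s(1) True by auto
      then show ?thesis
      proof
        assume "s \<in> ?P \<and> s \<notin> ?Q"
        then have b: "real (card {y \<in> tuples V m. distinct (fill \<tau> y) \<and> (!) (fill \<tau> y) ` ?P \<in> E \<and>
           \<phi> ((!) (fill \<tau> y) ` ?P) = \<phi> ((!) (fill \<tau> y) ` ?Q)}) \<le> t * ?n"
          using card_color_clash[OF fin t0 col d\<tau> vars cns sub(1) cd(1) sub(2), of s j] s(2) by blast
        have "card (?C pq) \<le> card {y \<in> tuples V m. distinct (fill \<tau> y) \<and> (!) (fill \<tau> y) ` ?P \<in> E \<and>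
           \<phi> ((!) (fill \<tau> y) ` ?P) = \<phi> ((!) (fill \<tau> y) ` ?Q)}"
          using True pq finT by (intro card_mono) (auto simp: win_def)
        with b show ?thesis by linarith
      next
        assume "s \<in> ?Q \<and> s \<notin> ?P"
        then have b: "real (card {y \<in> tuples V m. distinct (fill \<tau> y) \<and> (!) (fill \<tau> y) ` ?Q \<in> E \<and>
           \<phi> ((!) (fill \<tau> y) ` ?Q) = \<phi> ((!) (fill \<tau> y) ` ?P)}) \<le> t * ?n"
          using card_color_clash[OF fin t0 col d\<tau> vars cns sub(2) cd(2) sub(1), of s j] s(2) by blast
        have "card (?C pq) \<le> card {y \<in> tuples V m. distinct (fill \<tau> y) \<and> (!) (fill \<tau> y) ` ?Q \<in> E \<and>
           \<phi> ((!) (fill \<tau> y) ` ?Q) = \<phi> ((!) (fill \<tau> y) ` ?P)}"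
          using True pq finT by (intro card_mono) (auto simp: win_def)
        with b show ?thesis by linarith
      qed
    qed
  qed
  have B: "real (card (?B j)) \<le> t * ?n" if "j \<in> {..<m}" for j
  proof (rule card_bad_coordinate[OF fin, where B = "\<lambda>_. Z"])
    show "real (card (Z \<inter> V)) \<le> t" using Z card_mono[of Z "Z \<inter> V"] by auto
  qed (use that t0 in auto)
  have "{y \<in> tuples V m. \<not> generic k E \<phi> Z \<tau> y}
      \<subseteq> (\<Union>pq\<in>?I. ?A pq) \<union> (\<Union>pq\<in>?I. ?C pq) \<union> (\<Union>j\<in>{..<m}. ?B j)"
  proof
    fix y assume "y \<in> {y \<in> tuples V m. \<not> generic k E \<phi> Z \<tau> y}"
    then have y: "y \<in> tuples V m" "\<not> generic k E \<phi> Z \<tau> y" by auto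
    show "y \<in> (\<Union>pq\<in>?I. ?A pq) \<union> (\<Union>pq\<in>?I. ?C pq) \<union> (\<Union>j\<in>{..<m}. ?B j)"
    proof (cases "distinct (fill \<tau> y)")
      case False
      then obtain p q where "p < length \<tau>" "q < length \<tau>" "p \<noteq> q" "fill \<tau> y ! p = fill \<tau> y ! q"
        by (auto simp: distinct_conv_nth)
      then have "(p, q) \<in> ?I" "y \<in> ?A (p, q)" using y(1) by auto
      then show ?thesis by blast
    next
      case d: True
      show ?thesis
      proof (cases "set y \<inter> Z = {}")
        case False
        then obtain j where "j < m" "y ! j \<in> Z" using y(1) by (auto simp: tuples_def in_set_conv_nth)
        then show ?thesis using y(1) by blast
      next
        case True
        then obtain p q where "?clash p q" "win k (fill \<tau> y) p \<in> E" "win k (fill \<tau> y) q \<in> E"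
          "\<phi> (win k (fill \<tau> y) p) = \<phi> (win k (fill \<tau> y) q)"
          using y(2) d unfolding generic_def by blast
        moreover from this have "(p, q) \<in> ?I" by (auto)
        ultimately have "(p, q) \<in> ?I" "y \<in> ?C (p, q)" using y(1) d by auto
        then show ?thesis by blast
      qed
    qed
  qed
  moreover have "finite ((\<Union>pq\<in>?I. ?A pq) \<union> (\<Union>pq\<in>?I. ?C pq) \<union> (\<Union>j\<in>{..<m}. ?B j))"
    using finT by auto
  ultimately have "card {y \<in> tuples V m. \<not> generic k E \<phi> Z \<tau> y}
      \<le> card ((\<Union>pq\<in>?I. ?A pq) \<union> (\<Union>pq\<in>?I. ?C pq) \<union> (\<Union>j\<in>{..<m}. ?B j))"
    by (rule card_mono[rotated])
  also have "\<dots> \<le> card (\<Union>pq\<in>?I. ?A pq) + card (\<Union>pq\<in>?I. ?C pq) + card (\<Union>j\<in>{..<m}. ?B j)"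
    using card_Un_le[of "(\<Union>pq\<in>?I. ?A pq) \<union> (\<Union>pq\<in>?I. ?C pq)" "\<Union>j\<in>{..<m}. ?B j"]
      card_Un_le[of "\<Union>pq\<in>?I. ?A pq" "\<Union>pq\<in>?I. ?C pq"] by linarith
  also have "\<dots> \<le> (\<Sum>pq\<in>?I. card (?A pq)) + (\<Sum>pq\<in>?I. card (?C pq)) + (\<Sum>j\<in>{..<m}. card (?B j))"
    by (intro add_mono card_UN_le) auto
  finally have "real (card {y \<in> tuples V m. \<not> generic k E \<phi> Z \<tau> y})
      \<le> real ((\<Sum>pq\<in>?I. card (?A pq)) + (\<Sum>pq\<in>?I. card (?C pq)) + (\<Sum>j\<in>{..<m}. card (?B j)))"
    by (rule of_nat_mono)
  also have "\<dots> = (\<Sum>pq\<in>?I. real (card (?A pq))) + (\<Sum>pq\<in>?I. real (card (?C pq)))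
      + (\<Sum>j\<in>{..<m}. real (card (?B j)))"
    by (simp only: of_nat_add of_nat_sum)
  also have "\<dots> \<le> (\<Sum>pq\<in>?I. t * ?n) + (\<Sum>pq\<in>?I. t * ?n) + (\<Sum>j\<in>{..<m}. t * ?n)"
    by (intro add_mono sum_mono A B C)
  also have "\<dots> = (2 * real (length \<tau>) ^ 2 + real m) * t * ?n"
    by (simp add: card_cartesian_product power2_eq_square algebra_simps)
  finally show ?thesis .
qed

text \<open>The parameter \<open>\<eta>\<close> bounds the color degrees and, through \<open>1 \<le> \<eta> * card V\<close>, also forces \<open>V\<close> to be
  large, so that decreasing \<open>\<eta>\<close> is the only way in which constants are adjusted.\<close>

definition setting :: "nat \<Rightarrow> real \<Rightarrow> real \<Rightarrow> 'a set \<Rightarrow> 'a set set \<Rightarrow> ('a set \<Rightarrow> nat) \<Rightarrow> bool" where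
  "setting k \<gamma> \<eta> V E \<phi> \<longleftrightarrow> finite V \<and> (\<forall>e\<in>E. e \<subseteq> V \<and> card e = k) \<and>
     (\<forall>S. S \<subseteq> V \<longrightarrow> card S = k - 1 \<longrightarrow> (1/2 + \<gamma>) * real (card V) \<le> real (card (nbhd V E S))) \<and>
     (\<forall>S i. S \<subseteq> V \<longrightarrow> card S = k - 1 \<longrightarrow>
        real (card {u \<in> nbhd V E S. \<phi> (insert u S) = i}) \<le> \<eta> * real (card V)) \<and>
     1 \<le> \<eta> * real (card V)"

lemma setting_mono: "setting k \<gamma> \<eta> V E \<phi> \<Longrightarrow> \<eta> \<le> \<eta>' \<Longrightarrow> setting k \<gamma> \<eta>' V E \<phi>"
proof -
  assume *: "setting k \<gamma> \<eta> V E \<phi>" "\<eta> \<le> \<eta>'"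
  then have "\<eta> * real (card V) \<le> \<eta>' * real (card V)" by (simp add: mult_right_mono)
  then show ?thesis using *(1) unfolding setting_def by (meson order_trans)
qed

text \<open>At most \<open>(2 * length^2 + m) * \<eta> * card V ^ m\<close> tuples fail to be
  generic, which is at most half of \<open>X\<close> once \<open>\<eta>\<close> is small compared
  with \<open>\<beta>\<close> and the lengths.\<close>

lemma many_generic:
  assumes "setting k \<gamma> \<eta> V E \<phi>"
    and "distinct \<tau>" "\<And>j. Inl j \<in> set \<tau> \<Longrightarrow> j < m" "\<And>v. Inr v \<in> set \<tau> \<Longrightarrow> v \<in> V" "1 \<le> m"
    and "finite Z" "real (card Z) \<le> \<eta> * real (card V)"
    and "X \<subseteq> tuples V m" "\<beta> * real (card V) ^ m \<le> real (card X)"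
    and small: "(2 * real (length \<tau>) ^ 2 + real m) * \<eta> \<le> \<beta> / 2"
  shows "\<beta> / 2 * real (card V) ^ m \<le> real (card {y \<in> X. generic k E \<phi> Z \<tau> y})"
proof -
  have fin: "finite V" and t: "1 \<le> \<eta> * real (card V)"
    and col: "\<And>S i. S \<subseteq> V \<Longrightarrow> card S = k - 1 \<Longrightarrow>
      real (card {u \<in> nbhd V E S. \<phi> (insert u S) = i}) \<le> \<eta> * real (card V)"
    using assms(1) unfolding setting_def by auto
  have finT: "finite (tuples V m)" by (rule finite_tuples[OF fin])
  have finX: "finite X" using assms(8) finT finite_subset by blast
  let ?G = "{y \<in> X. generic k E \<phi> Z \<tau> y}" and ?N = "{y \<in> tuples V m. \<not> generic k E \<phi> Z \<tau> y}"
  have "card X \<le> card (?G \<union> ?N)"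
    using assms(8) finX finT by (intro card_mono) auto
  then have "card X \<le> card ?G + card ?N" using card_Un_le order_trans by blast
  then have X: "real (card X) \<le> real (card ?G) + real (card ?N)" by linarith
  have "real (card ?N) \<le> (2 * real (length \<tau>) ^ 2 + real m) * (\<eta> * real (card V)) * real (card V) ^ (m - 1)"
    using card_not_generic[OF fin t col assms(2) assms(3) assms(4) assms(6,7)] by simp
  also have "\<dots> = ((2 * real (length \<tau>) ^ 2 + real m) * \<eta>) * real (card V) ^ m"
    using assms(5) by (simp add: power_eq_if[of _ m])
  also have "\<dots> \<le> \<beta> / 2 * real (card V) ^ m"
    using small by (intro mult_right_mono) auto
  finally show ?thesis using X assms(9) by (simp add: field_simps)
qed

section \<open>Connecting walks\<close>

definition link :: "'a set set \<Rightarrow> 'a \<Rightarrow> 'a set set" where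
  "link E v = {S. v \<notin> S \<and> insert v S \<in> E}"

text \<open>After every \<open>r\<close> entries of \<open>s\<close> one entry of \<open>vs\<close>
  is inserted, so every \<open>r + 1\<close> consecutive entries contain exactly one of them.
  Exactly \<open>p div Suc r\<close> insertions precede position \<open>p\<close>, which explains
  the index into \<open>s\<close>.\<close>

definition interleave :: "nat \<Rightarrow> 'a list \<Rightarrow> 'a list \<Rightarrow> 'a list" where
  "interleave r s vs = map (\<lambda>p. if p mod Suc r = r then vs ! (p div Suc r) else s ! (p - p div Suc r))
     [0..<length s + length vs]"

lemma length_interleave [simp]: "length (interleave r s vs) = length s + length vs"
  by (simp add: interleave_def)

lemma nth_interleave_v:
  assumes "j * Suc r + r < length s + length vs"
  shows "interleave r s vs ! (j * Suc r + r) = vs ! j"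
proof -
  have "(j * Suc r + r) mod Suc r = r" "(j * Suc r + r) div Suc r = j"
    by (metis lessI mod_less mod_mult_self3, metis add.right_neutral div_less div_mult_self3 lessI nat.simps(3))
  then show ?thesis using assms by (simp add: interleave_def)
qed

lemma nth_interleave_s:
  assumes "t < r" "j * Suc r + t < length s + length vs"
  shows "interleave r s vs ! (j * Suc r + t) = s ! (j * r + t)"
proof -
  have "(j * Suc r + t) mod Suc r = t" "(j * Suc r + t) div Suc r = j"
    using assms(1) by (simp_all del: mult_Suc_right)
  then show ?thesis using assms by (simp add: interleave_def)
qed

text \<open>The window takes the last \<open>r - t\<close> entries of block \<open>j\<close>, then
  \<open>vs ! j\<close>, then the first \<open>t\<close> entries of block \<open>j + 1\<close>; the
  entries of \<open>s\<close> among them are \<open>r\<close> consecutive ones.\<close>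

lemma win_interleave:
  assumes "p = j * Suc r + t" "t \<le> r" "p + Suc r \<le> length s + length vs"
  shows "win (Suc r) (interleave r s vs) p = insert (vs ! j) (win r s (j * r + t))"
proof
  let ?W = "interleave r s vs"
  show "win (Suc r) ?W p \<subseteq> insert (vs ! j) (win r s (j * r + t))"
  proof
    fix x assume "x \<in> win (Suc r) ?W p"
    then obtain i where i: "p \<le> i" "i < p + Suc r" "x = ?W ! i" by (auto simp: win_def)
    consider "i < j * Suc r + r" | "i = j * Suc r + r" | "i > j * Suc r + r" by linarith
    then show "x \<in> insert (vs ! j) (win r s (j * r + t))"
    proof cases
      case 1
      define u where "u = i - j * Suc r"
      have u: "i = j * Suc r + u" "u < r" "t \<le> u" using 1 i assms by (auto simp: u_def)
      then have "x = s ! (j * r + u)" using nth_interleave_s[of u r j s vs] i assms by simp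
      then show ?thesis using u by (auto simp: win_def)
    next
      case 2
      then show ?thesis using nth_interleave_v[of j r s vs] i assms by simp
    next
      case 3
      define u where "u = i - Suc j * Suc r"
      have u: "i = Suc j * Suc r + u" "u < t" using 3 i assms by (auto simp: u_def)
      then have "x = s ! (Suc j * r + u)" using nth_interleave_s[of u r "Suc j" s vs] i assms by simp
      moreover have "Suc j * r + u \<in> {j * r + t..<j * r + t + r}" using u assms(2) by auto
      ultimately show ?thesis by (auto simp: win_def)
    qed
  qed
  show "insert (vs ! j) (win r s (j * r + t)) \<subseteq> win (Suc r) ?W p"
  proof
    fix x assume "x \<in> insert (vs ! j) (win r s (j * r + t))"
    then consider "x = vs ! j" | i where "x = s ! i" "j * r + t \<le> i" "i < j * r + t + r"
      by (auto simp: win_def)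
    then show "x \<in> win (Suc r) ?W p"
    proof cases
      case 1
      then have "x = ?W ! (j * Suc r + r)" using nth_interleave_v[of j r s vs] assms by simp
      moreover have "j * Suc r + r \<in> {p..<p + Suc r}" using assms by auto
      ultimately show ?thesis unfolding win_def by blast
    next
      case 2
      show ?thesis
      proof (cases "i < j * r + r")
        case True
        define u where "u = i - j * r"
        have u: "i = j * r + u" "u < r" "t \<le> u" using 2 True by (auto simp: u_def)
        then have "x = ?W ! (j * Suc r + u)" using 2 assms nth_interleave_s[of u r j s vs] by simp
        moreover have "j * Suc r + u \<in> {p..<p + Suc r}" using assms u by auto
        ultimately show ?thesis unfolding win_def by blast
      next
        case False
        define u where "u = i - Suc j * r"
        have u: "i = Suc j * r + u" "u < t" using 2 False by (auto simp: u_def)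
        then have "x = ?W ! (Suc j * Suc r + u)" using 2 assms nth_interleave_s[of u r "Suc j" s vs] by simp
        moreover have "Suc j * Suc r + u \<in> {p..<p + Suc r}" using assms u by auto
        ultimately show ?thesis unfolding win_def by blast
      qed
    qed
  qed
qed

text \<open>Needed to count interleavings without multiplicity. The lengths describe
  \<open>q + 2\<close> blocks of \<open>s\<close>, the outer two being the ends to be joined, with
  one entry of \<open>vs\<close> in each of the \<open>q + 1\<close> gaps.\<close>

lemma interleave_inject:
  assumes "interleave r s vs = interleave r s' vs'" "length s = r * Suc (Suc q)" "length s' = length s"
    "length vs = Suc q" "length vs' = Suc q" "1 \<le> r"
  shows "s = s' \<and> vs = vs'"
proof
  show "s = s'"
  proof (rule nth_equalityI)
    fix i assume i: "i < length s"
    define j t where "j = i div r" and "t = i mod r"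
    have it: "i = j * r + t" "t < r" using assms(6) by (auto simp: j_def t_def)
    have "j < Suc (Suc q)" using i assms(2,6) by (simp add: j_def less_mult_imp_div_less mult.commute)
    then have "j * Suc r + t < length s + length vs" using i it assms(4) by simp
    then show "s ! i = s' ! i"
      using nth_interleave_s[OF it(2), of j s vs] nth_interleave_s[OF it(2), of j s' vs'] assms it by simp
  qed (use assms in simp)
  show "vs = vs'"
  proof (rule nth_equalityI)
    fix j assume j: "j < length vs"
    have "j * Suc r \<le> q * Suc r" using j assms(4) by (intro mult_le_mono1) simp
    then have "j * Suc r + r < length s + length vs" using assms by (simp add: algebra_simps)
    then show "vs ! j = vs' ! j"
      using nth_interleave_v[of j r s vs] nth_interleave_v[of j r s' vs'] assms by simp
  qed (use assms in simp)
qed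

text \<open>The blocks \<open>a\<close> and \<open>b\<close> come first and last and receive no
  inserted vertex, so the interleaving still starts with \<open>a\<close> and ends with
  \<open>b\<close>.\<close>

lemma interleave_ends:
  assumes "length a = r" "length b = r" "length x = r * q" "length vs = Suc q"
  shows "\<exists>y. length y = Suc r * q + 1 \<and> set y \<subseteq> set x \<union> set vs \<and> interleave r (a @ x @ b) vs = a @ y @ b"
proof -
  let ?s = "a @ x @ b"
  let ?W = "interleave r ?s vs"
  define y where "y = take (Suc r * q + 1) (drop r ?W)"
  have lW: "length ?W = r + (Suc r * q + 1) + r" using assms by simp
  have a: "take r ?W = a"
  proof (rule nth_equalityI)
    fix i assume "i < length (take r ?W)"
    then have i: "i < r" by simp
    then show "take r ?W ! i = a ! i"
      using nth_interleave_s[of i r 0 ?s vs] assms by (simp add: nth_append)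
  qed (use assms in simp)
  have b: "drop (r + (Suc r * q + 1)) ?W = b"
  proof (rule nth_equalityI)
    fix i assume "i < length (drop (r + (Suc r * q + 1)) ?W)"
    then have i: "i < r" using lW by simp
    have "drop (r + (Suc r * q + 1)) ?W ! i = ?W ! (Suc q * Suc r + i)"
      using lW i by (simp add: algebra_simps)
    also have "\<dots> = ?s ! (Suc q * r + i)"
      using nth_interleave_s[OF i, of "Suc q" ?s vs] i assms by simp
    also have "\<dots> = b ! i" using assms by (simp add: nth_append algebra_simps)
    finally show "drop (r + (Suc r * q + 1)) ?W ! i = b ! i" .
  qed (use lW assms in simp)
  have "?W = take r ?W @ take (Suc r * q + 1) (drop r ?W) @ drop (Suc r * q + 1) (drop r ?W)"
    by (metis append_take_drop_id)
  moreover have "drop (Suc r * q + 1) (drop r ?W) = drop (r + (Suc r * q + 1)) ?W"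
    by (simp only: drop_drop add.commute)
  ultimately have W: "?W = a @ y @ b" using a b unfolding y_def by simp
  have ly: "length y = Suc r * q + 1" using lW by (simp add: y_def)
  have "set y \<subseteq> set x \<union> set vs"
  proof
    fix z assume "z \<in> set y"
    then obtain i where i: "i < Suc r * q + 1" "z = y ! i" using ly by (auto simp: in_set_conv_nth)
    then have z: "z = ?W ! (r + i)" using W assms(1) ly by (simp add: nth_append)
    define j t where "j = (r + i) div Suc r" and "t = (r + i) mod Suc r"
    have ri: "r + i = j * Suc r + t" "t \<le> r"
      by (simp_all only: j_def t_def div_mult_mod_eq) (metis less_Suc_eq_le mod_less_divisor zero_less_Suc)
    have "r + i < Suc q * Suc r" using i by (simp add: algebra_simps)
    then have jq: "j < Suc q" unfolding j_def using less_mult_imp_div_less by blast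
    have bd: "j * Suc r + t < length ?s + length vs" using ri i assms by simp
    show "z \<in> set x \<union> set vs"
    proof (cases "t = r")
      case True
      then have "z = vs ! j" using z ri nth_interleave_v[of j r ?s vs] bd by simp
      then show ?thesis using jq assms(4) by auto
    next
      case False
      then have t: "t < r" using ri by simp
      then have "z = ?s ! (j * r + t)" using z ri nth_interleave_s[OF t bd] by simp
      moreover have "1 \<le> j" using ri t by (cases j) auto
      then have "r \<le> j * r" by (cases j) auto
      moreover have "j * r + t < r + r * q"
      proof -
        have "j * r \<le> q * r" using jq by simp
        with t have "j * r + t < r + q * r" by linarith
        then show ?thesis by (simp add: mult.commute)
      qed
      ultimately obtain e where e: "z = ?s ! e" "r \<le> e" "e < r + r * q"
        using that[of "j * r + t"] by linarith
      then have "z = x ! (e - r)" "e - r < length x"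
        using assms by (auto simp: nth_append)
      then show ?thesis by auto
    qed
  qed
  with W ly show ?thesis by blast
qed

text \<open>A window is some \<open>v\<close> in \<open>vs\<close> with \<open>r\<close> consecutive
  entries of \<open>a @ x @ b\<close>. These are \<open>a\<close>, or \<open>b\<close>, where
  \<open>v\<close> is a common neighbor, or they lie in \<open>tl a @ x @ butlast b\<close>, a walk
  in the link of \<open>v\<close>.\<close>

lemma walk_interleave:
  assumes len: "length a = r" "length b = r" "length x = r * q" "length vs = Suc q" and r: "1 \<le> r"
    and v: "\<And>v. v \<in> set vs \<Longrightarrow> insert v (set a) \<in> E \<and> insert v (set b) \<in> E \<and>
       walk r (link E v) (tl a @ x @ butlast b)"
  shows "walk (Suc r) E (interleave r (a @ x @ b) vs)"
  unfolding walk_def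
proof (intro allI impI)
  let ?s = "a @ x @ b"
  fix p assume p: "p + Suc r \<le> length (interleave r ?s vs)"
  define j t where "j = p div Suc r" and "t = p mod Suc r"
  have pt: "p = j * Suc r + t" "t \<le> r"
    by (simp_all only: j_def t_def div_mult_mod_eq) (metis less_Suc_eq_le mod_less_divisor zero_less_Suc)
  have "p < Suc q * Suc r" using p len by (simp add: algebra_simps)
  then have jq: "j < Suc q" unfolding j_def using less_mult_imp_div_less by blast
  then have vj: "vs ! j \<in> set vs" using len by simp
  let ?i = "j * r + t"
  have "j * r \<le> q * r" using jq by (intro mult_le_mono1) simp
  then have "?i \<le> q * r + r" using pt(2) by linarith
  then have i: "?i + r \<le> length ?s" using len by (simp add: mult.commute)
  have W: "win (Suc r) (interleave r ?s vs) p = insert (vs ! j) (win r ?s ?i)"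
    using win_interleave[OF pt, of ?s vs] p by simp
  consider "?i = 0" | "?i + r = length ?s" | "0 < ?i" "?i + r < length ?s" using i by linarith
  then show "win (Suc r) (interleave r ?s vs) p \<in> E"
  proof cases
    case 1
    have "win r (a @ x @ b) 0 = set a" using win_middle[of a r "[]" "x @ b"] len by simp
    then show ?thesis using W 1 v[OF vj] by simp
  next
    case 2
    then have "?i = length (a @ x)" using len by simp
    moreover have "win r ((a @ x) @ b @ []) (length (a @ x)) = set b" by (rule win_middle) (rule len)
    ultimately show ?thesis using W v[OF vj] by simp
  next
    case 3
    let ?m = "tl a @ x @ butlast b"
    have ab: "a = [hd a] @ tl a" "b = butlast b @ [last b]"
      using len r by (cases a; simp) (cases "b = []"; use len r in auto)
    have "length ?m + 2 = length ?s" using len r by simp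
    then have bd: "?i - 1 + r \<le> length ?m" using 3 by linarith
    have "?s = [hd a] @ ?m @ [last b]" using ab by (metis append.assoc)
    then have "win r ?s ?i = win r ([hd a] @ ?m @ [last b]) ?i" by simp
    also have "\<dots> = win r (?m @ [last b]) (?i - 1)"
      using 3(1) win_append2[of "[hd a]" ?i r "?m @ [last b]"] by (simp del: add_is_0 neq0_conv add_gr_0)
    also have "\<dots> = win r ?m (?i - 1)"
      using bd by (rule win_append1)
    finally have eq: "win r ?s ?i = win r ?m (?i - 1)" .
    have "win r ?m (?i - 1) \<in> link E (vs ! j)"
      using v[OF vj] bd unfolding walk_def by blast
    then show ?thesis using W eq by (simp add: link_def)
  qed
qed

section \<open>Averaging\<close>

lemma double_count:
  assumes "finite A" "finite B"
  shows "(\<Sum>a\<in>A. real (card {b \<in> B. R a b})) = (\<Sum>b\<in>B. real (card {a \<in> A. R a b}))"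
proof -
  have "(\<Sum>a\<in>A. card {b \<in> B. R a b}) = (\<Sum>b\<in>B. card {a \<in> A. R a b})"
    by (rule sum_multicount_gen) (use assms in auto)
  then show ?thesis by (simp flip: of_nat_sum)
qed

text \<open>Among the at least \<open>L * card A\<close> related pairs, the elements
  \<open>b\<close> with fewer than \<open>\<theta>\<close> partners account for at most
  \<open>L * card A / 2\<close>. The rest belongs to popular elements, each of which has at most
  \<open>card A\<close> partners.\<close>

lemma popular_many:
  fixes L \<theta> :: real
  assumes "finite A" "finite B" "A \<noteq> {}" "0 \<le> \<theta>"
    and L: "\<And>a. a \<in> A \<Longrightarrow> L \<le> real (card {b \<in> B. R a b})"
    and \<theta>: "\<theta> * real (card B) \<le> L * real (card A) / 2"
  shows "L / 2 \<le> real (card {b \<in> B. \<theta> \<le> real (card {a \<in> A. R a b})})"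
proof -
  let ?d = "\<lambda>b. real (card {a \<in> A. R a b})"
  let ?G = "{b \<in> B. \<theta> \<le> ?d b}"
  have "L * real (card A) \<le> (\<Sum>a\<in>A. real (card {b \<in> B. R a b}))"
    using sum_mono[of A "\<lambda>_. L", OF L] by (simp add: mult.commute)
  also have "\<dots> = (\<Sum>b\<in>B. ?d b)" by (rule double_count[OF assms(1,2)])
  also have "\<dots> \<le> (\<Sum>b\<in>B. (if b \<in> ?G then real (card A) else 0) + \<theta>)"
  proof (rule sum_mono)
    fix b assume "b \<in> B"
    moreover have "?d b \<le> real (card A)" using assms(1) by (auto intro: card_mono)
    ultimately show "?d b \<le> (if b \<in> ?G then real (card A) else 0) + \<theta>" using assms(4) by auto
  qed
  also have "\<dots> = real (card ?G) * real (card A) + \<theta> * real (card B)"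
  proof -
    have "(\<Sum>b\<in>B. if b \<in> ?G then real (card A) else 0) = (\<Sum>b\<in>?G. real (card A))"
      using assms(2) by (intro sum.mono_neutral_cong_right) auto
    then show ?thesis by (simp add: sum.distrib mult.commute)
  qed
  finally have "L / 2 * real (card A) \<le> real (card ?G) * real (card A)" using \<theta> by linarith
  moreover have "0 < real (card A)" using assms(1,3) by (simp add: card_gt_0_iff)
  ultimately show ?thesis by (simp only: mult_le_cancel_right_pos)
qed

text \<open>The threshold \<open>D\<close> is absolute and not a proportion of
  \<open>card V\<close>, so a link on one vertex less can inherit it.\<close>

definition codeg_ge :: "nat \<Rightarrow> 'a set \<Rightarrow> 'a set set \<Rightarrow> real \<Rightarrow> bool" where
  "codeg_ge r V E D \<longleftrightarrow> finite V \<and> (\<forall>S. S \<subseteq> V \<longrightarrow> card S = r - 1 \<longrightarrow> D \<le> real (card (nbhd V E S)))"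

text \<open>Only the last \<open>r - 1\<close> vertices are kept distinct: this is enough for the
  codegree condition to offer \<open>D\<close> continuations. Other repetitions are eliminated later
  by genericity.\<close>

lemma walk_extension_count:
  assumes "codeg_ge r V E D" "0 \<le> D" "1 \<le> r" "a \<in> tuples V (r - 1)" "distinct a"
  shows "D ^ e \<le> real (card {y \<in> tuples V e. walk r E (a @ y) \<and> distinct (lastn (r - 1) (a @ y))})"
proof (rule greedy_count)
  show "finite V" using assms(1) by (simp add: codeg_ge_def)
  have "length a < r" using assms by (simp add: tuples_def)
  then show "walk r E (a @ []) \<and> distinct (lastn (r - 1) (a @ []))"
    using assms(5) by (simp add: walk_def lastn_def)
next
  fix y assume y: "walk r E (a @ y) \<and> distinct (lastn (r - 1) (a @ y))" "set y \<subseteq> V"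
  let ?c = "lastn (r - 1) (a @ y)"
  have la: "length a = r - 1" "set a \<subseteq> V" using assms(4) by (auto simp: tuples_def)
  have c: "set ?c \<subseteq> V" "card (set ?c) = r - 1"
    using set_lastn_subset[of "r - 1" "a @ y"] la y
    by (auto simp: distinct_card length_lastn)
  have "D \<le> real (card (nbhd V E (set ?c)))" using assms(1) c by (simp add: codeg_ge_def)
  also have "\<dots> \<le> real (card {u \<in> V. walk r E (a @ (y @ [u])) \<and> distinct (lastn (r - 1) (a @ (y @ [u])))})"
  proof -
    have "nbhd V E (set ?c) \<subseteq> {u \<in> V. walk r E (a @ (y @ [u])) \<and> distinct (lastn (r - 1) (a @ (y @ [u])))}"
    proof
      fix u assume u: "u \<in> nbhd V E (set ?c)"
      have "walk r E ((a @ y) @ [u])"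
        using y u assms(3) by (intro walk_snoc) (auto simp: nbhd_def)
      moreover have "lastn (r - 1) ((a @ y) @ [u]) = tl (?c @ [u])"
        using la by (intro lastn_snoc) simp
      moreover have "distinct (?c @ [u])" using y u by (auto simp: nbhd_def)
      ultimately show "u \<in> {u \<in> V. walk r E (a @ (y @ [u])) \<and> distinct (lastn (r - 1) (a @ (y @ [u])))}"
        using u by (auto simp: nbhd_def intro: distinct_tl)
    qed
    moreover have "finite {u \<in> V. walk r E (a @ (y @ [u])) \<and> distinct (lastn (r - 1) (a @ (y @ [u])))}"
      using assms(1) by (simp add: codeg_ge_def)
    ultimately show ?thesis by (simp add: card_mono)
  qed
  finally show "D \<le> real (card {u \<in> V. walk r E (a @ (y @ [u])) \<and> distinct (lastn (r - 1) (a @ (y @ [u])))})" .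
qed (rule assms(2))

text \<open>\<open>N\<close> merely bounds \<open>card V\<close> from above. The statement then
  applies to links, which live on \<open>V - {v}\<close>, with unchanged \<open>N\<close> and
  \<open>\<gamma>\<close>.\<close>

definition connects :: "nat \<Rightarrow> real \<Rightarrow> 'a itself \<Rightarrow> nat \<Rightarrow> real \<Rightarrow> bool" where
  "connects r \<gamma> T m \<beta> \<longleftrightarrow> (\<forall>(V :: 'a set) E (N :: nat) a b.
     card V \<le> N \<longrightarrow> codeg_ge r V E ((1/2 + \<gamma>) * real N) \<longrightarrow>
     a \<in> tuples V (r - 1) \<longrightarrow> b \<in> tuples V (r - 1) \<longrightarrow> distinct a \<longrightarrow> distinct b \<longrightarrow>
     \<beta> * real N ^ m \<le> real (card {x \<in> tuples V m. walk r E (a @ x @ b)}))"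

text \<open>The walk first makes \<open>e\<close> free steps from \<open>a\<close>, with at least
  \<open>N / 2\<close> choices each, and then connects from its new end. This reaches lengths that
  the induction on \<open>r\<close> does not produce.\<close>

lemma connects_longer:
  assumes "connects r \<gamma> TYPE('a) m \<beta>" "1 \<le> r" "0 < \<gamma>" "0 \<le> \<beta>"
  shows "connects r \<gamma> TYPE('a) (e + m) ((1/2) ^ e * \<beta>)"
  unfolding connects_def
proof (intro allI impI)
  fix V :: "'a set" and E and N :: nat and a b
  assume N: "card V \<le> N" and cd: "codeg_ge r V E ((1/2 + \<gamma>) * real N)"
    and a: "a \<in> tuples V (r - 1)" "distinct a" and b: "b \<in> tuples V (r - 1)" "distinct b"
  have fin: "finite V" using cd by (simp add: codeg_ge_def)
  let ?A = "{y \<in> tuples V e. walk r E (a @ y) \<and> distinct (lastn (r - 1) (a @ y))}"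
  let ?B = "\<lambda>y. {x \<in> tuples V m. walk r E (lastn (r - 1) (a @ y) @ x @ b)}"
  let ?C = "{x \<in> tuples V (e + m). walk r E (a @ x @ b)}"
  have la: "length a = r - 1" "set a \<subseteq> V" using a by (auto simp: tuples_def)
  have "((1/2) * real N) ^ e \<le> ((1/2 + \<gamma>) * real N) ^ e"
    using assms(3) by (intro power_mono mult_right_mono) auto
  also have "\<dots> \<le> real (card ?A)"
    using assms(2,3) a by (intro walk_extension_count[OF cd]) auto
  finally have A: "((1/2) * real N) ^ e \<le> real (card ?A)" .
  have B: "\<beta> * real N ^ m \<le> real (card (?B y))" if "y \<in> ?A" for y
  proof -
    have "lastn (r - 1) (a @ y) \<in> tuples V (r - 1)" "distinct (lastn (r - 1) (a @ y))"
      using that la set_lastn_subset[of "r - 1" "a @ y"] by (auto simp: tuples_def length_lastn)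
    then show ?thesis using assms(1) N cd b unfolding connects_def by blast
  qed
  have inj: "inj_on (\<lambda>(y, x). y @ x) (Sigma ?A ?B)"
    by (auto simp: inj_on_def tuples_def)
  have sub: "(\<lambda>(y, x). y @ x) ` Sigma ?A ?B \<subseteq> ?C"
  proof (clarsimp, intro conjI)
    fix y x assume y: "y \<in> tuples V e" and w1: "walk r E (a @ y)" and x: "x \<in> tuples V m"
      and w2: "walk r E (lastn (r - Suc 0) (a @ y) @ x @ b)"
    show "y @ x \<in> tuples V (e + m)" using x y by (auto simp: tuples_def)
    let ?c = "lastn (r - 1) (a @ y)" and ?p = "take (length (a @ y) - (r - 1)) (a @ y)"
    have s: "a @ y = ?p @ ?c" by (rule split_lastn)
    have "walk r E (?p @ ?c @ (x @ b))"
      by (rule walk_glue) (use s w1 w2 la in \<open>auto simp: length_lastn\<close>)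
    then have "walk r E ((?p @ ?c) @ (x @ b))" by (simp only: append_assoc)
    then show "walk r E (a @ y @ x @ b)" unfolding s[symmetric] by (simp only: append_assoc)
  qed
  have finC: "finite ?C" and finA: "finite ?A" using finite_tuples[OF fin] by auto
  have "(1/2) ^ e * \<beta> * real N ^ (e + m) = ((1/2) * real N) ^ e * (\<beta> * real N ^ m)"
    by (simp add: power_add power_mult_distrib power_divide)
  also have "\<dots> \<le> real (card ?A) * (\<beta> * real N ^ m)"
    using A assms(4) by (intro mult_right_mono) auto
  also have "\<dots> = (\<Sum>y\<in>?A. \<beta> * real N ^ m)" by simp
  also have "\<dots> \<le> (\<Sum>y\<in>?A. real (card (?B y)))" by (intro sum_mono B)
  also have "\<dots> = real (card (Sigma ?A ?B))"
    using finA finite_tuples[OF fin, of m] by (simp add: card_SigmaI)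
  also have "\<dots> \<le> real (card ?C)" using card_inj_on_le[OF inj sub finC] by simp
  finally show "(1/2) ^ e * \<beta> * real N ^ (e + m) \<le> real (card ?C)" .
qed

text \<open>The uniformity grows by one when a common neighbour of both ends is put between any \<open>r\<close>
  consecutive vertices of a walk in its link. Averaging supplies linearly many neighbours whose
  links contain the same walk, so the inserted vertices can vary independently.\<close>

lemma connects_Suc:
  assumes "connects r \<gamma> TYPE('a) (r * q) \<beta>" "1 \<le> r" "0 < \<gamma>" "0 < \<beta>"
  shows "\<exists>\<beta>'>0. connects (Suc r) \<gamma> TYPE('a) (Suc r * q + 1) \<beta>'"
proof -
  let ?m = "r * q"
  \<comment> \<open>Half of the proportion \<open>\<beta>\<close> survives as popular walks
    \<open>x\<close>, and each of the \<open>q + 1\<close> inserted vertices then has at least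
    \<open>\<gamma> * \<beta> * N\<close> choices.\<close>
  define \<beta>' where "\<beta>' = \<beta> / 2 * (\<gamma> * \<beta>) ^ Suc q"
  have "connects (Suc r) \<gamma> TYPE('a) (Suc r * q + 1) \<beta>'"
    unfolding connects_def
  proof (intro allI impI)
    fix V :: "'a set" and E and N :: nat and a b
    assume N: "card V \<le> N" and cd: "codeg_ge (Suc r) V E ((1/2 + \<gamma>) * real N)"
      and a: "a \<in> tuples V (Suc r - 1)" "distinct a" and b: "b \<in> tuples V (Suc r - 1)" "distinct b"
    let ?C = "{x \<in> tuples V (Suc r * q + 1). walk (Suc r) E (a @ x @ b)}"
    have la: "length a = r" "set a \<subseteq> V" "length b = r" "set b \<subseteq> V"
      using a b by (auto simp: tuples_def)
    have fin: "finite V" using cd by (simp add: codeg_ge_def)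
    have na: "(1/2 + \<gamma>) * real N \<le> real (card (nbhd V E (set a)))"
      and nb: "(1/2 + \<gamma>) * real N \<le> real (card (nbhd V E (set b)))"
      using cd la a(2) b(2) by (auto simp: codeg_ge_def distinct_card)
    define A where "A = nbhd V E (set a) \<inter> nbhd V E (set b)"
    have finA: "finite A" using fin by (simp add: A_def nbhd_def)
    \<comment> \<open>Two neighborhoods that both exceed \<open>N / 2\<close> by
      \<open>\<gamma> * N\<close> meet in \<open>2 * \<gamma> * N\<close> vertices.\<close>
    have "card (nbhd V E (set a)) + card (nbhd V E (set b))
        = card (nbhd V E (set a) \<union> nbhd V E (set b)) + card A"
      unfolding A_def using fin by (intro card_Un_Int) (auto simp: nbhd_def)
    moreover have "card (nbhd V E (set a) \<union> nbhd V E (set b)) \<le> card V"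
      using fin by (intro card_mono) (auto simp: nbhd_def)
    ultimately have cA: "2 * \<gamma> * real N \<le> real (card A)"
      using na nb N by (simp add: algebra_simps)
    show "\<beta>' * real N ^ (Suc r * q + 1) \<le> real (card ?C)"
    proof (cases "N = 0")
      case True
      then show ?thesis by simp
    next
      case False
      then have "0 < 2 * \<gamma> * real N" using assms(3) by simp
      then have A0: "A \<noteq> {}" using cA by auto
      define R where "R v x \<longleftrightarrow> walk r (link E v) (tl a @ x @ butlast b)" for v x
      let ?B = "tuples V ?m"
      have L: "\<beta> * real N ^ ?m \<le> real (card {x \<in> ?B. R v x})" if v: "v \<in> A" for v
      proof -
        have vV: "v \<in> V" "v \<notin> set a" "v \<notin> set b" using v by (auto simp: A_def nbhd_def)
        \<comment> \<open>Every extension of \<open>insert v S\<close> in \<open>E\<close> extends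
          \<open>S\<close> in the link of \<open>v\<close>.\<close>
        have "codeg_ge r (V - {v}) (link E v) ((1/2 + \<gamma>) * real N)"
          unfolding codeg_ge_def
        proof (intro conjI allI impI)
          fix S assume S: "S \<subseteq> V - {v}" "card S = r - 1"
          have finS: "finite S" using S(1) fin finite_subset by blast
          have "v \<notin> S" using S(1) by auto
          then have "card (insert v S) = Suc r - 1" using S(2) finS assms(2) by simp
          moreover have "insert v S \<subseteq> V" using S vV by auto
          ultimately have "(1/2 + \<gamma>) * real N \<le> real (card (nbhd V E (insert v S)))"
            using cd by (simp add: codeg_ge_def)
          moreover have "nbhd V E (insert v S) \<subseteq> nbhd (V - {v}) (link E v) S"
            using S by (auto simp: nbhd_def link_def insert_commute)
          then have "card (nbhd V E (insert v S)) \<le> card (nbhd (V - {v}) (link E v) S)"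
            using fin by (intro card_mono) (auto simp: nbhd_def)
          ultimately show "(1/2 + \<gamma>) * real N \<le> real (card (nbhd (V - {v}) (link E v) S))" by linarith
        qed (use fin in simp)
        moreover have "card (V - {v}) \<le> N" by (rule le_trans[OF card_Diff1_le N])
        moreover have "tl a \<in> tuples (V - {v}) (r - 1)" "butlast b \<in> tuples (V - {v}) (r - 1)"
        proof -
          have "set (tl a) \<subseteq> set a" "set (butlast b) \<subseteq> set b"
            by (cases a; auto) (auto dest: in_set_butlastD)
          then show "tl a \<in> tuples (V - {v}) (r - 1)" "butlast b \<in> tuples (V - {v}) (r - 1)"
            using la vV by (auto simp: tuples_def)
        qed
        moreover have "distinct (tl a)" "distinct (butlast b)"
          using a(2) b(2) by (auto intro: distinct_tl distinct_butlast)
        ultimately have "\<beta> * real N ^ ?m \<le> real (card {x \<in> tuples (V - {v}) ?m. R v x})"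
          using assms(1) unfolding connects_def R_def by blast
        also have "\<dots> \<le> real (card {x \<in> ?B. R v x})"
        proof -
          have "{x \<in> tuples (V - {v}) ?m. R v x} \<subseteq> {x \<in> ?B. R v x}" by (auto simp: tuples_def)
          moreover have "finite {x \<in> ?B. R v x}" using finite_tuples[OF fin] by simp
          ultimately show ?thesis by (simp add: card_mono)
        qed
        finally show ?thesis .
      qed
      \<comment> \<open>Each of the at least \<open>2 * \<gamma> * N\<close> vertices of
        \<open>A\<close> is related to a proportion \<open>\<beta>\<close> of the
        \<open>N ^ (r * q)\<close> possible walks, so \<open>\<theta>\<close> is half of the average
        that this guarantees.\<close>
      define \<theta> where "\<theta> = \<gamma> * \<beta> * real N"
      have th0: "0 \<le> \<theta>" using assms by (simp add: \<theta>_def)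
      define G where "G = {x \<in> ?B. \<theta> \<le> real (card {v \<in> A. R v x})}"
      have G: "\<beta> * real N ^ ?m / 2 \<le> real (card G)"
        unfolding G_def
      proof (rule popular_many[OF finA finite_tuples[OF fin] A0 th0 L])
        have "\<theta> * real (card ?B) \<le> \<theta> * real N ^ ?m"
          using th0 N by (intro mult_left_mono) (auto simp: card_tuples[OF fin] power_mono)
        also have "\<dots> = \<beta> * real N ^ ?m * (2 * \<gamma> * real N) / 2" by (simp add: \<theta>_def)
        also have "\<dots> \<le> \<beta> * real N ^ ?m * real (card A) / 2"
          using cA assms(4) by (intro divide_right_mono mult_left_mono) auto
        finally show "\<theta> * real (card ?B) \<le> \<beta> * real N ^ ?m * real (card A) / 2" .
      qed
      let ?D = "\<lambda>x. tuples {v \<in> A. R v x} (Suc q)"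
      let ?f = "\<lambda>(x, vs). take (Suc r * q + 1) (drop r (interleave r (a @ x @ b) vs))"
      have f: "interleave r (a @ x @ b) vs = a @ ?f (x, vs) @ b \<and> ?f (x, vs) \<in> ?C"
        if "x \<in> G" "vs \<in> ?D x" for x vs
      proof -
        have x: "length x = r * q" "set x \<subseteq> V" using that by (auto simp: G_def tuples_def)
        have vs: "length vs = Suc q" "set vs \<subseteq> {v \<in> A. R v x}" using that by (auto simp: tuples_def)
        obtain y where y: "length y = Suc r * q + 1" "set y \<subseteq> set x \<union> set vs"
          "interleave r (a @ x @ b) vs = a @ y @ b"
          using interleave_ends[OF la(1,3) x(1) vs(1)] by blast
        have fy: "?f (x, vs) = y" using y la by simp
        have "walk (Suc r) E (interleave r (a @ x @ b) vs)"
          by (rule walk_interleave[OF la(1,3) x(1) vs(1) assms(2)])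
            (use vs(2) in \<open>auto simp: A_def nbhd_def R_def\<close>)
        moreover have "set y \<subseteq> V" using y(2) x(2) vs(2) by (auto simp: A_def nbhd_def)
        ultimately show ?thesis using y fy by (simp add: tuples_def)
      qed
      have inj: "inj_on ?f (Sigma G ?D)"
      proof (rule inj_onI)
        fix p p' assume p: "p \<in> Sigma G ?D" "p' \<in> Sigma G ?D" and eq: "?f p = ?f p'"
        obtain x vs x' vs' where pp: "p = (x, vs)" "p' = (x', vs')" by fastforce
        have mem: "x \<in> G" "vs \<in> ?D x" "x' \<in> G" "vs' \<in> ?D x'" using p pp by auto
        have "interleave r (a @ x @ b) vs = interleave r (a @ x' @ b) vs'"
          using f[OF mem(1,2)] f[OF mem(3,4)] eq pp by metis
        then have "a @ x @ b = a @ x' @ b \<and> vs = vs'"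
          by (rule interleave_inject[where q = q])
            (use mem la assms(2) in \<open>auto simp: G_def tuples_def\<close>)
        then show "p = p'" using pp by simp
      qed
      have sub: "?f ` Sigma G ?D \<subseteq> ?C" using f by fast
      have finC: "finite ?C" and finG: "finite G" using finite_tuples[OF fin] by (auto simp: G_def)
      have "\<beta>' * real N ^ (Suc r * q + 1) = (\<beta> * real N ^ ?m / 2) * \<theta> ^ Suc q"
        by (simp add: \<beta>'_def \<theta>_def power_mult_distrib power_add algebra_simps)
      also have "\<dots> \<le> real (card G) * \<theta> ^ Suc q"
        using G th0 by (intro mult_right_mono) auto
      also have "\<dots> = (\<Sum>x\<in>G. \<theta> ^ Suc q)" by simp
      also have "\<dots> \<le> (\<Sum>x\<in>G. real (card (?D x)))"
      proof (rule sum_mono)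
        fix x assume "x \<in> G"
        then have "\<theta> \<le> real (card {v \<in> A. R v x})" by (simp add: G_def)
        then have "\<theta> ^ Suc q \<le> real (card {v \<in> A. R v x}) ^ Suc q" using th0 by (intro power_mono)
        then show "\<theta> ^ Suc q \<le> real (card (?D x))" using finA by (simp add: card_tuples)
      qed
      also have "\<dots> = real (card (Sigma G ?D))"
        using finG finA by (simp add: card_SigmaI finite_tuples)
      also have "\<dots> \<le> real (card ?C)" using card_inj_on_le[OF inj sub finC] by simp
      finally show ?thesis .
    qed
  qed
  moreover have "0 < \<beta>'" using assms by (simp add: \<beta>'_def)
  ultimately show ?thesis by blast
qed

text \<open>For \<open>r = 1\<close> the ends are empty and the empty list connects them. All large
  \<open>m\<close> are claimed, since the step needs a length divisible by \<open>r\<close>; it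
  takes \<open>r * m0\<close> and then lengthens at will.\<close>

lemma connects_exists:
  assumes "1 \<le> r" "0 < \<gamma>"
  shows "\<exists>m0. \<forall>m\<ge>m0. \<exists>\<beta>>0. connects r \<gamma> TYPE('a) m \<beta>"
  using assms(1)
proof (induction r rule: dec_induct)
  case base
  have "connects 1 \<gamma> TYPE('a) 0 1"
  proof -
    have "{x \<in> tuples V 0. walk 1 E ([] @ x @ [])} = {[]}" for V :: "'a set" and E
      by (auto simp: tuples_def walk_def)
    then show ?thesis by (auto simp: connects_def tuples_def)
  qed
  then have "connects 1 \<gamma> TYPE('a) m ((1/2) ^ m)" for m
    using connects_longer[of 1 \<gamma> 0 1 m] assms(2) by simp
  then show ?case by (meson zero_less_divide_1_iff zero_less_numeral zero_less_power)
next
  case (step r)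
  then obtain m0 where m0: "\<forall>m\<ge>m0. \<exists>\<beta>>0. connects r \<gamma> TYPE('a) m \<beta>" by blast
  have "m0 \<le> r * m0" using step by simp
  then obtain \<beta> where "\<beta> > 0" "connects r \<gamma> TYPE('a) (r * m0) \<beta>" using m0 by blast
  then obtain \<beta>' where \<beta>': "\<beta>' > 0" "connects (Suc r) \<gamma> TYPE('a) (Suc r * m0 + 1) \<beta>'"
    using connects_Suc[of r \<gamma> m0 \<beta>] step assms(2) by auto
  show ?case
  proof (intro exI allI impI conjI)
    fix m assume "Suc r * m0 + 1 \<le> m"
    then have "m = (m - (Suc r * m0 + 1)) + (Suc r * m0 + 1)" by simp
    then show "connects (Suc r) \<gamma> TYPE('a) m ((1/2) ^ (m - (Suc r * m0 + 1)) * \<beta>')"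
      using connects_longer[OF \<beta>'(2), of "m - (Suc r * m0 + 1)"] assms(2) \<beta>'(1) by simp
    show "0 < (1/2) ^ (m - (Suc r * m0 + 1)) * \<beta>'" using \<beta>'(1) by simp
  qed
qed

section \<open>Selecting disjoint tuples\<close>

lemma card_hitting:
  assumes "finite V" "finite Z"
  shows "real (card {y \<in> tuples V m. set y \<inter> Z \<noteq> {}}) \<le> real m * real (card Z) * real (card V) ^ (m - 1)"
proof -
  have "{y \<in> tuples V m. set y \<inter> Z \<noteq> {}} \<subseteq> (\<Union>j\<in>{..<m}. {y \<in> tuples V m. y ! j \<in> Z})"
    by (auto simp: tuples_def in_set_conv_nth)
  then have "card {y \<in> tuples V m. set y \<inter> Z \<noteq> {}} \<le> card (\<Union>j\<in>{..<m}. {y \<in> tuples V m. y ! j \<in> Z})"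
    using finite_tuples[OF assms(1)] by (intro card_mono) auto
  also have "\<dots> \<le> (\<Sum>j\<in>{..<m}. card {y \<in> tuples V m. y ! j \<in> Z})"
    by (rule card_UN_le) simp
  finally have "real (card {y \<in> tuples V m. set y \<inter> Z \<noteq> {}})
      \<le> (\<Sum>j\<in>{..<m}. real (card {y \<in> tuples V m. y ! j \<in> Z}))"
    by (simp flip: of_nat_sum)
  also have "\<dots> \<le> (\<Sum>j\<in>{..<m}. real (card Z) * real (card V) ^ (m - 1))"
  proof (rule sum_mono)
    fix j assume j: "j \<in> {..<m}"
    show "real (card {y \<in> tuples V m. y ! j \<in> Z}) \<le> real (card Z) * real (card V) ^ (m - 1)"
    proof (rule card_bad_coordinate[OF assms(1), where B = "\<lambda>_. Z"])
      show "real (card (Z \<inter> V)) \<le> real (card Z)" using card_mono[OF assms(2), of "Z \<inter> V"] by auto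
    qed (use j in auto)
  qed
  finally show ?thesis by simp
qed

text \<open>A greedy choice with the potential \<open>\<Sum>i. (1/2) ^ card (F \<inter> G i)\<close> replaces the usual random selection
  of disjoint tuples: the average tuple lowers the potential by the factor \<open>1 - \<beta>/4\<close>.\<close>

lemma disjoint_selection_potential:
  fixes G :: "'i \<Rightarrow> 'a list set" and \<beta> \<eta> :: real
  assumes fin: "finite V" "V \<noteq> {}" "finite I" "I \<noteq> {}" and \<beta>: "0 < \<beta>" and m: "1 \<le> m"
    and G: "\<And>i. i \<in> I \<Longrightarrow> G i \<subseteq> tuples V m" "\<And>i. i \<in> I \<Longrightarrow> \<beta> * real (card V) ^ m \<le> real (card (G i))"
    and \<eta>: "real m * \<eta> \<le> \<beta> / 2" and s: "real s * real m \<le> \<eta> * real (card V)"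
  shows "\<exists>F. finite F \<and> card F = s \<and> F \<subseteq> (\<Union>i\<in>I. G i) \<and>
     (\<forall>x\<in>F. \<forall>y\<in>F. x \<noteq> y \<longrightarrow> set x \<inter> set y = {}) \<and>
     (\<Sum>i\<in>I. (1/2) ^ card (F \<inter> G i)) \<le> real (card I) * (1 - \<beta>/4) ^ s"
  using s
proof (induction s)
  case 0
  show ?case by (intro exI[of _ "{}"]) auto
next
  case (Suc s)
  have "real s * real m \<le> real (Suc s) * real m" by (simp add: mult_right_mono)
  then have sm: "real s * real m \<le> \<eta> * real (card V)" using Suc.prems by linarith
  then obtain F where F: "finite F" "card F = s" "F \<subseteq> (\<Union>i\<in>I. G i)"
    "\<forall>x\<in>F. \<forall>y\<in>F. x \<noteq> y \<longrightarrow> set x \<inter> set y = {}"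
    "(\<Sum>i\<in>I. (1/2) ^ card (F \<inter> G i)) \<le> real (card I) * (1 - \<beta>/4) ^ s"
    using Suc.IH by blast
  let ?n = "real (card V)"
  \<comment> \<open>The weight of \<open>i\<close> halves with every chosen member of
    \<open>G i\<close>, so a small total weight means that every \<open>G i\<close> has been hit
    often.\<close>
  define w where "w i = ((1/2) ^ card (F \<inter> G i) :: real)" for i
  define \<Phi> where "\<Phi> = (\<Sum>i\<in>I. w i)"
  define Z where "Z = (\<Union>x\<in>F. set x)"
  define A where "A = {x \<in> tuples V m. set x \<inter> Z = {}}"
  have n0: "0 < ?n" using fin by (simp add: card_gt_0_iff)
  have w0: "0 < w i" for i by (simp add: w_def)
  have \<Phi>0: "0 < \<Phi>" unfolding \<Phi>_def using fin w0 by (intro sum_pos) auto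
  have finZ: "finite Z" using F(1) by (simp add: Z_def)
  have finT: "finite (tuples V m)" by (rule finite_tuples[OF fin(1)])
  have finA: "finite A" using finT by (simp add: A_def)
  have "card Z \<le> (\<Sum>x\<in>F. card (set x))" unfolding Z_def by (rule card_UN_le[OF F(1)])
  also have "\<dots> \<le> (\<Sum>x\<in>F. m)"
  proof (rule sum_mono)
    fix x assume "x \<in> F"
    then have "length x = m" using F(3) G(1) by (force simp: tuples_def)
    then show "card (set x) \<le> m" using card_length[of x] by simp
  qed
  finally have "card Z \<le> s * m" using F(2) by simp
  then have "real (card Z) \<le> real (s * m)" by (rule of_nat_mono)
  then have cZ: "real (card Z) \<le> \<eta> * ?n" using sm by simp
  \<comment> \<open>Tuples meeting the vertices already used make up at most half of the guaranteed
    size of \<open>G i\<close>.\<close>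
  have gA: "\<beta> / 2 * ?n ^ m \<le> real (card {x \<in> A. x \<in> G i})" if i: "i \<in> I" for i
  proof -
    let ?H = "{y \<in> tuples V m. set y \<inter> Z \<noteq> {}}"
    have "card (G i) \<le> card ({x \<in> A. x \<in> G i} \<union> ?H)"
      using G(1)[OF i] finA finT by (intro card_mono) (auto simp: A_def)
    then have c: "card (G i) \<le> card {x \<in> A. x \<in> G i} + card ?H" using card_Un_le order_trans by blast
    have "real (card ?H) \<le> real m * real (card Z) * ?n ^ (m - 1)" by (rule card_hitting[OF fin(1) finZ])
    also have "\<dots> \<le> real m * (\<eta> * ?n) * ?n ^ (m - 1)"
      using cZ by (intro mult_right_mono mult_left_mono) auto
    also have "\<dots> = real m * \<eta> * ?n ^ m" using m by (simp add: power_eq_if[of _ m])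
    also have "\<dots> \<le> \<beta> / 2 * ?n ^ m" using \<eta> by (intro mult_right_mono) auto
    finally have "real (card ?H) \<le> \<beta> / 2 * ?n ^ m" .
    moreover have "real (card (G i)) \<le> real (card {x \<in> A. x \<in> G i}) + real (card ?H)"
      using c by linarith
    ultimately show ?thesis using G(2)[OF i] by (simp add: field_simps)
  qed
  \<comment> \<open>Summed over \<open>x\<close> in \<open>A\<close>, the weights of all
    \<open>G i\<close> containing \<open>x\<close> amount to at least
    \<open>\<beta> / 2 * \<Phi>\<close> times the number of all tuples, so some \<open>x\<close>
    reaches the average.\<close>
  have "\<exists>x\<in>A. \<beta> / 2 * \<Phi> \<le> (\<Sum>i\<in>I. if x \<in> G i then w i else 0)"
  proof (rule ccontr)
    assume "\<not> ?thesis"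
    then have lt: "\<And>x. x \<in> A \<Longrightarrow> (\<Sum>i\<in>I. if x \<in> G i then w i else 0) < \<beta> / 2 * \<Phi>" by force
    obtain i0 where i0: "i0 \<in> I" using fin by auto
    have "0 < \<beta> / 2 * ?n ^ m" using \<beta> n0 by simp
    then have "0 < real (card {x \<in> A. x \<in> G i0})" using gA[OF i0] by linarith
    then have A0: "A \<noteq> {}" by auto
    have "\<beta> / 2 * ?n ^ m * \<Phi> = (\<Sum>i\<in>I. w i * (\<beta> / 2 * ?n ^ m))"
      unfolding \<Phi>_def sum_distrib_left by (simp only: mult.commute)
    also have "\<dots> \<le> (\<Sum>i\<in>I. w i * real (card {x \<in> A. x \<in> G i}))"
      using gA w0 by (intro sum_mono mult_left_mono) (auto simp: less_imp_le)
    also have "\<dots> = (\<Sum>i\<in>I. \<Sum>x\<in>A. if x \<in> G i then w i else 0)"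
      using finA by (intro sum.cong) (auto simp: sum.If_cases Int_def mult.commute)
    also have "\<dots> = (\<Sum>x\<in>A. \<Sum>i\<in>I. if x \<in> G i then w i else 0)" by (rule sum.swap)
    also have "\<dots> < (\<Sum>x\<in>A. \<beta> / 2 * \<Phi>)" by (rule sum_strict_mono[OF finA A0 lt])
    also have "\<dots> = real (card A) * (\<beta> / 2 * \<Phi>)" by simp
    also have "\<dots> \<le> ?n ^ m * (\<beta> / 2 * \<Phi>)"
    proof -
      have "card A \<le> card (tuples V m)" using finT by (intro card_mono) (auto simp: A_def)
      then have "real (card A) \<le> ?n ^ m" by (simp add: card_tuples[OF fin(1)] flip: of_nat_power)
      then show ?thesis using \<beta> \<Phi>0 by (intro mult_right_mono) auto
    qed
    finally show False by (simp add: algebra_simps)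
  qed
  then obtain x where x: "x \<in> A" "\<beta> / 2 * \<Phi> \<le> (\<Sum>i\<in>I. if x \<in> G i then w i else 0)" by blast
  have "0 < \<beta> / 2 * \<Phi>" using \<beta> \<Phi>0 by simp
  then have "(\<Sum>i\<in>I. if x \<in> G i then w i else 0) \<noteq> 0" using x(2) by linarith
  then have "\<exists>i\<in>I. (if x \<in> G i then w i else 0) \<noteq> 0" by (rule contrapos_np) (auto intro!: sum.neutral)
  then obtain i where i: "i \<in> I" "x \<in> G i" by (auto split: if_splits)
  have xl: "length x = m" "set x \<inter> Z = {}" using x(1) by (auto simp: A_def tuples_def)
  have xF: "x \<notin> F"
  proof
    assume "x \<in> F"
    then have "set x \<subseteq> Z" by (auto simp: Z_def)
    then have "set x \<inter> Z = set x" by (rule Int_absorb2)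
    then show False using xl m by simp
  qed
  \<comment> \<open>Choosing \<open>x\<close> removes half of the weight of each \<open>G i\<close>
    containing it, in total at least \<open>\<beta> / 4 * \<Phi>\<close>.\<close>
  have "(\<Sum>i\<in>I. (1/2) ^ card (insert x F \<inter> G i)) = (\<Sum>i\<in>I. w i - (1/2) * (if x \<in> G i then w i else 0))"
    using xF F(1) by (intro sum.cong) (auto simp: w_def)
  also have "\<dots> = \<Phi> - (1/2) * (\<Sum>i\<in>I. if x \<in> G i then w i else 0)"
    by (simp add: \<Phi>_def sum_subtractf sum_distrib_left)
  also have "\<dots> \<le> \<Phi> * (1 - \<beta>/4)" using x(2) by (simp add: algebra_simps)
  also have "\<dots> \<le> (real (card I) * (1 - \<beta>/4) ^ s) * (1 - \<beta>/4)"
  proof (rule mult_right_mono)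
    show "\<Phi> \<le> real (card I) * (1 - \<beta>/4) ^ s" using F(5) by (simp add: \<Phi>_def w_def)
    have "card (G i) \<le> card (tuples V m)" using finT G(1)[OF i(1)] by (intro card_mono)
    then have "real (card (G i)) \<le> ?n ^ m" by (simp add: card_tuples[OF fin(1)] flip: of_nat_power)
    then have "\<beta> * ?n ^ m \<le> 1 * ?n ^ m" using G(2)[OF i(1)] by linarith
    then have "\<beta> \<le> 1" using n0 by (subst (asm) mult_le_cancel_right_pos) auto
    then show "0 \<le> 1 - \<beta>/4" by simp
  qed
  finally have pot: "(\<Sum>i\<in>I. (1/2) ^ card (insert x F \<inter> G i)) \<le> real (card I) * (1 - \<beta>/4) ^ Suc s"
    by (simp add: algebra_simps)
  show ?case
  proof (intro exI[of _ "insert x F"] conjI)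
    show "\<forall>xa\<in>insert x F. \<forall>y\<in>insert x F. xa \<noteq> y \<longrightarrow> set xa \<inter> set y = {}"
      using F(4) xl(2) unfolding Z_def by blast
  qed (use F xF i pot in auto)
qed

text \<open>A single term of the potential is at most the whole sum. With
  \<open>exp (-1) \<le> 1/2\<close> and \<open>1 - \<beta>/4 \<le> exp (- \<beta>/4)\<close>, taking
  logarithms gives the bound. The term \<open>ln (card I)\<close> is harmless in the applications,
  where \<open>s\<close> is linear in \<open>card V\<close> and \<open>I\<close> has polynomial
  size.\<close>

lemma disjoint_selection:
  fixes G :: "'i \<Rightarrow> 'a list set" and \<beta> \<eta> :: real
  assumes fin: "finite V" "V \<noteq> {}" "finite I" "I \<noteq> {}" and \<beta>: "0 < \<beta>" and m: "1 \<le> m"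
    and G: "\<And>i. i \<in> I \<Longrightarrow> G i \<subseteq> tuples V m" "\<And>i. i \<in> I \<Longrightarrow> \<beta> * real (card V) ^ m \<le> real (card (G i))"
    and \<eta>: "real m * \<eta> \<le> \<beta> / 2" and s: "real s * real m \<le> \<eta> * real (card V)"
  obtains F where "finite F" "card F = s" "F \<subseteq> (\<Union>i\<in>I. G i)"
     "\<And>x y. x \<in> F \<Longrightarrow> y \<in> F \<Longrightarrow> x \<noteq> y \<Longrightarrow> set x \<inter> set y = {}"
     "\<And>i. i \<in> I \<Longrightarrow> \<beta> * real s / 4 - ln (real (card I)) \<le> real (card (F \<inter> G i))"
proof -
  have "\<exists>F. finite F \<and> card F = s \<and> F \<subseteq> (\<Union>i\<in>I. G i) \<and>
     (\<forall>x\<in>F. \<forall>y\<in>F. x \<noteq> y \<longrightarrow> set x \<inter> set y = {}) \<and>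
     (\<Sum>i\<in>I. (1/2) ^ card (F \<inter> G i)) \<le> real (card I) * (1 - \<beta>/4) ^ s"
    by (rule disjoint_selection_potential[OF fin \<beta> m _ _ \<eta> s]) (fact G)+
  then obtain F where F: "finite F" "card F = s" "F \<subseteq> (\<Union>i\<in>I. G i)"
     "\<forall>x\<in>F. \<forall>y\<in>F. x \<noteq> y \<longrightarrow> set x \<inter> set y = {}"
     "(\<Sum>i\<in>I. (1/2) ^ card (F \<inter> G i)) \<le> real (card I) * (1 - \<beta>/4) ^ s"
    by (elim exE conjE) (rule that)
  have n0: "0 < real (card V)" using fin by (simp add: card_gt_0_iff)
  have I0: "0 < real (card I)" using fin by (simp add: card_gt_0_iff)
  have "\<beta> * real s / 4 - ln (real (card I)) \<le> real (card (F \<inter> G i))" if i: "i \<in> I" for i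
  proof -
    have "card (G i) \<le> card (tuples V m)" using finite_tuples[OF fin(1)] G(1)[OF i] by (intro card_mono)
    then have "real (card (G i)) \<le> real (card V) ^ m" by (simp add: card_tuples[OF fin(1)] flip: of_nat_power)
    then have "\<beta> * real (card V) ^ m \<le> 1 * real (card V) ^ m" using G(2)[OF i] by linarith
    then have b1: "\<beta> \<le> 1" using n0 by (subst (asm) mult_le_cancel_right_pos) auto
    let ?c = "card (F \<inter> G i)"
    have "exp (-1) \<le> (1/2 :: real)"
      using exp_ge_add_one_self[of 1] by (simp add: exp_minus field_simps)
    then have "exp (-1) ^ ?c \<le> (1/2 :: real) ^ ?c" by (intro power_mono) auto
    then have "exp (- real ?c) \<le> (1/2) ^ ?c" by (simp flip: exp_of_nat_mult)
    also have "\<dots> \<le> (\<Sum>i\<in>I. (1/2) ^ card (F \<inter> G i))"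
      using i fin(3) by (intro member_le_sum) auto
    also have "\<dots> \<le> real (card I) * (1 - \<beta>/4) ^ s" by (rule F(5))
    also have "\<dots> \<le> real (card I) * exp (- (\<beta>/4)) ^ s"
      using exp_ge_add_one_self[of "- (\<beta>/4)"] b1 by (intro mult_left_mono power_mono) auto
    also have "\<dots> = exp (ln (real (card I))) * exp (real s * - (\<beta>/4))"
      using I0 by (simp only: exp_of_nat_mult exp_ln)
    also have "\<dots> = exp (ln (real (card I)) - \<beta> * real s / 4)"
      by (simp add: mult.commute flip: exp_add)
    finally show ?thesis by simp
  qed
  with F show thesis using that by blast
qed

section \<open>Connectors and absorbers\<close>

lemma fill_append: "fill (\<sigma> @ \<tau>) y = fill \<sigma> y @ fill \<tau> y"
  by (simp add: fill_def)

lemma fill_Cons_const: "fill (Inr v # \<tau>) y = v # fill \<tau> y"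
  by (simp add: fill_def)

lemma fill_const: "fill (map Inr a) y = a"
  by (simp add: fill_def comp_def)

lemma fill_vars: "j \<le> length y \<Longrightarrow> fill (map Inl [i..<j]) y = take (j - i) (drop i y)"
  by (rule nth_equalityI) (auto simp: fill_def)

lemma setting_codeg: "setting k \<gamma> \<eta> V E \<phi> \<Longrightarrow> codeg_ge k V E ((1/2 + \<gamma>) * real (card V))"
  by (simp add: setting_def codeg_ge_def)

lemma setting_finite: "setting k \<gamma> \<eta> V E \<phi> \<Longrightarrow> finite V"
  by (simp add: setting_def)

definition connector :: "nat \<Rightarrow> 'a set set \<Rightarrow> ('a set \<Rightarrow> nat) \<Rightarrow> 'a list \<Rightarrow> 'a list \<Rightarrow> 'a list \<Rightarrow> bool" where
  "connector k E \<phi> a b y \<longleftrightarrow> distinct (a @ y @ b) \<and> good_walk k E \<phi> (a @ y @ b)"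

text \<open>Edges come from gluing along \<open>k - 1\<close> vertices. For colors, genericity
  handles every pair of windows with a free vertex in the symmetric difference; since the free block
  has length at least \<open>k\<close>, any other pair lies inside \<open>a\<close> or inside
  \<open>b\<close>.\<close>

lemma connector_of_generic:
  assumes k: "2 \<le> k" and m: "k \<le> m"
    and a: "length a = 2 * k - 2" "good_walk k E \<phi> a" and b: "length b = 2 * k - 2" "good_walk k E \<phi> b"
    and y: "length y = m" and w: "walk k E (lastn (k - 1) a @ y @ take (k - 1) b)"
    and g: "generic k E \<phi> Z (map Inr a @ map Inl [0..<m] @ map Inr b) y"
  shows "connector k E \<phi> a b y"
proof -
  let ?\<tau> = "map Inr a @ map Inl [0..<m] @ map Inr b"
  let ?w = "a @ y @ b"
  let ?h = "2 * k - 2"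
  have f: "fill ?\<tau> y = ?w" using y by (simp add: fill_append fill_const fill_vars)
  let ?p = "take (length a - (k - 1)) a" and ?c = "lastn (k - 1) a" and ?d = "take (k - 1) b" and ?s = "drop (k - 1) b"
  have ac: "a = ?p @ ?c" by (rule split_lastn)
  have bd: "b = ?d @ ?s" by simp
  have wa: "walk k E a" and wb: "walk k E b" using a b by (auto simp: good_walk_def)
  have "walk k E (?p @ ?c @ (y @ ?d))"
    by (rule walk_glue) (use wa ac w a k in \<open>auto simp: length_lastn\<close>)
  then have "walk k E ((?p @ ?c) @ y @ ?d)" by (simp only: append_assoc)
  then have "walk k E ((a @ y) @ ?d)" unfolding ac[symmetric] by simp
  then have "walk k E ((a @ y) @ ?d @ ?s)"
    by (rule walk_glue) (use wb b k in auto)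
  then have W: "walk k E ?w" by simp
  have "separated k \<phi> ?w"
    unfolding separated_def
  proof (intro allI impI)
    fix i j assume ij: "i < j" "j < i + k" "j + k \<le> length ?w"
    have ln: "length ?w = length ?\<tau>" using y by simp
    show "\<phi> (win k ?w i) \<noteq> \<phi> (win k ?w j)"
    proof (cases "\<exists>s\<in>{i..<j} \<union> {i + k..<j + k}. \<exists>l. ?\<tau> ! s = Inl l")
      case True
      have "win k ?w i \<in> E" "win k ?w j \<in> E" using W ij unfolding walk_def by auto
      then show ?thesis using g True ij ln unfolding generic_def f by (metis (no_types, lifting))
    next
      case False
      have var: "\<exists>l. ?\<tau> ! s = Inl l" if "?h \<le> s" "s < ?h + m" for s
        using that a by (simp add: nth_append)
      have nv: "s < ?h \<or> ?h + m \<le> s" if "s \<in> {i..<j} \<union> {i + k..<j + k}" for s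
        using False var that by (meson not_less)
      consider "j + k \<le> ?h" | "?h + m \<le> i" | "?h < j + k" "i < ?h + m" by linarith
      then show ?thesis
      proof cases
        case 1
        then have "win k ?w i = win k a i" "win k ?w j = win k a j"
          using ij a(1) by (auto intro!: win_append1)
        moreover have "\<phi> (win k a i) \<noteq> \<phi> (win k a j)"
          using a(2) 1 a(1) ij unfolding good_walk_def separated_def by auto
        ultimately show ?thesis by simp
      next
        case 2
        have e: "win k ((a @ y) @ b) t = win k b (t - length (a @ y))" if "?h + m \<le> t" for t
          using that a(1) y by (intro win_append2) auto
        have "\<phi> (win k b (i - length (a @ y))) \<noteq> \<phi> (win k b (j - length (a @ y)))"
          using b 2 ij a(1) y unfolding good_walk_def separated_def by auto
        then show ?thesis using e[of i] e[of j] 2 ij by simp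
      next
        case 3
        \<comment> \<open>The outermost positions \<open>i\<close> and \<open>j + k - 1\<close> are
          fixed, hence on opposite sides of the free block. Its first position is not in the
          symmetric difference, so \<open>j \<le> ?h\<close>, and the window at \<open>j\<close>
          would have to cover the whole block and one more entry, against
          \<open>k \<le> m\<close>.\<close>
        have "j + k - 1 \<in> {i..<j} \<union> {i + k..<j + k}" using ij by auto
        then have "?h + m \<le> j + k - 1" using nv[of "j + k - 1"] 3(1) by linarith
        moreover have "i < ?h" using nv[of i] 3(2) ij by auto
        then have "j \<le> ?h" using nv[of ?h] m k by (cases "?h < j") auto
        ultimately show ?thesis using m k by linarith
      qed
    qed
  qed
  with W g show ?thesis unfolding connector_def good_walk_def generic_def f by blast
qed

text \<open>\<open>connects\<close> joins the inner \<open>k - 1\<close> vertices of both ends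
  regardless of colors and repetitions; genericity for the template \<open>a\<close>, free block,
  \<open>b\<close> turns at least half of the guaranteed number into connectors.\<close>

lemma many_connectors:
  assumes k: "2 \<le> k" and \<gamma>: "0 < \<gamma>"
  shows "\<exists>m \<beta> \<eta>. k \<le> m \<and> 0 < \<beta> \<and> 0 < \<eta> \<and> (\<forall>(V :: 'a set) E \<phi> (Z :: 'a set) a b.
     setting k \<gamma> \<eta> V E \<phi> \<longrightarrow> finite Z \<longrightarrow> real (card Z) \<le> \<eta> * real (card V) \<longrightarrow>
     a \<in> tuples V (2 * k - 2) \<longrightarrow> b \<in> tuples V (2 * k - 2) \<longrightarrow> distinct (a @ b) \<longrightarrow>
     good_walk k E \<phi> a \<longrightarrow> good_walk k E \<phi> b \<longrightarrow>
     \<beta> * real (card V) ^ m \<le> real (card {y \<in> tuples V m. connector k E \<phi> a b y \<and> set y \<inter> Z = {}}))"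
proof -
  obtain m0 where m0: "\<forall>m\<ge>m0. \<exists>\<beta>>0. connects k \<gamma> TYPE('a) m \<beta>"
    using connects_exists[of k \<gamma>] k \<gamma> by auto
  define m where "m = max m0 k"
  obtain \<beta> where \<beta>: "\<beta> > 0" "connects k \<gamma> TYPE('a) m \<beta>" using m0 unfolding m_def by (meson max.cobounded1)
  have mk: "k \<le> m" by (simp add: m_def)
  \<comment> \<open>The factor from \<open>many_generic\<close> for a template of two ends and
    \<open>m\<close> free positions.\<close>
  define \<Lambda> where "\<Lambda> = 2 * real (2 * (2 * k - 2) + m) ^ 2 + real m"
  have \<Lambda>0: "0 < \<Lambda>" using mk k by (simp add: \<Lambda>_def add_nonneg_pos)
  define \<eta> where "\<eta> = \<beta> / 2 / \<Lambda>"
  have \<eta>0: "0 < \<eta>" using \<beta>(1) \<Lambda>0 by (simp add: \<eta>_def)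
  show ?thesis
  proof (rule exI[of _ m], rule exI[of _ "\<beta> / 2"], rule exI[of _ \<eta>], intro conjI allI impI)
    fix V :: "'a set" and E \<phi> and Z :: "'a set" and a b
    assume S: "setting k \<gamma> \<eta> V E \<phi>" and Z: "finite Z" "real (card Z) \<le> \<eta> * real (card V)"
      and a: "a \<in> tuples V (2 * k - 2)" and b: "b \<in> tuples V (2 * k - 2)" and ab: "distinct (a @ b)"
      and ga: "good_walk k E \<phi> a" and gb: "good_walk k E \<phi> b"
    let ?X = "{y \<in> tuples V m. walk k E (lastn (k - 1) a @ y @ take (k - 1) b)}"
    let ?\<tau> = "map Inr a @ map Inl [0..<m] @ map Inr b"
    have la: "length a = 2 * k - 2" "set a \<subseteq> V" and lb: "length b = 2 * k - 2" "set b \<subseteq> V"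
      using a b by (auto simp: tuples_def)
    have fin: "finite V" using S by (rule setting_finite)
    have "lastn (k - 1) a \<in> tuples V (k - 1)" "take (k - 1) b \<in> tuples V (k - 1)"
      using la lb set_lastn_subset[of "k - 1" a] set_take_subset[of "k - 1" b]
      by (auto simp: tuples_def length_lastn)
    moreover have "distinct (lastn (k - 1) a)" "distinct (take (k - 1) b)"
      using ab by (auto simp: lastn_def)
    ultimately have X: "\<beta> * real (card V) ^ m \<le> real (card ?X)"
      using \<beta>(2) setting_codeg[OF S] unfolding connects_def by blast
    have "\<beta> / 2 * real (card V) ^ m \<le> real (card {y \<in> ?X. generic k E \<phi> Z ?\<tau> y})"
    proof (rule many_generic[OF S _ _ _ _ Z _ X])
      show "distinct ?\<tau>" using ab by (auto simp: distinct_map)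
      show "(2 * real (length ?\<tau>) ^ 2 + real m) * \<eta> \<le> \<beta> / 2"
      proof -
        have "length ?\<tau> = 2 * (2 * k - 2) + m" using la lb by simp
        then have "(2 * real (length ?\<tau>) ^ 2 + real m) * \<eta> = \<Lambda> * \<eta>" by (simp only: \<Lambda>_def)
        then show ?thesis using \<Lambda>0 by (simp add: \<eta>_def)
      qed
    qed (use la lb mk k in auto)
    also have "\<dots> \<le> real (card {y \<in> tuples V m. connector k E \<phi> a b y \<and> set y \<inter> Z = {}})"
    proof -
      have "{y \<in> ?X. generic k E \<phi> Z ?\<tau> y} \<subseteq> {y \<in> tuples V m. connector k E \<phi> a b y \<and> set y \<inter> Z = {}}"
        using connector_of_generic[OF k mk la(1) ga lb(1) gb] by (auto simp: tuples_def generic_def)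
      moreover have "finite {y \<in> tuples V m. connector k E \<phi> a b y \<and> set y \<inter> Z = {}}"
        using finite_tuples[OF fin] by simp
      ultimately show ?thesis by (simp add: card_mono)
    qed
    finally show "\<beta> / 2 * real (card V) ^ m \<le> real (card {y \<in> tuples V m. connector k E \<phi> a b y \<and> set y \<inter> Z = {}})" .
  qed (use mk \<beta> \<eta>0 in auto)
qed

text \<open>For \<open>x\<close> of length \<open>2 * (2 * k - 2)\<close>, the case of interest,
  \<open>v\<close> enters exactly in the middle, and the ends along which paths are glued stay the
  same.\<close>

definition absorber :: "nat \<Rightarrow> 'a set set \<Rightarrow> ('a set \<Rightarrow> nat) \<Rightarrow> 'a \<Rightarrow> 'a list \<Rightarrow> bool" where
  "absorber k E \<phi> v x \<longleftrightarrow> distinct (v # x) \<and> good_walk k E \<phi> x \<and>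
     good_walk k E \<phi> (take (2 * k - 2) x @ [v] @ drop (2 * k - 2) x)"

lemma win_insert_middle:
  assumes "i \<le> length l" "length l < i + k"
  shows "win k (l @ [v] @ r) i = insert v (win (k - 1) (l @ r) i)"
proof
  show "win k (l @ [v] @ r) i \<subseteq> insert v (win (k - 1) (l @ r) i)"
  proof
    fix z assume "z \<in> win k (l @ [v] @ r) i"
    then obtain p where p: "i \<le> p" "p < i + k" "z = (l @ [v] @ r) ! p" by (auto simp: win_def)
    consider "p < length l" | "p = length l" | "length l < p" by linarith
    then show "z \<in> insert v (win (k - 1) (l @ r) i)"
    proof cases
      case 1
      then have "z = (l @ r) ! p" "p \<in> {i..<i + (k - 1)}" using p assms by (auto simp: nth_append)
      then show ?thesis unfolding win_def by blast
    next
      case 2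
      then show ?thesis using p by simp
    next
      case 3
      then have "z = (l @ r) ! (p - 1)" "p - 1 \<in> {i..<i + (k - 1)}"
        using p assms by (auto simp: nth_append nth_Cons' diff_diff_add add.commute)
      then show ?thesis unfolding win_def by blast
    qed
  qed
  show "insert v (win (k - 1) (l @ r) i) \<subseteq> win k (l @ [v] @ r) i"
  proof
    fix z assume "z \<in> insert v (win (k - 1) (l @ r) i)"
    then consider "z = v" | p where "i \<le> p" "p < i + (k - 1)" "z = (l @ r) ! p"
      by (auto simp: win_def)
    then show "z \<in> win k (l @ [v] @ r) i"
    proof cases
      case 1
      then have "z = (l @ [v] @ r) ! length l" "length l \<in> {i..<i + k}" using assms by auto
      then show ?thesis unfolding win_def by blast
    next
      case 2
      show ?thesis
      proof (cases "p < length l")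
        case True
        then have "z = (l @ [v] @ r) ! p" "p \<in> {i..<i + k}" using 2 by (auto simp: nth_append)
        then show ?thesis unfolding win_def by blast
      next
        case False
        then have "z = (l @ [v] @ r) ! Suc p" "Suc p \<in> {i..<i + k}"
          using 2 by (auto simp: nth_append nth_Cons' Suc_diff_le)
        then show ?thesis unfolding win_def by blast
      qed
    qed
  qed
qed

text \<open>A window of the new list either avoids \<open>v\<close> and lies in \<open>l\<close> or
  in \<open>r\<close>, or it consists of \<open>v\<close> and \<open>k - 1\<close> consecutive
  entries of \<open>l @ r\<close>, an edge of the link.\<close>

lemma walk_insert_middle:
  assumes "walk k E (l @ r)" "walk (k - 1) (link E v) (l @ r)" "1 \<le> k"
  shows "walk k E (l @ [v] @ r)"
  unfolding walk_def
proof (intro allI impI)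
  fix i assume i: "i + k \<le> length (l @ [v] @ r)"
  consider "i + k \<le> length l" | "length l < i" | "i \<le> length l" "length l < i + k" by linarith
  then show "win k (l @ [v] @ r) i \<in> E"
  proof cases
    case 1
    then have "win k (l @ [v] @ r) i = win k l i" by (rule win_append1)
    moreover have "win k l i \<in> E" using walk_prefix[OF assms(1)] 1 by (simp add: walk_def)
    ultimately show ?thesis by simp
  next
    case 2
    then have "win k ((l @ [v]) @ r) i = win k r (i - length (l @ [v]))" by (intro win_append2) simp
    moreover have "win k r (i - length (l @ [v])) \<in> E"
      using walk_suffix[OF assms(1)] 2 i by (simp add: walk_def)
    ultimately show ?thesis by simp
  next
    case 3
    have "win (k - 1) (l @ r) i \<in> link E v" using assms(2) i assms(3) by (simp add: walk_def)
    then show ?thesis using win_insert_middle[OF 3, of v r] by (simp add: link_def)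
  qed
qed

text \<open>Gives \<open>V\<close> itself the degree bound, as \<open>V\<close> stands in for a
  neighborhood while a walk is too short to be constrained.\<close>

lemma setting_card_nbhd_le:
  assumes "setting k \<gamma> \<eta> V E \<phi>" "k - 1 \<le> card V"
  shows "(1/2 + \<gamma>) * real (card V) \<le> real (card V)"
proof -
  have fin: "finite V" using assms(1) by (rule setting_finite)
  obtain S where S: "S \<subseteq> V" "card S = k - 1" using obtain_subset_with_card_n[OF assms(2)] by metis
  then have "(1/2 + \<gamma>) * real (card V) \<le> real (card (nbhd V E S))" using assms(1) by (simp add: setting_def)
  also have "\<dots> \<le> real (card V)" using fin by (auto intro!: card_mono simp: nbhd_def)
  finally show ?thesis .
qed

text \<open>The next vertex must be adjacent to the last \<open>k - 1\<close> vertices and to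
  \<open>v\<close> with the last \<open>k - 2\<close>. These two \<open>(k - 1)\<close>-sets have
  \<open>2 * \<gamma> * card V\<close> common neighbors, and at most half of them are used
  up.\<close>

lemma absorber_walks_count:
  assumes S: "setting k \<gamma> \<eta> V E \<phi>" and k: "2 \<le> k" and \<gamma>: "0 < \<gamma>" and v: "v \<in> V"
    and n: "real (M + 1) \<le> \<gamma> * real (card V)" and kn: "k \<le> card V"
  shows "(\<gamma> * real (card V)) ^ M \<le> real (card {x \<in> tuples V M. distinct (v # x) \<and>
    walk k E x \<and> walk (k - 1) (link E v) x})"
proof (rule greedy_count)
  show fin: "finite V" using S by (rule setting_finite)
  show "0 \<le> \<gamma> * real (card V)" using \<gamma> by simp
  show "distinct [v] \<and> walk k E [] \<and> walk (k - 1) (link E v) []" using k by (simp add: walk_def)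
  fix x assume x: "distinct (v # x) \<and> walk k E x \<and> walk (k - 1) (link E v) x" "set x \<subseteq> V" "length x < M"
  let ?n = "real (card V)"
  have cs: "(1/2 + \<gamma>) * ?n \<le> real (card (nbhd V E T))" if "T \<subseteq> V" "card T = k - 1" for T
    using S that by (simp add: setting_def)
  have cV: "(1/2 + \<gamma>) * ?n \<le> real (card V)" using setting_card_nbhd_le[OF S] kn by simp
  define A where "A = (if k - 1 \<le> length x then nbhd V E (set (lastn (k - 1) x)) else V)"
  define B where "B = (if k - 2 \<le> length x then nbhd V E (insert v (set (lastn (k - 2) x))) else V)"
  have AB: "A \<subseteq> V" "B \<subseteq> V" by (auto simp: A_def B_def nbhd_def)
  have cA: "(1/2 + \<gamma>) * ?n \<le> real (card A)"
  proof (cases "k - 1 \<le> length x")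
    case True
    have "distinct (lastn (k - 1) x)" using x by (simp add: lastn_def)
    then have "card (set (lastn (k - 1) x)) = k - 1" using True by (simp add: distinct_card length_lastn)
    moreover have "set (lastn (k - 1) x) \<subseteq> V" using set_lastn_subset x(2) by fast
    ultimately show ?thesis using cs True by (simp add: A_def)
  qed (use cV in \<open>simp add: A_def\<close>)
  have cB: "(1/2 + \<gamma>) * ?n \<le> real (card B)"
  proof (cases "k - 2 \<le> length x")
    case True
    have sub: "set (lastn (k - 2) x) \<subseteq> set x" by (rule set_lastn_subset)
    have "distinct (lastn (k - 2) x)" using x by (simp add: lastn_def)
    then have "card (set (lastn (k - 2) x)) = k - 2" using True by (simp add: distinct_card length_lastn)
    moreover have "v \<notin> set (lastn (k - 2) x)" using sub x by auto
    ultimately have "card (insert v (set (lastn (k - 2) x))) = k - 1" using k by simp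
    moreover have "insert v (set (lastn (k - 2) x)) \<subseteq> V" using sub x(2) v by auto
    ultimately show ?thesis using cs True by (simp add: B_def)
  qed (use cV in \<open>simp add: B_def\<close>)
  have "card A + card B = card (A \<union> B) + card (A \<inter> B)"
    using AB fin finite_subset by (intro card_Un_Int) blast+
  moreover have "card (A \<union> B) \<le> card V" using AB fin by (intro card_mono) auto
  ultimately have "2 * \<gamma> * ?n \<le> real (card (A \<inter> B))" using cA cB by (simp add: algebra_simps)
  moreover have "card (A \<inter> B) \<le> card (A \<inter> B - set (v # x)) + card (set (v # x))"
    by (metis card_Un_le Un_Diff_cancel2 card_mono finite_Un finite_set finite_Int finite_Diff
        fin AB(1) finite_subset order_trans sup_ge1)
  moreover have "card (set (v # x)) \<le> M" using card_length[of "v # x"] x(3) by simp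
  ultimately have "\<gamma> * ?n \<le> real (card (A \<inter> B - set (v # x)))" using n by linarith
  also have "\<dots> \<le> real (card {u \<in> V. distinct (v # (x @ [u])) \<and> walk k E (x @ [u]) \<and> walk (k - 1) (link E v) (x @ [u])})"
  proof -
    have "A \<inter> B - set (v # x) \<subseteq> {u \<in> V. distinct (v # (x @ [u])) \<and> walk k E (x @ [u]) \<and> walk (k - 1) (link E v) (x @ [u])}"
    proof
      fix u assume u: "u \<in> A \<inter> B - set (v # x)"
      have "walk k E (x @ [u])"
      proof (rule walk_snoc)
        assume "k \<le> Suc (length x)"
        then have "k - 1 \<le> length x" by simp
        then have "A = nbhd V E (set (lastn (k - 1) x))" by (simp add: A_def)
        then show "insert u (set (lastn (k - 1) x)) \<in> E" using u by (simp add: nbhd_def)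
      qed (use x k in auto)
      moreover have "walk (k - 1) (link E v) (x @ [u])"
      proof (rule walk_snoc)
        show "1 \<le> k - 1" using k by simp
        assume "k - 1 \<le> Suc (length x)"
        then have "k - 2 \<le> length x" by simp
        then have "insert u (insert v (set (lastn (k - 2) x))) \<in> E" using u by (simp add: B_def nbhd_def)
        moreover have "v \<notin> insert u (set (lastn (k - 2) x))"
          using u x set_lastn_subset[of "k - 2" x] by auto
        moreover have "k - 1 - 1 = k - 2" by simp
        ultimately show "insert u (set (lastn (k - 1 - 1) x)) \<in> link E v"
          unfolding link_def by (simp add: insert_commute)
      qed (use x in simp)
      ultimately show "u \<in> {u \<in> V. distinct (v # (x @ [u])) \<and> walk k E (x @ [u]) \<and> walk (k - 1) (link E v) (x @ [u])}"
        using u x AB by auto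
    qed
    moreover have "finite {u \<in> V. distinct (v # (x @ [u])) \<and> walk k E (x @ [u]) \<and> walk (k - 1) (link E v) (x @ [u])}"
      using fin by simp
    ultimately show ?thesis by (simp add: card_mono)
  qed
  finally show "\<gamma> * ?n \<le> real (card {u \<in> V. distinct (v # (x @ [u])) \<and> walk k E (x @ [u]) \<and> walk (k - 1) (link E v) (x @ [u])})" .
qed

text \<open>Genericity is needed for \<open>x\<close> and for \<open>x\<close> with \<open>v\<close>
  inserted. In the second template only the middle position is fixed, while the symmetric difference
  of the windows contains both \<open>i\<close> and \<open>i + k\<close>, so it always has a free
  position.\<close>

lemma absorber_of_generic:
  assumes k: "2 \<le> k" and x: "length x = 2 * (2 * k - 2)" "distinct (v # x)" "walk k E x" "walk (k - 1) (link E v) x"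
    and g1: "generic k E \<phi> Z (map Inl [0..<2 * (2 * k - 2)]) x"
    and g2: "generic k E \<phi> Z (map Inl [0..<2 * k - 2] @ [Inr v] @ map Inl [2 * k - 2..<2 * (2 * k - 2)]) x"
  shows "absorber k E \<phi> v x"
proof -
  let ?h = "2 * k - 2"
  let ?\<tau>1 = "map Inl [0..<2 * ?h] :: (nat + 'a) list"
  let ?\<tau>2 = "map Inl [0..<?h] @ [Inr v] @ map Inl [?h..<2 * ?h]"
  let ?w = "take ?h x @ [v] @ drop ?h x"
  have f1: "fill ?\<tau>1 x = x" using x(1) by (simp add: fill_vars)
  have f2: "fill ?\<tau>2 x = ?w" using x(1) by (simp add: fill_append fill_vars fill_Cons_const)
  have "separated k \<phi> x" unfolding separated_def
  proof (intro allI impI)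
    fix i j assume ij: "i < j" "j < i + k" "j + k \<le> length x"
    have "win k x i \<in> E" "win k x j \<in> E" using x(3) ij unfolding walk_def by auto
    moreover have "\<exists>s\<in>{i..<j} \<union> {i + k..<j + k}. \<exists>l. ?\<tau>1 ! s = Inl l"
      using ij x(1) by (intro bexI[of _ i]) auto
    ultimately show "\<phi> (win k x i) \<noteq> \<phi> (win k x j)"
      using g1 ij x(1) unfolding generic_def f1 by auto
  qed
  moreover have W: "walk k E ?w" using walk_insert_middle[of k E "take ?h x" "drop ?h x" v] x(3,4) k by simp
  moreover have "separated k \<phi> ?w" unfolding separated_def
  proof (intro allI impI)
    fix i j assume ij: "i < j" "j < i + k" "j + k \<le> length ?w"
    have lw: "length ?w = length ?\<tau>2" using x(1) by simp
    have "win k ?w i \<in> E" "win k ?w j \<in> E" using W ij unfolding walk_def by auto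
    moreover have "\<exists>s\<in>{i..<j} \<union> {i + k..<j + k}. \<exists>l. ?\<tau>2 ! s = Inl l"
    proof -
      have var: "\<exists>l. ?\<tau>2 ! s = Inl l" if "s \<noteq> ?h" "s < length ?\<tau>2" for s
        using that by (auto simp: nth_append nth_Cons')
      show ?thesis
      proof (cases "i = ?h")
        case False
        then show ?thesis using var[of i] ij lw by (intro bexI[of _ i]) auto
      next
        case True
        have "i + k \<in> {i + k..<j + k}" using ij(1) by simp
        moreover have "i + k \<noteq> ?h" "i + k < length ?\<tau>2" using True k ij lw by linarith+
        ultimately show ?thesis using var[of "i + k"] by blast
      qed
    qed
    ultimately show "\<phi> (win k ?w i) \<noteq> \<phi> (win k ?w j)"
      using g2 ij lw unfolding generic_def f2 by metis
  qed
  ultimately show ?thesis using x unfolding absorber_def good_walk_def by simp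
qed

lemma many_absorbers:
  assumes k: "2 \<le> k" and \<gamma>: "0 < \<gamma>"
  shows "\<exists>\<beta> \<eta>. 0 < \<beta> \<and> 0 < \<eta> \<and> (\<forall>(V :: 'a set) E \<phi> v.
     setting k \<gamma> \<eta> V E \<phi> \<longrightarrow> v \<in> V \<longrightarrow>
     \<beta> * real (card V) ^ (2 * (2 * k - 2)) \<le> real (card {x \<in> tuples V (2 * (2 * k - 2)). absorber k E \<phi> v x}))"
proof -
  define h where "h = 2 * k - 2"
  define M where "M = 2 * h"
  have M0: "0 < M" using k by (simp add: M_def h_def)
  define \<beta> where "\<beta> = \<gamma> ^ M"
  have \<beta>0: "0 < \<beta>" using \<gamma> by (simp add: \<beta>_def)
  define \<Lambda> where "\<Lambda> = 2 * real (M + 1) ^ 2 + real M"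
  have \<Lambda>0: "0 < \<Lambda>" by (simp add: \<Lambda>_def add_pos_nonneg)
  \<comment> \<open>Two rounds of genericity halve the proportion twice, hence
    \<open>\<beta> / 4\<close>. The other terms turn \<open>1 \<le> \<eta> * card V\<close> into
    \<open>M + 1 \<le> \<gamma> * card V\<close> and \<open>k \<le> card V\<close>.\<close>
  define \<eta> where "\<eta> = min (\<beta> / 4 / \<Lambda>) (min (\<gamma> / real (M + 1)) (1 / real k))"
  have \<eta>0: "0 < \<eta>" using \<beta>0 \<Lambda>0 \<gamma> k by (simp add: \<eta>_def)
  have \<eta>1: "\<Lambda> * \<eta> \<le> \<beta> / 4"
  proof -
    have "\<Lambda> * \<eta> \<le> \<Lambda> * (\<beta> / 4 / \<Lambda>)" using \<Lambda>0 by (intro mult_left_mono) (auto simp: \<eta>_def)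
    then show ?thesis using \<Lambda>0 by simp
  qed
  have "\<beta> / 4 * real (card V) ^ M \<le> real (card {x \<in> tuples V M. absorber k E \<phi> v x})"
    if S: "setting k \<gamma> \<eta> V E \<phi>" and v: "v \<in> V" for V :: "'a set" and E \<phi> v
  proof -
    let ?n = "real (card V)"
    have fin: "finite V" using S by (rule setting_finite)
    have n1: "1 \<le> \<eta> * ?n" using S by (simp add: setting_def)
    have "\<eta> * ?n \<le> \<gamma> / real (M + 1) * ?n" by (intro mult_right_mono) (auto simp: \<eta>_def)
    then have "1 \<le> \<gamma> / real (M + 1) * ?n" using n1 by linarith
    then have nM: "real (M + 1) \<le> \<gamma> * ?n" by (simp add: field_simps)
    have "\<eta> * ?n \<le> 1 / real k * ?n" by (intro mult_right_mono) (auto simp: \<eta>_def)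
    then have "1 \<le> 1 / real k * ?n" using n1 by linarith
    then have nk: "k \<le> card V" using k by (simp add: field_simps)
    define X where "X = {x \<in> tuples V M. distinct (v # x) \<and> walk k E x \<and> walk (k - 1) (link E v) x}"
    have X: "\<beta> * ?n ^ M \<le> real (card X)"
      using absorber_walks_count[OF S k \<gamma> v nM nk] by (simp add: X_def \<beta>_def power_mult_distrib)
    let ?\<tau>1 = "map Inl [0..<M] :: (nat + 'a) list"
    let ?\<tau>2 = "map Inl [0..<h] @ [Inr v] @ map Inl [h..<M]"
    have XT: "X \<subseteq> tuples V M" by (auto simp: X_def)
    define X1 where "X1 = {x \<in> X. generic k E \<phi> {} ?\<tau>1 x}"
    have sm: "(2 * real l ^ 2 + real M) * \<eta> \<le> \<beta> / 4" if "l \<le> M + 1" for l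
    proof -
      have "(2 * real l ^ 2 + real M) * \<eta> \<le> \<Lambda> * \<eta>"
        unfolding \<Lambda>_def using that \<eta>0 by (intro mult_right_mono add_right_mono mult_left_mono power_mono) auto
      then show ?thesis using \<eta>1 by linarith
    qed
    have X1: "\<beta> / 2 * ?n ^ M \<le> real (card X1)" unfolding X1_def
    proof (rule many_generic[OF S _ _ _ _ _ _ XT X])
      show "(2 * real (length ?\<tau>1) ^ 2 + real M) * \<eta> \<le> \<beta> / 2" using sm[of "length ?\<tau>1"] \<beta>0 by simp
    qed (use M0 \<eta>0 in \<open>auto simp: distinct_map\<close>)
    have X1T: "X1 \<subseteq> tuples V M" using XT by (auto simp: X1_def)
    have "\<beta> / 2 / 2 * ?n ^ M \<le> real (card {x \<in> X1. generic k E \<phi> {} ?\<tau>2 x})"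
    proof (rule many_generic[OF S _ _ _ _ _ _ X1T X1])
      show "(2 * real (length ?\<tau>2) ^ 2 + real M) * \<eta> \<le> \<beta> / 2 / 2" using sm[of "length ?\<tau>2"] by (simp add: M_def)
    qed (use M0 \<eta>0 v in \<open>auto simp: distinct_map M_def\<close>)
    also have "\<dots> \<le> real (card {x \<in> tuples V M. absorber k E \<phi> v x})"
    proof -
      have "{x \<in> X1. generic k E \<phi> {} ?\<tau>2 x} \<subseteq> {x \<in> tuples V M. absorber k E \<phi> v x}"
      proof clarify
        fix x assume x: "x \<in> X1" "generic k E \<phi> {} ?\<tau>2 x"
        then have "x \<in> tuples V M" "absorber k E \<phi> v x"
          using absorber_of_generic[OF k, of x v E \<phi> "{}"]
          by (auto simp: X1_def X_def M_def h_def tuples_def)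
        then show "x \<in> tuples V M \<and> absorber k E \<phi> v x" by simp
      qed
      moreover have "finite {x \<in> tuples V M. absorber k E \<phi> v x}" using finite_tuples[OF fin] by simp
      ultimately show ?thesis by (simp add: card_mono)
    qed
    finally show ?thesis by simp
  qed
  then show ?thesis using \<beta>0 \<eta>0 unfolding M_def h_def
    by (intro exI[of _ "\<beta> / 4"] exI[of _ \<eta>]) auto
qed

section \<open>Covering almost all vertices\<close>

definition shadow :: "nat \<Rightarrow> 'a set set \<Rightarrow> 'a set set" where
  "shadow r F = {T. card T = r - 1 \<and> (\<exists>S\<in>F. T \<subseteq> S)}"

lemma card_subsets_le_power:
  assumes "finite U"
  shows "card {T. T \<subseteq> U \<and> card T = r} \<le> card U ^ r"
proof -
  have "{T. T \<subseteq> U \<and> card T = r} \<subseteq> set ` tuples U r"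
  proof
    fix T assume T: "T \<in> {T. T \<subseteq> U \<and> card T = r}"
    then have "finite T" using assms finite_subset by auto
    then obtain xs where "set xs = T" "distinct xs" using finite_distinct_list by blast
    then show "T \<in> set ` tuples U r" using T by (auto simp: tuples_def distinct_card)
  qed
  then have "card {T. T \<subseteq> U \<and> card T = r} \<le> card (set ` tuples U r)"
    using finite_tuples[OF assms] by (intro card_mono) auto
  also have "\<dots> \<le> card (tuples U r)" by (rule card_image_le[OF finite_tuples[OF assms]])
  finally show ?thesis by (simp add: card_tuples[OF assms])
qed

lemma deg_le_card_nbhd:
  assumes "kgraph k V E" "S \<subseteq> V" "card S = k - 1" "1 \<le> k"
  shows "deg E S \<le> card (nbhd V E S)"
proof -
  have fin: "finite V" using assms(1) by (simp add: kgraph_def)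
  have "{e \<in> E. S \<subseteq> e} \<subseteq> (\<lambda>u. insert u S) ` nbhd V E S"
  proof
    fix e assume e: "e \<in> {e \<in> E. S \<subseteq> e}"
    then have e': "e \<subseteq> V" "card e = k" "S \<subseteq> e" "e \<in> E" using assms(1) by (auto simp: kgraph_def)
    have "card (e - S) = card e - card S"
      by (rule card_Diff_subset[OF finite_subset[OF assms(2) fin] e'(3)])
    then have "card (e - S) = 1" using e'(2) assms(3,4) by simp
    then obtain u where u: "e - S = {u}" by (auto simp: card_Suc_eq)
    then have eu: "e = insert u S" using e'(3) by auto
    moreover have "u \<in> nbhd V E S" using u e' eu by (auto simp: nbhd_def)
    ultimately show "e \<in> (\<lambda>u. insert u S) ` nbhd V E S" by blast
  qed
  moreover have fn: "finite (nbhd V E S)" using fin by (simp add: nbhd_def)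
  ultimately have "card {e \<in> E. S \<subseteq> e} \<le> card ((\<lambda>u. insert u S) ` nbhd V E S)" by (intro card_mono) auto
  also have "\<dots> \<le> card (nbhd V E S)" by (rule card_image_le[OF fn])
  finally show ?thesis by (simp add: deg_def)
qed

text \<open>A subfamily maximizing \<open>card F' - d * card (shadow r F')\<close> has no shadow set of small positive degree.\<close>

lemma dense_core:
  fixes d :: real and U :: "'a set"
  assumes fin: "finite U" and F: "F \<subseteq> {S. S \<subseteq> U \<and> card S = r}" and r: "1 \<le> r" and d0: "0 \<le> d"
    and d: "d * real (card U) ^ (r - 1) < real (card F)"
  shows "\<exists>F'\<subseteq>F. F' \<noteq> {} \<and> (\<forall>T\<in>shadow r F'. d \<le> real (card (nbhd U F' T)))"
proof -
  define \<Psi> where "\<Psi> F' = real (card F') - d * real (card (shadow r F'))" for F' :: "'a set set"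
  have finF: "finite F" using F fin by (auto intro: finite_subset[of _ "Pow U"])
  have sh: "shadow r F' \<subseteq> {T. T \<subseteq> U \<and> card T = r - 1}" if "F' \<subseteq> F" for F'
    using that F by (fastforce simp: shadow_def)
  have finsh: "finite (shadow r F')" if "F' \<subseteq> F" for F'
    using sh[OF that] fin by (auto intro: finite_subset[of _ "Pow U"])
  have fPow: "finite (\<Psi> ` Pow F)" "\<Psi> ` Pow F \<noteq> {}" using finF by auto
  obtain F' where F': "F' \<subseteq> F" "\<Psi> F' = Max (\<Psi> ` Pow F)" using Max_in[OF fPow] by auto
  have mx: "\<Psi> H \<le> \<Psi> F'" if "H \<subseteq> F" for H using F'(2) Max_ge[OF fPow(1)] that by auto
  have finF': "finite F'" by (rule finite_subset[OF F'(1) finF])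
  \<comment> \<open>\<open>F\<close> itself has positive value, so the maximizer is not
    empty.\<close>
  have "card (shadow r F) \<le> card {T. T \<subseteq> U \<and> card T = r - 1}"
    using sh[of F] fin by (intro card_mono) auto
  also have "\<dots> \<le> card U ^ (r - 1)" by (rule card_subsets_le_power[OF fin])
  finally have "real (card (shadow r F)) \<le> real (card U) ^ (r - 1)" by (simp flip: of_nat_power)
  then have "d * real (card (shadow r F)) \<le> d * real (card U) ^ (r - 1)" using d0 by (rule mult_left_mono)
  then have "0 < \<Psi> F" using d by (simp add: \<Psi>_def)
  then have pos: "0 < \<Psi> F'" using mx[of F] by simp
  have ne: "F' \<noteq> {}"
  proof
    assume "F' = {}"
    then have "\<Psi> F' = 0" by (simp add: \<Psi>_def shadow_def)
    then show False using pos by simp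
  qed
  have "d \<le> real (card (nbhd U F' T))" if T: "T \<in> shadow r F'" for T
  proof (rule ccontr)
    assume "\<not> d \<le> real (card (nbhd U F' T))"
    then have lt: "real (card (nbhd U F' T)) < d" by simp
    let ?B = "{S \<in> F'. T \<subseteq> S}"
    have "kgraph r U F'" using F F'(1) fin by (auto simp: kgraph_def)
    moreover have "T \<subseteq> U" "card T = r - 1" using T sh[OF F'(1)] by auto
    ultimately have "card ?B \<le> card (nbhd U F' T)" using deg_le_card_nbhd[of r U F' T] r by (simp add: deg_def)
    then have cB: "real (card ?B) < d" using lt by linarith
    \<comment> \<open>Deleting the fewer than \<open>d\<close> sets above \<open>T\<close> also
      removes \<open>T\<close> from the shadow, so the value would strictly increase.\<close>
    let ?H = "F' - ?B"
    have H: "?H \<subseteq> F" using F'(1) by auto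
    have "card ?H = card F' - card ?B" using finF' by (intro card_Diff_subset) auto
    moreover have "card ?B \<le> card F'" using finF' by (intro card_mono) auto
    ultimately have cH: "real (card ?H) = real (card F') - real (card ?B)" by simp
    have "shadow r ?H \<subseteq> shadow r F' - {T}" by (auto simp: shadow_def)
    then have "card (shadow r ?H) \<le> card (shadow r F' - {T})"
      using finsh[OF F'(1)] by (intro card_mono) auto
    then have "Suc (card (shadow r ?H)) \<le> card (shadow r F')"
      using T finsh[OF F'(1)] card_Suc_Diff1[of "shadow r F'" T] by simp
    then have "real (card (shadow r ?H)) + 1 \<le> real (card (shadow r F'))" by linarith
    then have "d * (real (card (shadow r ?H)) + 1) \<le> d * real (card (shadow r F'))" using d0 by (rule mult_left_mono)
    then have "\<Psi> F' < \<Psi> ?H" using cB cH by (simp add: \<Psi>_def algebra_simps)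
    then show False using mx[OF H] by simp
  qed
  with F'(1) ne show ?thesis by blast
qed

text \<open>In the dense core the last \<open>r - 1\<close> vertices of a walk form a shadow set
  again, so each step has at least \<open>d\<close> continuations. The shadow set \<open>a\<close>
  only starts the walk and is cut off at the end.\<close>

lemma dense_walks:
  fixes d :: real
  assumes fin: "finite U" and F: "F \<subseteq> {S. S \<subseteq> U \<and> card S = r}" and r: "1 \<le> r" and d0: "0 \<le> d"
    and d: "d * real (card U) ^ (r - 1) < real (card F)"
  shows "d ^ M \<le> real (card {y \<in> tuples U M. walk r F y})"
proof -
  obtain F' where F': "F' \<subseteq> F" "F' \<noteq> {}" "\<And>T. T \<in> shadow r F' \<Longrightarrow> d \<le> real (card (nbhd U F' T))"
    using dense_core[OF assms] by blast
  obtain S0 where S0: "S0 \<in> F'" using F'(2) by auto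
  then have S0': "card S0 = r" "S0 \<subseteq> U" using F F'(1) by auto
  have "r - 1 \<le> card S0" using S0' by simp
  then obtain T0 where T0: "T0 \<subseteq> S0" "card T0 = r - 1" using obtain_subset_with_card_n by metis
  have "finite T0" using finite_subset[OF T0(1)] finite_subset[OF S0'(2) fin] by simp
  then obtain a where a: "set a = T0" "distinct a" using finite_distinct_list by blast
  have la: "length a = r - 1" using a T0 distinct_card by fastforce
  define P where "P y \<longleftrightarrow> walk r F' (a @ y) \<and> distinct (lastn (r - 1) (a @ y)) \<and>
    set (lastn (r - 1) (a @ y)) \<in> shadow r F'" for y
  have "d ^ M \<le> real (card {y \<in> tuples U M. P y})"
  proof (rule greedy_count[OF fin d0])
    show "P []" unfolding P_def using la a S0 T0 r by (auto simp: walk_def lastn_def shadow_def)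
  next
    fix y assume y: "P y" "set y \<subseteq> U"
    let ?c = "lastn (r - 1) (a @ y)"
    have "d \<le> real (card (nbhd U F' (set ?c)))" using y(1) F'(3) by (simp add: P_def)
    also have "\<dots> \<le> real (card {u \<in> U. P (y @ [u])})"
    proof -
      have "nbhd U F' (set ?c) \<subseteq> {u \<in> U. P (y @ [u])}"
      proof
        fix u assume u: "u \<in> nbhd U F' (set ?c)"
        then have uS: "insert u (set ?c) \<in> F'" "u \<notin> set ?c" "u \<in> U" by (auto simp: nbhd_def)
        have w: "walk r F' ((a @ y) @ [u])"
          using y(1) uS(1) r by (intro walk_snoc) (auto simp: P_def)
        have l: "lastn (r - 1) ((a @ y) @ [u]) = tl (?c @ [u])"
          by (rule lastn_snoc) (use la in simp)
        have dist: "distinct (?c @ [u])" using y(1) uS(2) by (simp add: P_def)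
        then have dt: "distinct (tl (?c @ [u]))" by (rule distinct_tl)
        have "length (tl (?c @ [u])) = r - 1" using la by (simp add: length_lastn)
        then have "card (set (tl (?c @ [u]))) = r - 1" using distinct_card[OF dt] by simp
        moreover have "set (tl (?c @ [u])) \<subseteq> insert u (set ?c)" by (cases ?c) auto
        ultimately have "set (tl (?c @ [u])) \<in> shadow r F'" using uS(1) by (auto simp: shadow_def)
        then have "P (y @ [u])" using w l dt unfolding P_def by simp
        then show "u \<in> {u \<in> U. P (y @ [u])}" using uS(3) by simp
      qed
      then show ?thesis using fin by (simp add: card_mono)
    qed
    finally show "d \<le> real (card {u \<in> U. P (y @ [u])})" .
  qed
  also have "\<dots> \<le> real (card {y \<in> tuples U M. walk r F y})"
  proof -
    have "{y \<in> tuples U M. P y} \<subseteq> {y \<in> tuples U M. walk r F y}"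
      using F'(1) walk_suffix[of r F' a] unfolding P_def walk_def by blast
    moreover have "finite {y \<in> tuples U M. walk r F y}" using finite_tuples[OF fin] by simp
    ultimately show ?thesis by (simp add: card_mono)
  qed
  finally show ?thesis .
qed

text \<open>In this shape every block is followed by an inserted entry, including the last; the
  connecting walks above instead end with a whole block.\<close>

lemma set_interleave:
  assumes "length s = r * L" "length vs = L" "1 \<le> r"
  shows "set (interleave r s vs) = set s \<union> set vs"
proof
  let ?W = "interleave r s vs"
  show "set ?W \<subseteq> set s \<union> set vs"
  proof
    fix z assume "z \<in> set ?W"
    then obtain p where p: "p < length s + length vs" "z = ?W ! p" by (auto simp: in_set_conv_nth)
    define j t where "j = p div Suc r" and "t = p mod Suc r"
    have pt: "p = j * Suc r + t" "t \<le> r"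
      by (simp_all only: j_def t_def div_mult_mod_eq) (metis less_Suc_eq_le mod_less_divisor zero_less_Suc)
    have "p < L * Suc r" using p assms by (simp add: algebra_simps)
    then have jL: "j < L" unfolding j_def using less_mult_imp_div_less by blast
    show "z \<in> set s \<union> set vs"
    proof (cases "t = r")
      case True
      then have "z = vs ! j" using nth_interleave_v[of j r s vs] p pt by simp
      then show ?thesis using jL assms by auto
    next
      case False
      then have t: "t < r" using pt by simp
      then have z: "z = s ! (j * r + t)" using nth_interleave_s[OF t, of j s vs] p pt by simp
      have "Suc j * r \<le> L * r" using jL by (intro mult_le_mono1) simp
      then have "j * r + t < L * r" using t by simp
      then have "j * r + t < length s" using assms by (simp add: mult.commute)
      then show ?thesis using z by auto
    qed
  qed
  show "set s \<union> set vs \<subseteq> set ?W"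
  proof
    fix z assume "z \<in> set s \<union> set vs"
    then consider i where "i < length s" "z = s ! i" | j where "j < L" "z = vs ! j"
      using assms by (auto simp: in_set_conv_nth)
    then show "z \<in> set ?W"
    proof cases
      case 1
      define j t where "j = i div r" and "t = i mod r"
      have it: "i = j * r + t" "t < r" using assms(3) by (auto simp: j_def t_def)
      have "j < L" using 1 assms by (simp add: j_def less_mult_imp_div_less mult.commute)
      then have "j * Suc r + t < length s + length vs" using 1 it assms by simp
      then show ?thesis using nth_interleave_s[OF it(2), of j s vs] 1 it
        by (metis length_interleave nth_mem)
    next
      case 2
      have "Suc j * Suc r \<le> L * Suc r" using 2 by (intro mult_le_mono1) simp
      then have "j * Suc r + r < length s + length vs" using assms by (simp add: algebra_simps)
      then show ?thesis using nth_interleave_v[of j r s vs] 2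
        by (metis length_interleave nth_mem)
    qed
  qed
qed

lemma distinct_interleave:
  assumes "length s = r * L" "length vs = L" "1 \<le> r" "distinct (s @ vs)"
  shows "distinct (interleave r s vs)"
proof -
  have "card (set (interleave r s vs)) = card (set (s @ vs))" using set_interleave[OF assms(1-3)] by simp
  also have "\<dots> = length (interleave r s vs)" using distinct_card[OF assms(4)] by simp
  finally show ?thesis by (rule card_distinct)
qed

lemma fill_interleave:
  assumes "length y = r * L" "length D = L" "1 \<le> r"
  shows "fill (interleave r (map Inl [0..<r * L]) (map Inr D)) y = interleave r y D"
proof (rule nth_equalityI)
  let ?\<tau> = "interleave r (map Inl [0..<r * L]) (map Inr D)"
  show "length (fill ?\<tau> y) = length (interleave r y D)" using assms by simp
  fix p assume "p < length (fill ?\<tau> y)"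
  then have p: "p < r * L + L" using assms by simp
  define j t where "j = p div Suc r" and "t = p mod Suc r"
  have pt: "p = j * Suc r + t" "t \<le> r"
    by (simp_all only: j_def t_def div_mult_mod_eq) (metis less_Suc_eq_le mod_less_divisor zero_less_Suc)
  have "p < L * Suc r" using p by (simp add: algebra_simps)
  then have jL: "j < L" unfolding j_def using less_mult_imp_div_less by blast
  show "fill ?\<tau> y ! p = interleave r y D ! p"
  proof (cases "t = r")
    case True
    then have "?\<tau> ! p = Inr (D ! j)" "interleave r y D ! p = D ! j"
      using nth_interleave_v[of j r "map Inl [0..<r * L]" "map Inr D"] nth_interleave_v[of j r y D] p pt assms jL
      by auto
    then show ?thesis using fill_Inr[of p ?\<tau>] p assms by simp
  next
    case False
    then have t: "t < r" using pt by simp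
    have "Suc j * r \<le> L * r" using jL by (intro mult_le_mono1) simp
    then have "j * r + t < L * r" using t by simp
    then have i: "j * r + t < r * L" by (simp add: mult.commute)
    have "?\<tau> ! p = Inl (j * r + t)" "interleave r y D ! p = y ! (j * r + t)"
      using nth_interleave_s[OF t, of j "map Inl [0..<r * L]" "map Inr D"] nth_interleave_s[OF t, of j y D] p pt assms i
      by auto
    then show ?thesis using fill_Inl[of p ?\<tau>] p assms by simp
  qed
qed

text \<open>The vertices of \<open>D\<close> are placed at every \<open>k\<close>-th position of a walk in \<open>F\<close>. Two windows whose symmetric
  difference contains no vertex of that walk are \<open>insert (D ! i) S\<close> and \<open>insert (D ! Suc i) S\<close>, which is
  why consecutive entries of \<open>D\<close> must give different colors.\<close>

lemma interleaved_path:
  assumes k: "3 \<le> k" and L: "1 \<le> L" and \<epsilon>: "0 < \<epsilon>"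
  shows "\<exists>\<eta>>0. \<forall>(V :: 'a set) E \<phi> U F D.
     setting k \<gamma> \<eta> V E \<phi> \<longrightarrow> U \<subseteq> V \<longrightarrow> F \<subseteq> {S. S \<subseteq> U \<and> card S = k - 1} \<longrightarrow>
     \<epsilon> * real (card V) ^ (k - 1) \<le> real (card F) \<longrightarrow>
     D \<in> tuples V L \<longrightarrow> distinct D \<longrightarrow>
     (\<forall>S\<in>F. set D \<subseteq> nbhd V E S) \<longrightarrow>
     (\<forall>S\<in>F. \<forall>i. Suc i < L \<longrightarrow> \<phi> (insert (D ! i) S) \<noteq> \<phi> (insert (D ! Suc i) S)) \<longrightarrow>
     (\<exists>w. length w = k * L \<and> distinct w \<and> set w \<subseteq> U \<union> set D \<and> good_walk k E \<phi> w)"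
proof -
  define r where "r = k - 1"
  have kr: "k = Suc r" "2 \<le> r" using k by (auto simp: r_def)
  define M where "M = r * L"
  have M1: "1 \<le> M" using kr L by (simp add: M_def Suc_le_eq)
  \<comment> \<open>From \<open>dense_walks\<close> with \<open>d = \<epsilon> / 2 * card V\<close>;
    the factor one half makes its density premise strict.\<close>
  define \<beta> where "\<beta> = (\<epsilon> / 2) ^ M"
  have \<beta>0: "0 < \<beta>" using \<epsilon> by (simp add: \<beta>_def)
  define \<Lambda> where "\<Lambda> = 2 * real (k * L) ^ 2 + real M"
  have \<Lambda>0: "0 < \<Lambda>" using M1 by (simp add: \<Lambda>_def add_nonneg_pos)
  define \<eta> where "\<eta> = \<beta> / 2 / \<Lambda>"
  have \<eta>0: "0 < \<eta>" using \<beta>0 \<Lambda>0 by (simp add: \<eta>_def)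
  have "\<exists>w. length w = k * L \<and> distinct w \<and> set w \<subseteq> U \<union> set D \<and> good_walk k E \<phi> w"
    if S: "setting k \<gamma> \<eta> V E \<phi>" and U: "U \<subseteq> V" and F: "F \<subseteq> {S. S \<subseteq> U \<and> card S = k - 1}"
      and cF: "\<epsilon> * real (card V) ^ (k - 1) \<le> real (card F)" and D: "D \<in> tuples V L" "distinct D"
      and nb: "\<forall>S\<in>F. set D \<subseteq> nbhd V E S"
      and alt: "\<forall>S\<in>F. \<forall>i. Suc i < L \<longrightarrow> \<phi> (insert (D ! i) S) \<noteq> \<phi> (insert (D ! Suc i) S)"
    for V :: "'a set" and E \<phi> U F D
  proof -
    let ?n = "real (card V)"
    have fin: "finite V" using S by (rule setting_finite)
    have finU: "finite U" using finite_subset[OF U fin] .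
    have n0: "0 < ?n"
    proof (rule ccontr)
      assume "\<not> 0 < ?n"
      then have "?n = 0" by simp
      then show False using S unfolding setting_def by simp
    qed
    have lD: "length D = L" "set D \<subseteq> V" using D by (auto simp: tuples_def)
    have "(\<epsilon> / 2 * ?n) * real (card U) ^ (r - 1) \<le> (\<epsilon> / 2 * ?n) * ?n ^ (r - 1)"
      using \<epsilon> card_mono[OF fin U] by (intro mult_left_mono power_mono) auto
    also have "\<dots> = \<epsilon> / 2 * ?n ^ r" using kr by (simp add: power_eq_if[of _ r])
    also have "\<dots> < \<epsilon> * ?n ^ r" using \<epsilon> n0 by simp
    also have "\<dots> \<le> real (card F)" using cF by (simp add: r_def)
    finally have dF: "(\<epsilon> / 2 * ?n) * real (card U) ^ (r - 1) < real (card F)" .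
    define X where "X = {y \<in> tuples U M. walk r F y}"
    have "(\<epsilon> / 2 * ?n) ^ M \<le> real (card X)" unfolding X_def
      by (rule dense_walks[OF finU _ _ _ dF]) (use F kr \<epsilon> in auto)
    then have X: "\<beta> * ?n ^ M \<le> real (card X)" by (simp add: \<beta>_def flip: power_mult_distrib)
    have XT: "X \<subseteq> tuples V M" using U by (auto simp: X_def tuples_def)
    let ?vs = "map Inl [0..<r * L] :: (nat + 'a) list"
    let ?ds = "map Inr D :: (nat + 'a) list"
    let ?\<tau> = "interleave r ?vs ?ds"
    have lt: "length ?\<tau> = k * L" using lD kr by simp
    have st: "set ?\<tau> = set ?vs \<union> set ?ds" by (rule set_interleave) (use lD kr in auto)
    have "\<beta> / 2 * ?n ^ M \<le> real (card {y \<in> X. generic k E \<phi> {} ?\<tau> y})"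
    proof (rule many_generic[OF S _ _ _ M1 _ _ XT X])
      show "distinct ?\<tau>"
        by (rule distinct_interleave) (use lD D(2) kr in \<open>auto simp: distinct_map\<close>)
      show "(2 * real (length ?\<tau>) ^ 2 + real M) * \<eta> \<le> \<beta> / 2"
        unfolding lt \<Lambda>_def[symmetric] using \<Lambda>0 by (simp add: \<eta>_def)
      show "j < M" if "Inl j \<in> set ?\<tau>" for j using that unfolding st by (auto simp: M_def)
      show "v \<in> V" if "Inr v \<in> set ?\<tau>" for v using that lD unfolding st by auto
    qed (use \<eta>0 in auto)
    moreover have "0 < \<beta> / 2 * ?n ^ M" using \<beta>0 n0 by simp
    ultimately have "0 < real (card {y \<in> X. generic k E \<phi> {} ?\<tau> y})" by linarith
    then have "{y \<in> X. generic k E \<phi> {} ?\<tau> y} \<noteq> {}" by (metis card.empty of_nat_0 less_irrefl)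
    then obtain y where y: "y \<in> X" "generic k E \<phi> {} ?\<tau> y" by blast
    have ly: "length y = r * L" "set y \<subseteq> U" "walk r F y" using y(1) by (auto simp: X_def tuples_def M_def)
    define w where "w = interleave r y D"
    have f: "fill ?\<tau> y = w" unfolding w_def by (rule fill_interleave) (use ly lD kr in auto)
    have lw: "length w = k * L" using ly lD kr by (simp add: w_def)
    have dw: "distinct w" using y(2) by (simp add: generic_def f)
    have sw: "set w = set y \<union> set D" unfolding w_def by (rule set_interleave) (use ly lD kr in auto)
    have pos: "\<exists>j t. p = j * k + t \<and> t \<le> r \<and> j < L" if "p < k * L" for p
    proof (intro exI conjI)
      show "p = (p div k) * k + p mod k" by simp
      show "p mod k \<le> r" using kr mod_less_divisor[of k p] by simp
      show "p div k < L" using that by (simp add: less_mult_imp_div_less mult.commute)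
    qed
    have winF: "win r y (j * r + t) \<in> F" and winw: "win k w (j * k + t) = insert (D ! j) (win r y (j * r + t))"
      if "j * k + t + k \<le> k * L" "t \<le> r" for j t
    proof -
      have "j * k < k * L" using that kr by simp
      then have "j * k < L * k" by (simp only: mult.commute)
      then have j: "Suc j \<le> L" by (simp only: mult_less_cancel2 Suc_le_eq)
      have "j * r + t + r \<le> r * L"
      proof (cases "t = 0")
        case True
        have "Suc j * r \<le> L * r" using j by (intro mult_le_mono1)
        then show ?thesis using True by (simp add: algebra_simps)
      next
        case False
        then have "Suc j * k < L * k" using that by (simp add: mult.commute)
        then have "Suc (Suc j) \<le> L" using mult_less_cancel2[of "Suc j" k L] by simp
        then have "Suc (Suc j) * r \<le> L * r" by (intro mult_le_mono1)
        then show ?thesis using that(2) by (simp add: algebra_simps)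
      qed
      then show "win r y (j * r + t) \<in> F" using ly unfolding walk_def by simp
      show "win k w (j * k + t) = insert (D ! j) (win r y (j * r + t))"
        unfolding w_def kr(1) by (rule win_interleave) (use that ly lD kr in auto)
    qed
    have W: "walk k E w"
      unfolding walk_def
    proof (intro allI impI)
      fix p assume p: "p + k \<le> length w"
      then have "p < k * L" using lw kr by simp
      then obtain j t where jt: "p = j * k + t" "t \<le> r" "j < L" using pos by blast
      have b: "j * k + t + k \<le> k * L" using p jt lw by simp
      have "D ! j \<in> set D" using jt(3) lD by simp
      then have "D ! j \<in> nbhd V E (win r y (j * r + t))" using nb winF[OF b jt(2)] by blast
      then show "win k w p \<in> E" using winw[OF b jt(2)] jt(1) by (simp add: nbhd_def)
    qed
    have "separated k \<phi> w"
      unfolding separated_def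
    proof (intro allI impI)
      fix p q assume pq: "p < q" "q < p + k" "q + k \<le> length w"
      show "\<phi> (win k w p) \<noteq> \<phi> (win k w q)"
      proof (cases "\<exists>s\<in>{p..<q} \<union> {p + k..<q + k}. \<exists>l. ?\<tau> ! s = Inl l")
        case True
        have "win k w p \<in> E" "win k w q \<in> E" using W pq unfolding walk_def by auto
        then show ?thesis using y(2) True pq lt lw unfolding generic_def f by metis
      next
        case False
        have var: "\<exists>l. ?\<tau> ! (j * k + t) = Inl l" if "t < r" "j * k + t < k * L" for j t
        proof -
          have "j * k < k * L" using that by linarith
          then have "j * k < L * k" by (simp only: mult.commute)
      then have j: "Suc j \<le> L" by (simp only: mult_less_cancel2 Suc_le_eq)
          have "Suc j * r \<le> L * r" using j by (intro mult_le_mono1)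
          then have "j * r + t < r * L" using that(1) by (simp add: algebra_simps)
          moreover have "?\<tau> ! (j * Suc r + t) = ?vs ! (j * r + t)"
            by (rule nth_interleave_s) (use that lD kr in auto)
          ultimately show ?thesis using kr by simp
        qed
        have pk: "p < k * L" "p + 1 < k * L" using pq lw kr by auto
        obtain j t where jt: "p = j * k + t" "t \<le> r" "j < L" using pos[OF pk(1)] by blast
        \<comment> \<open>Position \<open>p\<close> is in the symmetric difference, hence occupied
          by an entry of \<open>D\<close>. Position \<open>p + 1\<close> is free, hence outside the
          symmetric difference, and this leaves only \<open>q = p + 1\<close>.\<close>
        have t: "t = r"
        proof (rule ccontr)
          assume "t \<noteq> r"
          then have "\<exists>l. ?\<tau> ! p = Inl l" using var[of t j] jt pk by simp
          then show False using False pq(1) by (meson UnI1 atLeastLessThan_iff order_refl)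
        qed
        have p1: "p + 1 = Suc j * k + 0" using jt t kr by simp
        then have "\<exists>l. ?\<tau> ! (p + 1) = Inl l" using var[of 0 "Suc j"] kr pk by simp
        then have "p + 1 \<notin> {p..<q}" using False by blast
        then have q: "q = Suc j * k + 0" using pq p1 by simp
        have b1: "j * k + r + k \<le> k * L" and b2: "Suc j * k + 0 + k \<le> k * L" using pq jt t q lw by auto
        have "Suc (Suc j) * k \<le> L * k" using b2 by (simp add: algebra_simps)
        then have "Suc (Suc j) \<le> L" using kr by (simp only: mult_le_cancel2)
        then have "Suc j < L" by simp
        moreover have "win r y (Suc j * r + 0) \<in> F" by (rule winF[OF b2]) simp
        ultimately have "\<phi> (insert (D ! j) (win r y (Suc j * r + 0))) \<noteq> \<phi> (insert (D ! Suc j) (win r y (Suc j * r + 0)))"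
          using alt by blast
        moreover have "win k w p = insert (D ! j) (win r y (Suc j * r + 0))"
          using winw[OF b1] jt t by (simp add: add.commute)
        moreover have "win k w q = insert (D ! Suc j) (win r y (Suc j * r + 0))"
          using winw[OF b2] q by simp
        ultimately show ?thesis by simp
      qed
    qed
    with W have "good_walk k E \<phi> w" by (simp add: good_walk_def)
    then show ?thesis using lw dw sw ly by blast
  qed
  then show ?thesis using \<eta>0 by blast
qed

section \<open>Tilings by good walks and the trading of tiles\<close>

definition tiling :: "nat \<Rightarrow> 'a set set \<Rightarrow> ('a set \<Rightarrow> nat) \<Rightarrow> 'a set \<Rightarrow> nat \<Rightarrow> 'a list set \<Rightarrow> bool" where
  "tiling k E \<phi> W L T \<longleftrightarrow> finite T \<and>
     (\<forall>x\<in>T. length x = L \<and> distinct x \<and> set x \<subseteq> W \<and> good_walk k E \<phi> x) \<and>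
     (\<forall>x\<in>T. \<forall>y\<in>T. x \<noteq> y \<longrightarrow> set x \<inter> set y = {})"

lemma tiling_card:
  assumes "tiling k E \<phi> W L T" "finite W"
  shows "L * card T \<le> card W"
proof -
  have "card (\<Union>x\<in>T. set x) = (\<Sum>x\<in>T. card (set x))"
    using assms by (intro card_UN_disjoint) (auto simp: tiling_def)
  also have "\<dots> = (\<Sum>x\<in>T. L)"
    using assms by (intro sum.cong) (auto simp: tiling_def distinct_card)
  finally have "card (\<Union>x\<in>T. set x) = L * card T" by simp
  moreover have "card (\<Union>x\<in>T. set x) \<le> card W"
    using assms by (intro card_mono) (auto simp: tiling_def)
  ultimately show ?thesis by simp
qed

text \<open>The long walk is cut into \<open>q\<close> consecutive pieces of length
  \<open>L\<close>, each a good walk as an infix. For \<open>q > card T0\<close> the tiling grows,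
  which contradicts maximality.\<close>

lemma tiling_exchange:
  assumes T: "tiling k E \<phi> W L T" and L: "1 \<le> L" and T0: "T0 \<subseteq> T"
    and w: "distinct w" "good_walk k E \<phi> w" "q * L \<le> length w"
      "set w \<subseteq> (W - (\<Union>x\<in>T. set x)) \<union> (\<Union>x\<in>T0. set x)"
  shows "\<exists>T'. tiling k E \<phi> W L T' \<and> card T' = card T - card T0 + q"
proof -
  define c where "c i = take L (drop (i * L) w)" for i
  have split: "w = take (i * L) w @ c i @ drop (i * L + L) w" for i
    by (simp add: c_def drop_drop[symmetric] add.commute[of _ L] del: drop_drop)
  have cl: "length (c i) = L" if "i < q" for i
  proof -
    have "Suc i * L \<le> q * L" using that by (intro mult_le_mono1) simp
    then have "i * L + L \<le> length w" using w(3) by simp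
    then show ?thesis by (simp add: c_def)
  qed
  have cd: "distinct (c i)" for i using w(1) by (simp add: c_def)
  have cg: "good_walk k E \<phi> (c i)" for i
    using good_walk_infix[of k E \<phi> "take (i * L) w" "c i" "drop (i * L + L) w"] split[of i] w(2) by simp
  have cw: "set (c i) \<subseteq> set w" for i
    unfolding c_def using set_take_subset set_drop_subset by fastforce
  have cdis: "set (c i) \<inter> set (c j) = {}" if "i < j" for i j
  proof -
    have "Suc i * L \<le> j * L" using that by (intro mult_le_mono1) simp
    then have "set (c j) \<subseteq> set (drop (i * L + L) w)"
      unfolding c_def using set_take_subset set_drop_subset_set_drop[of "i * L + L" "j * L" w]
      by (fastforce simp: add.commute)
    moreover have "set (c i) \<inter> set (drop (i * L + L) w) = {}"
    proof -
      have "distinct (take (i * L) w @ c i @ drop (i * L + L) w)" using split[of i] w(1) by simp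
      then show ?thesis by auto
    qed
    ultimately show ?thesis by blast
  qed
  have cdis': "set (c i) \<inter> set (c j) = {}" if "i \<noteq> j" for i j
    using that cdis[of i j] cdis[of j i] by (cases "i < j") (auto simp: Int_commute)
  let ?N = "c ` {..<q}"
  have inj: "inj_on c {..<q}"
  proof (rule inj_onI, rule ccontr)
    fix i j assume "i \<in> {..<q}" "j \<in> {..<q}" "c i = c j" "i \<noteq> j"
    then have "set (c i) = {}" using cdis'[of i j] by auto
    then show False using cl[of i] \<open>i \<in> {..<q}\<close> L by simp
  qed
  have TT: "finite T" "\<And>x. x \<in> T \<Longrightarrow> length x = L \<and> distinct x \<and> set x \<subseteq> W \<and> good_walk k E \<phi> x"
    "\<And>x y. x \<in> T \<Longrightarrow> y \<in> T \<Longrightarrow> x \<noteq> y \<Longrightarrow> set x \<inter> set y = {}"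
    using T by (auto simp: tiling_def)
  have old: "set x \<inter> set w = {}" if "x \<in> T - T0" for x
  proof -
    have "set x \<inter> set y = {}" if "y \<in> T0" for y using TT(3)[of x y] that T0 \<open>x \<in> T - T0\<close> by auto
    then show ?thesis using w(4) that by blast
  qed
  have wW: "set w \<subseteq> W" using w(4) T0 TT(2) by blast
  have dj: "(T - T0) \<inter> ?N = {}"
  proof -
    have "c i \<notin> T - T0" if "i < q" for i
    proof
      assume "c i \<in> T - T0"
      then have "set (c i) \<inter> set w = {}" by (rule old)
      then have "set (c i) = {}" using Int_absorb2[OF cw[of i]] by simp
      then show False using cl[OF that] L by simp
    qed
    then show ?thesis by auto
  qed
  have "tiling k E \<phi> W L ((T - T0) \<union> ?N)"
    unfolding tiling_def
  proof (intro conjI ballI impI)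
    show "finite ((T - T0) \<union> ?N)" using TT(1) by simp
    fix x assume x: "x \<in> (T - T0) \<union> ?N"
    show "length x = L" "distinct x" "set x \<subseteq> W" "good_walk k E \<phi> x"
      using x TT(2) cl cd cg cw wW by (auto, blast)
    fix y assume y: "y \<in> (T - T0) \<union> ?N" "x \<noteq> y"
    show "set x \<inter> set y = {}"
    proof (cases "x \<in> T - T0")
      case True
      then show ?thesis
      proof (cases "y \<in> T - T0")
        case True
        then show ?thesis using TT(3) \<open>x \<in> T - T0\<close> y by auto
      next
        case False
        then show ?thesis using old[OF \<open>x \<in> T - T0\<close>] y cw by blast
      qed
    next
      case False
      then obtain i where i: "x = c i" using x by auto
      show ?thesis
      proof (cases "y \<in> T - T0")
        case True
        then show ?thesis using old[OF True] i cw by blast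
      next
        case False
        then obtain j where "y = c j" using y by auto
        then show ?thesis using i y cdis'[of i j] by auto
      qed
    qed
  qed
  moreover have "card ((T - T0) \<union> ?N) = card T - card T0 + q"
  proof -
    have "card ((T - T0) \<union> ?N) = card (T - T0) + card ?N" using TT(1) dj by (intro card_Un_disjoint) auto
    then show ?thesis using card_Diff_subset[OF finite_subset[OF T0 TT(1)] T0] card_image[OF inj] by simp
  qed
  ultimately show ?thesis by blast
qed

text \<open>Averaging for a single popular element. \<open>K\<close> replaces \<open>card B\<close>
  so that \<open>L0 / K\<close> becomes a constant when both scale with the same power of
  \<open>card V\<close>.\<close>

lemma popular_one:
  fixes L0 K :: real
  assumes "finite A" "finite B" "A \<noteq> {}" "0 < L0"
    and L: "\<And>a. a \<in> A \<Longrightarrow> L0 \<le> real (card {b \<in> B. R a b})" and K: "real (card B) \<le> K"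
  shows "\<exists>b\<in>B. L0 / K * real (card A) \<le> real (card {a \<in> A. R a b})"
proof (rule ccontr)
  assume "\<not> ?thesis"
  then have lt: "\<And>b. b \<in> B \<Longrightarrow> real (card {a \<in> A. R a b}) < L0 / K * real (card A)" by force
  obtain a where "a \<in> A" using assms(3) by auto
  then have "0 < real (card {b \<in> B. R a b})" using L assms(4) by force
  then have B: "B \<noteq> {}" by auto
  then have B0: "0 < real (card B)" using assms(2) by (simp add: card_gt_0_iff)
  have "L0 * real (card A) \<le> (\<Sum>a\<in>A. real (card {b \<in> B. R a b}))"
    using sum_mono[of A "\<lambda>_. L0", OF L] by (simp add: mult.commute)
  also have "\<dots> = (\<Sum>b\<in>B. real (card {a \<in> A. R a b}))" by (rule double_count[OF assms(1,2)])
  also have "\<dots> < (\<Sum>b\<in>B. L0 / K * real (card A))" by (rule sum_strict_mono[OF assms(2) B lt])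
  also have "\<dots> = real (card B) / K * (L0 * real (card A))" by simp
  also have "\<dots> \<le> 1 * (L0 * real (card A))"
    using K B0 assms(4) by (intro mult_right_mono) auto
  finally show False by simp
qed

definition alternating :: "('a set \<Rightarrow> nat) \<Rightarrow> 'a set \<Rightarrow> 'a list \<Rightarrow> bool" where
  "alternating \<phi> S D \<longleftrightarrow>
     (\<forall>i. Suc i < length D \<longrightarrow> \<phi> (insert (D ! i) S) \<noteq> \<phi> (insert (D ! Suc i) S))"

lemma alternating_snoc:
  assumes "alternating \<phi> S D" "D \<noteq> [] \<Longrightarrow> \<phi> (insert (last D) S) \<noteq> \<phi> (insert u S)"
  shows "alternating \<phi> S (D @ [u])"
  unfolding alternating_def
proof (intro allI impI)
  fix i assume i: "Suc i < length (D @ [u])"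
  show "\<phi> (insert ((D @ [u]) ! i) S) \<noteq> \<phi> (insert ((D @ [u]) ! Suc i) S)"
  proof (cases "Suc i < length D")
    case True
    then show ?thesis using assms(1) by (simp add: alternating_def nth_append)
  next
    case False
    then have "length D = Suc i" using i by simp
    moreover from this have "D \<noteq> []" by auto
    ultimately have "D \<noteq> []" "(D @ [u]) ! i = last D" "(D @ [u]) ! Suc i = u"
      by (auto simp: nth_append last_conv_nth)
    then show ?thesis using assms(2) by simp
  qed
qed

text \<open>Of the at least \<open>2 * \<delta>\<close> candidates, each step loses at most
  \<open>L\<close> vertices already used and \<open>\<eta> * card V\<close> vertices that would
  repeat the previous color.\<close>

lemma many_alternating:
  assumes S: "setting k \<gamma> \<eta> V E \<phi>" and T: "T \<subseteq> V" "card T = k - 1" and U: "U \<subseteq> V"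
    and \<delta>: "2 * \<delta> \<le> real (card (nbhd V E T \<inter> U))" "real L + \<eta> * real (card V) \<le> \<delta>" "0 \<le> \<delta>"
  shows "\<delta> ^ L \<le> real (card {D \<in> tuples U L. distinct D \<and> set D \<subseteq> nbhd V E T \<and> alternating \<phi> T D})"
proof (rule greedy_count)
  have fin: "finite V" using S by (rule setting_finite)
  show finU: "finite U" by (rule finite_subset[OF U fin])
  show "distinct [] \<and> set [] \<subseteq> nbhd V E T \<and> alternating \<phi> T []" by (simp add: alternating_def)
  fix D assume D: "distinct D \<and> set D \<subseteq> nbhd V E T \<and> alternating \<phi> T D" "set D \<subseteq> U" "length D < L"
  let ?N = "nbhd V E T"
  \<comment> \<open>For empty \<open>D\<close> the vertex \<open>last D\<close> is unspecified.
    \<open>C\<close> then excludes some candidates needlessly, but the color bound limits their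
    number for any color.\<close>
  define C where "C = {u \<in> ?N. \<phi> (insert u T) = \<phi> (insert (last D) T)}"
  have "real (card C) \<le> \<eta> * real (card V)" using S T by (simp add: setting_def C_def)
  moreover have "card (set D) \<le> L" using card_length[of D] D(3) by simp
  moreover have finN: "finite ?N" using fin by (simp add: nbhd_def)
  have "card (?N \<inter> U) \<le> card ((?N \<inter> U - set D - C) \<union> set D \<union> C)"
    using finN by (intro card_mono) (auto simp: C_def)
  then have "card (?N \<inter> U) \<le> card (?N \<inter> U - set D - C) + card (set D) + card C"
    using card_Un_le[of "(?N \<inter> U - set D - C) \<union> set D" C] card_Un_le[of "?N \<inter> U - set D - C" "set D"] by linarith
  ultimately have "\<delta> \<le> real (card (?N \<inter> U - set D - C))" using \<delta> by linarith
  also have "\<dots> \<le> real (card {u \<in> U. distinct (D @ [u]) \<and> set (D @ [u]) \<subseteq> ?N \<and> alternating \<phi> T (D @ [u])})"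
  proof -
    have "?N \<inter> U - set D - C \<subseteq> {u \<in> U. distinct (D @ [u]) \<and> set (D @ [u]) \<subseteq> ?N \<and> alternating \<phi> T (D @ [u])}"
    proof
      fix u assume u: "u \<in> ?N \<inter> U - set D - C"
      then have "alternating \<phi> T (D @ [u])" using D(1) by (intro alternating_snoc) (auto simp: C_def)
      then show "u \<in> {u \<in> U. distinct (D @ [u]) \<and> set (D @ [u]) \<subseteq> ?N \<and> alternating \<phi> T (D @ [u])}"
        using u D by simp
    qed
    moreover have "finite {u \<in> U. distinct (D @ [u]) \<and> set (D @ [u]) \<subseteq> ?N \<and> alternating \<phi> T (D @ [u])}"
      using finU by simp
    ultimately show ?thesis by (simp add: card_mono)
  qed
  finally show "\<delta> \<le> real (card {u \<in> U. distinct (D @ [u]) \<and> set (D @ [u]) \<subseteq> ?N \<and> alternating \<phi> T (D @ [u])})" .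
qed (use \<delta> in simp)

text \<open>The threshold \<open>h\<close> is half of the tile length \<open>2 * h\<close>: with
  \<open>h\<close> neighbors from each tile, alternating between the two gives a list of full length
  \<open>2 * h\<close>.\<close>

definition tile_pair :: "('a set \<Rightarrow> nat) \<Rightarrow> nat \<Rightarrow> 'a set \<Rightarrow> 'a set \<Rightarrow> 'a list \<Rightarrow> 'a list \<Rightarrow> bool" where
  "tile_pair \<phi> h S N x y \<longleftrightarrow> x \<noteq> y \<and> h \<le> card (N \<inter> set x) \<and> h \<le> card (N \<inter> set y) \<and>
     (\<forall>d\<in>N \<inter> set x. \<forall>d'\<in>N \<inter> set y. \<phi> (insert d S) \<noteq> \<phi> (insert d' S))"

text \<open>There are at most \<open>card V / (2 * h)\<close> tiles, so on average they contain more
  than \<open>h\<close> neighbors of \<open>A\<close>, and linearly many contain at least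
  \<open>h\<close>. Among pairs of such tiles only \<open>2 * \<eta> * card V ^ 2\<close> fail, by
  being equal or by a clash between two of their vertices.\<close>

lemma many_tile_pairs:
  assumes S: "setting k \<gamma> \<eta> V E \<phi>" and A: "A \<subseteq> V" "card A = k - 1" and h: "1 \<le> h" and \<gamma>: "0 < \<gamma>"
    and T: "tiling k E \<phi> W (2 * h) T" "W \<subseteq> V"
    and sum: "(1/2 + \<gamma>/4) * real (card V) \<le> (\<Sum>x\<in>T. real (card (nbhd V E A \<inter> set x)))"
    and \<eta>: "\<eta> \<le> (\<gamma> / (8 * real h)) ^ 2 / 4"
  shows "(\<gamma> / (8 * real h)) ^ 2 / 2 * real (card V) ^ 2
    \<le> real (card {p \<in> T \<times> T. tile_pair \<phi> h A (nbhd V E A) (fst p) (snd p)})"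
proof -
  let ?n = "real (card V)" and ?N = "nbhd V E A"
  define \<rho> where "\<rho> = \<gamma> / (8 * real h)"
  have \<rho>0: "0 < \<rho>" using \<gamma> h by (simp add: \<rho>_def)
  have fin: "finite V" using S by (rule setting_finite)
  have finW: "finite W" by (rule finite_subset[OF T(2) fin])
  have finT: "finite T" and Tl: "\<And>x. x \<in> T \<Longrightarrow> length x = 2 * h \<and> distinct x \<and> set x \<subseteq> W"
    and Td: "\<And>x y. x \<in> T \<Longrightarrow> y \<in> T \<Longrightarrow> x \<noteq> y \<Longrightarrow> set x \<inter> set y = {}"
    using T(1) by (auto simp: tiling_def)
  have "2 * h * card T \<le> card W" by (rule tiling_card[OF T(1) finW])
  also have "\<dots> \<le> card V" by (rule card_mono[OF fin T(2)])
  finally have cT: "2 * h * card T \<le> card V" .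
  then have cT': "2 * real h * real (card T) \<le> ?n" by (metis of_nat_le_iff of_nat_mult of_nat_numeral)
  define G where "G = {x \<in> T. h \<le> card (?N \<inter> set x)}"
  have finG: "finite G" using finT by (simp add: G_def)
  have "(\<Sum>x\<in>T. real (card (?N \<inter> set x))) \<le> (\<Sum>x\<in>T. (if x \<in> G then 2 * real h else 0) + real h)"
  proof (rule sum_mono)
    fix x assume x: "x \<in> T"
    have "card (?N \<inter> set x) \<le> card (set x)" by (intro card_mono) auto
    also have "\<dots> \<le> 2 * h" using Tl[OF x] card_length[of x] by simp
    finally have "real (card (?N \<inter> set x)) \<le> 2 * real h" by linarith
    then show "real (card (?N \<inter> set x)) \<le> (if x \<in> G then 2 * real h else 0) + real h"
      using x by (auto simp: G_def)
  qed
  also have "\<dots> = 2 * real h * real (card G) + real h * real (card T)"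
  proof -
    have "(\<Sum>x\<in>T. if x \<in> G then 2 * real h else 0) = (\<Sum>x\<in>G. 2 * real h)"
      using finT by (intro sum.mono_neutral_cong_right) (auto simp: G_def)
    then show ?thesis by (simp add: sum.distrib)
  qed
  finally have "\<gamma> / 4 * ?n \<le> 2 * real h * real (card G)" using sum cT' by (simp add: algebra_simps)
  then have cG: "\<rho> * ?n \<le> real (card G)" using h by (simp add: \<rho>_def field_simps)
  define K where "K = (SIGMA d:?N. {d' \<in> ?N. \<phi> (insert d' A) = \<phi> (insert d A)})"
  have finN: "finite ?N" using fin by (simp add: nbhd_def)
  have NV: "card ?N \<le> card V" using fin by (intro card_mono) (auto simp: nbhd_def)
  have finK: "finite K" using finN by (simp add: K_def)
  have "real (card K) = (\<Sum>d\<in>?N. real (card {d' \<in> ?N. \<phi> (insert d' A) = \<phi> (insert d A)}))"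
    using finN by (simp add: K_def card_SigmaI)
  also have "\<dots> \<le> (\<Sum>d\<in>?N. \<eta> * ?n)"
    using S A by (intro sum_mono) (simp add: setting_def)
  also have "\<dots> = real (card ?N) * (\<eta> * ?n)" by simp
  also have "\<dots> \<le> ?n * (\<eta> * ?n)"
    using NV S by (intro mult_right_mono) (auto simp: setting_def)
  finally have cK: "real (card K) \<le> \<eta> * ?n ^ 2" by (simp add: power2_eq_square algebra_simps)
  \<comment> \<open>The tile containing \<open>d\<close>, unique by disjointness and arbitrary if
    there is none. It recovers a spoiled pair of tiles from a clashing pair of vertices, so there
    are at most \<open>card K\<close> spoiled pairs.\<close>
  define t where "t d = (SOME x. x \<in> T \<and> d \<in> set x)" for d
  have t: "t d = x" if "x \<in> T" "d \<in> set x" for d x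
  proof -
    have "t d \<in> T \<and> d \<in> set (t d)" unfolding t_def by (rule someI[of _ x]) (use that in simp)
    then show ?thesis using Td[of "t d" x] that by auto
  qed
  let ?P = "{p \<in> T \<times> T. tile_pair \<phi> h A ?N (fst p) (snd p)}"
  let ?Q = "(\<lambda>(d, d'). (t d, t d')) ` K"
  let ?I = "(\<lambda>x. (x, x)) ` G"
  have "G \<times> G \<subseteq> ?P \<union> ?I \<union> ?Q"
  proof
    fix p assume "p \<in> G \<times> G"
    then obtain x y where p: "p = (x, y)" "x \<in> G" "y \<in> G" by auto
    show "p \<in> ?P \<union> ?I \<union> ?Q"
    proof (cases "x = y \<or> tile_pair \<phi> h A ?N x y")
      case True
      then show ?thesis using p by (auto simp: G_def)
    next
      case False
      then obtain d d' where d: "d \<in> ?N \<inter> set x" "d' \<in> ?N \<inter> set y" "\<phi> (insert d A) = \<phi> (insert d' A)"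
        using p unfolding tile_pair_def G_def by auto
      then have "(d, d') \<in> K" by (simp add: K_def)
      moreover have "t d = x" "t d' = y" using d p by (auto intro!: t simp: G_def)
      ultimately have "p \<in> ?Q" using p(1) by (intro image_eqI[of _ _ "(d, d')"]) auto
      then show ?thesis by blast
    qed
  qed
  moreover have finP: "finite ?P" using finT by simp
  ultimately have "card (G \<times> G) \<le> card (?P \<union> ?I \<union> ?Q)" using finG finK by (intro card_mono) auto
  also have "\<dots> \<le> card ?P + card ?I + card ?Q"
    using card_Un_le[of "?P \<union> ?I" ?Q] card_Un_le[of ?P ?I] by linarith
  also have "\<dots> \<le> card ?P + card G + card K"
    using card_image_le[OF finG, of "\<lambda>x. (x, x)"] card_image_le[OF finK, of "\<lambda>(d, d'). (t d, t d')"] by linarith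
  finally have "card G * card G \<le> card ?P + card G + card K" by (simp add: card_cartesian_product)
  then have "real (card G * card G) \<le> real (card ?P + card G + card K)" by (rule of_nat_mono)
  then have main: "real (card G) ^ 2 \<le> real (card ?P) + real (card G) + real (card K)"
    by (simp add: power2_eq_square)
  have "card G \<le> card T" using finT by (intro card_mono) (auto simp: G_def)
  also have "\<dots> \<le> card V" using cT h by (metis le_trans mult_le_mono1 nat_mult_1 one_le_mult_iff one_le_numeral)
  finally have "real (card G) \<le> ?n" by simp
  \<comment> \<open>\<open>1 \<le> \<eta> * card V\<close> turns the linearly many diagonal pairs
    into an error of the same quadratic form as the clashes.\<close>
  also have "\<dots> \<le> (\<eta> * ?n) * ?n"
  proof -
    have "1 * ?n \<le> (\<eta> * ?n) * ?n" using S by (intro mult_right_mono) (auto simp: setting_def)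
    then show ?thesis by simp
  qed
  finally have cG2: "real (card G) \<le> \<eta> * ?n ^ 2" by (simp add: power2_eq_square algebra_simps)
  have "(\<rho> * ?n) ^ 2 \<le> real (card G) ^ 2" using cG \<rho>0 by (intro power_mono) auto
  then have "\<rho> ^ 2 * ?n ^ 2 - 2 * (\<eta> * ?n ^ 2) \<le> real (card ?P)"
    using main cG2 cK by (simp add: power_mult_distrib)
  moreover have "\<eta> * ?n ^ 2 \<le> \<rho> ^ 2 / 4 * ?n ^ 2" using \<eta> by (intro mult_right_mono) (auto simp: \<rho>_def)
  ultimately show ?thesis unfolding \<rho>_def by (simp add: algebra_simps)
qed

text \<open>Consecutive entries come from different tiles, and vertices from different tiles never
  give the same color.\<close>

lemma tile_pair_alternating:
  assumes "tile_pair \<phi> h S N x y" "set x \<inter> set y = {}" "finite N" "1 \<le> h"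
  shows "\<exists>D\<in>tuples (set x \<union> set y) (2 * h). distinct D \<and> set D \<subseteq> N \<and> alternating \<phi> S D"
proof -
  have "\<exists>D. length D = h \<and> distinct D \<and> set D \<subseteq> N \<inter> set z" if z: "h \<le> card (N \<inter> set z)" for z
  proof -
    obtain B where B: "B \<subseteq> N \<inter> set z" "card B = h" "finite B"
      using obtain_subset_with_card_n[OF z] by metis
    then obtain D where "set D = B" "distinct D" using finite_distinct_list by blast
    then show ?thesis using B distinct_card[of D] by (intro exI[of _ D]) auto
  qed
  then obtain D1 D2 where D1: "length D1 = h" "distinct D1" "set D1 \<subseteq> N \<inter> set x"
    and D2: "length D2 = h" "distinct D2" "set D2 \<subseteq> N \<inter> set y"
    using assms(1) unfolding tile_pair_def by meson
  define D where "D = interleave 1 D1 D2"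
  have sD: "set D = set D1 \<union> set D2" unfolding D_def by (rule set_interleave[where L = h]) (use D1 D2 in auto)
  have dD: "distinct D" unfolding D_def
    by (rule distinct_interleave[where L = h]) (use D1 D2 assms(2) in auto)
  have lD: "length D = 2 * h" using D1 D2 by (simp add: D_def)
  have "alternating \<phi> S D"
    unfolding alternating_def
  proof (intro allI impI)
    fix i assume i: "Suc i < length D"
    define j where "j = i div 2"
    have col: "\<phi> (insert d S) \<noteq> \<phi> (insert d' S)" if "d \<in> set D1" "d' \<in> set D2" for d d'
      using assms(1) that D1 D2 unfolding tile_pair_def by blast
    have n1: "D ! (j * 2) = D1 ! j" if "j * 2 < 2 * h" for j
      using nth_interleave_s[of 0 1 j D1 D2] that D1 D2 by (simp add: D_def numeral_2_eq_2)
    have n2: "D ! (j * 2 + 1) = D2 ! j" if "j * 2 + 1 < 2 * h" for j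
      using nth_interleave_v[of j 1 D1 D2] that D1 D2 by (simp add: D_def numeral_2_eq_2)
    show "\<phi> (insert (D ! i) S) \<noteq> \<phi> (insert (D ! Suc i) S)"
    proof (cases "even i")
      case True
      then have ij: "i = j * 2" by (simp add: j_def)
      then have "D ! i = D1 ! j" "D ! Suc i = D2 ! j" "j < h" using n1[of j] n2[of j] i lD by auto
      then show ?thesis using col D1 D2 by simp
    next
      case False
      then have ij: "i = j * 2 + 1" unfolding j_def by presburger
      then have si: "Suc i = Suc j * 2" by simp
      then have "D ! i = D2 ! j" "D ! Suc i = D1 ! Suc j" "Suc j < h"
        using n1[of "Suc j"] n2[of j] ij i lD by auto
      then show ?thesis using col[of "D1 ! Suc j" "D2 ! j"] D1 D2 by simp
    qed
  qed
  then show ?thesis using dD sD lD D1 D2 by (intro bexI[of _ D]) (auto simp: tuples_def)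
qed

text \<open>In a maximal tiling at most two tiles can be traded for a path on \<open>k * L \<ge> 3 * L\<close> vertices. If many
  vertices were left over, averaging would produce the list \<open>D\<close> for such a trade: either inside the
  leftover set, or alternating between two tiles half of which are neighbors of many leftover
  \<open>(k - 1)\<close>-sets. Two tiles are needed because all extensions of a set into a single tile may have the
  same color.\<close>

lemma almost_cover:
  assumes k: "3 \<le> k" and \<gamma>: "0 < \<gamma>" and h: "1 \<le> h" and \<zeta>: "0 < \<zeta>"
  shows "\<exists>\<eta>>0. \<forall>(V :: 'a set) E \<phi> Z. setting k \<gamma> \<eta> V E \<phi> \<longrightarrow> Z \<subseteq> V \<longrightarrow>
     real (card Z) \<le> \<gamma> / 2 * real (card V) \<longrightarrow>
     (\<exists>T. tiling k E \<phi> (V - Z) (2 * h) T \<and> real (card (V - Z - (\<Union>x\<in>T. set x))) \<le> \<zeta> * real (card V))"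
proof -
  define L where "L = 2 * h"
  have L1: "1 \<le> L" using h by (simp add: L_def)
  \<comment> \<open>From the lower bound \<open>(card U / (k - 1)) ^ (k - 1)\<close> for the number
    of \<open>(k - 1)\<close>-subsets of the leftover set \<open>U\<close>.\<close>
  define \<sigma> where "\<sigma> = (\<zeta> / real (k - 1)) ^ (k - 1)"
  have \<sigma>0: "0 < \<sigma>" using \<zeta> k by (simp add: \<sigma>_def)
  \<comment> \<open>\<open>\<kappa>1\<close> and \<open>\<kappa>2\<close> are the proportions of
    sets served by one common \<open>D\<close>. Inside the leftover, a set has
    \<open>(\<gamma> / 8 * card V) ^ L\<close> suitable lists out of \<open>card V ^ L\<close>. With
    tiles, it has a proportion \<open>\<rho> ^ 2 / 2\<close> of the \<open>card V ^ 2\<close> pairs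
    and then one of at most \<open>(2 * L) ^ L\<close> lists in a fixed pair. In
    \<open>\<epsilon>\<close>, the factor \<open>\<sigma> / 2\<close> reflects that one of the two
    kinds of sets makes up at least half.\<close>
  define \<kappa>1 where "\<kappa>1 = (\<gamma> / 8) ^ L"
  define \<rho> where "\<rho> = \<gamma> / (8 * real h)"
  define \<kappa>2 where "\<kappa>2 = \<rho> ^ 2 / 2 / real (2 * L) ^ L"
  have \<kappa>: "0 < \<kappa>1" "0 < \<kappa>2" "0 < \<rho>" using \<gamma> h L1 by (auto simp: \<kappa>1_def \<kappa>2_def \<rho>_def)
  define \<epsilon> where "\<epsilon> = min \<kappa>1 \<kappa>2 * (\<sigma> / 2)"
  have \<epsilon>0: "0 < \<epsilon>" using \<kappa> \<sigma>0 by (simp add: \<epsilon>_def)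
  obtain \<eta>1 where \<eta>1: "0 < \<eta>1" and path: "\<forall>(V :: 'a set) E \<phi> U F D.
     setting k \<gamma> \<eta>1 V E \<phi> \<longrightarrow> U \<subseteq> V \<longrightarrow> F \<subseteq> {S. S \<subseteq> U \<and> card S = k - 1} \<longrightarrow>
     \<epsilon> * real (card V) ^ (k - 1) \<le> real (card F) \<longrightarrow>
     D \<in> tuples V L \<longrightarrow> distinct D \<longrightarrow>
     (\<forall>S\<in>F. set D \<subseteq> nbhd V E S) \<longrightarrow>
     (\<forall>S\<in>F. \<forall>i. Suc i < L \<longrightarrow> \<phi> (insert (D ! i) S) \<noteq> \<phi> (insert (D ! Suc i) S)) \<longrightarrow>
     (\<exists>w. length w = k * L \<and> distinct w \<and> set w \<subseteq> U \<union> set D \<and> good_walk k E \<phi> w)"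
    using interleaved_path[OF k L1 \<epsilon>0, of \<gamma>] by (elim exE conjE) (rule that)
  \<comment> \<open>The last three terms serve \<open>many_alternating\<close>,
    \<open>many_tile_pairs\<close>, and the existence of \<open>(k - 1)\<close>-subsets of the
    leftover, through \<open>k \<le> \<zeta> * card V\<close>.\<close>
  define \<eta> where "\<eta> = min \<eta>1 (min (\<gamma> / (8 * (real L + 1))) (min (\<rho> ^ 2 / 4) (\<zeta> / real k)))"
  have \<eta>0: "0 < \<eta>" using \<eta>1 \<gamma> \<kappa> \<zeta> k by (simp add: \<eta>_def add_nonneg_pos)
  have "\<exists>T. tiling k E \<phi> (V - Z) L T \<and> real (card (V - Z - (\<Union>x\<in>T. set x))) \<le> \<zeta> * real (card V)"
    if S: "setting k \<gamma> \<eta> V E \<phi>" and Z: "Z \<subseteq> V" "real (card Z) \<le> \<gamma> / 2 * real (card V)"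
    for V :: "'a set" and E \<phi> Z
  proof -
    let ?n = "real (card V)"
    have fin: "finite V" using S by (rule setting_finite)
    have n1: "1 \<le> \<eta> * ?n" using S by (simp add: setting_def)
    have n0: "0 < ?n" using n1 \<eta>0 by (cases "?n = 0") auto
    have S1: "setting k \<gamma> \<eta>1 V E \<phi>" using S by (rule setting_mono) (simp add: \<eta>_def)
    define W where "W = V - Z"
    have WV: "W \<subseteq> V" and finW: "finite W" using fin by (auto simp: W_def)
    have bound: "card T \<le> card W" if "tiling k E \<phi> W L T" for T
      using tiling_card[OF that finW] L1 by (metis le_trans mult_le_mono1 nat_mult_1)
    have "tiling k E \<phi> W L {}" by (simp add: tiling_def)
    then obtain T where T: "tiling k E \<phi> W L T" and mx: "\<And>T'. tiling k E \<phi> W L T' \<Longrightarrow> card T' \<le> card T"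
      using ex_has_greatest_nat[of "tiling k E \<phi> W L" "{}" card "Suc (card W)"] bound by (metis le_imp_less_Suc)
    define U where "U = W - (\<Union>x\<in>T. set x)"
    have UV: "U \<subseteq> V" and finU: "finite U" using WV finW by (auto simp: U_def)
    have "real (card U) \<le> \<zeta> * ?n"
    proof (rule ccontr)
      assume "\<not> real (card U) \<le> \<zeta> * ?n"
      then have big: "\<zeta> * ?n \<le> real (card U)" by simp
      have no_exchange: False if "T0 \<subseteq> T" "distinct w" "good_walk k E \<phi> w" "length w = k * L"
        "set w \<subseteq> U \<union> (\<Union>x\<in>T0. set x)" "card T0 < 3" for T0 w
      proof -
        have "k * L \<ge> 3 * L" using k by (intro mult_le_mono1)
        then have "\<exists>T'. tiling k E \<phi> W L T' \<and> card T' = card T - card T0 + 3"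
          using that by (intro tiling_exchange[OF T L1]) (auto simp: U_def)
        then obtain T' where T': "tiling k E \<phi> W L T'" "card T' = card T - card T0 + 3" by blast
        then show False using mx[OF T'(1)] that(6) by linarith
      qed
      define \<S> where "\<S> = {A. A \<subseteq> U \<and> card A = k - 1}"
      have fin\<S>: "finite \<S>" using finU by (simp add: \<S>_def)
      have "real k * 1 \<le> real k * (\<zeta> / real k * ?n)"
      proof (rule mult_left_mono)
        have "\<eta> * ?n \<le> \<zeta> / real k * ?n" by (intro mult_right_mono) (auto simp: \<eta>_def)
        then show "1 \<le> \<zeta> / real k * ?n" using n1 by linarith
      qed simp
      then have "real k \<le> real (card U)" using big k by simp
      then have kU: "k - 1 \<le> card U" by simp
      have "\<sigma> * ?n ^ (k - 1) = (\<zeta> * ?n / real (k - 1)) ^ (k - 1)"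
        by (simp add: \<sigma>_def power_divide power_mult_distrib)
      also have "\<dots> \<le> (real (card U) / real (k - 1)) ^ (k - 1)"
        using big \<zeta> by (intro power_mono divide_right_mono) auto
      also have "\<dots> \<le> real (card U choose (k - 1))" by (rule binomial_ge_n_over_k_pow_k[OF kU])
      also have "\<dots> = real (card \<S>)" using n_subsets[OF finU, of "k - 1"] by (simp add: \<S>_def)
      finally have c\<S>: "\<sigma> * ?n ^ (k - 1) \<le> real (card \<S>)" .
      define \<A> where "\<A> = {A \<in> \<S>. \<gamma> / 4 * ?n \<le> real (card (nbhd V E A \<inter> U))}"
      define \<B> where "\<B> = \<S> - \<A>"
      have "card \<S> = card \<A> + card \<B>"
      proof -
        have "\<S> = \<A> \<union> \<B>" "\<A> \<inter> \<B> = {}" by (auto simp: \<A>_def \<B>_def)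
        moreover have "finite \<A>" "finite \<B>" using fin\<S> by (auto simp: \<A>_def \<B>_def)
        ultimately show ?thesis using card_Un_disjoint by metis
      qed
      then have "real (card \<S>) \<le> 2 * real (card \<A>) \<or> real (card \<S>) \<le> 2 * real (card \<B>)" by linarith
      then show False
      proof
        assume "real (card \<S>) \<le> 2 * real (card \<A>)"
        then have c\<A>: "\<sigma> / 2 * ?n ^ (k - 1) \<le> real (card \<A>)" using c\<S> by simp
        have "0 < \<sigma> / 2 * ?n ^ (k - 1)" using \<sigma>0 n0 by simp
        then have ne: "\<A> \<noteq> {}" using c\<A> by auto
        have fin\<A>: "finite \<A>" using fin\<S> by (simp add: \<A>_def)
        let ?R = "\<lambda>A D. distinct D \<and> set D \<subseteq> nbhd V E A \<and> alternating \<phi> A D"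
        have "\<exists>D\<in>tuples U L. (\<gamma> / 8 * ?n) ^ L / ?n ^ L * real (card \<A>) \<le> real (card {A \<in> \<A>. ?R A D})"
        proof (rule popular_one[OF fin\<A> finite_tuples[OF finU] ne])
          show "0 < (\<gamma> / 8 * ?n) ^ L" using \<gamma> n0 by simp
          show "real (card (tuples U L)) \<le> ?n ^ L"
            using card_mono[OF fin UV] by (simp add: card_tuples[OF finU] power_mono)
          fix A assume A: "A \<in> \<A>"
          have "real L * 1 \<le> real L * (\<eta> * ?n)" using n1 by (intro mult_left_mono) auto
          then have "real L + \<eta> * ?n \<le> (real L + 1) * \<eta> * ?n" by (simp add: algebra_simps)
          also have "\<dots> \<le> (real L + 1) * (\<gamma> / (8 * (real L + 1))) * ?n"
            by (intro mult_right_mono mult_left_mono) (auto simp: \<eta>_def)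
          also have "\<dots> = \<gamma> / 8 * ?n"
          proof -
            have "(real L + 1) * (\<gamma> / (8 * (real L + 1))) = \<gamma> / 8"
              by (simp add: divide_simps)
            then show ?thesis by (simp only:)
          qed
          finally have "real L + \<eta> * ?n \<le> \<gamma> / 8 * ?n" .
          then show "(\<gamma> / 8 * ?n) ^ L \<le> real (card {D \<in> tuples U L. ?R A D})"
            using A UV \<gamma> by (intro many_alternating[OF S _ _ UV]) (auto simp: \<A>_def \<S>_def)
        qed
        then obtain D where D: "D \<in> tuples U L"
          "(\<gamma> / 8 * ?n) ^ L / ?n ^ L * real (card \<A>) \<le> real (card {A \<in> \<A>. ?R A D})" by blast
        define F where "F = {A \<in> \<A>. ?R A D}"
        have "(\<gamma> / 8 * ?n) ^ L / ?n ^ L = \<kappa>1"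
          using n0 by (simp add: \<kappa>1_def power_mult_distrib power_divide)
        then have "\<kappa>1 * real (card \<A>) \<le> real (card F)" using D(2) by (simp add: F_def)
        moreover have "\<epsilon> * ?n ^ (k - 1) \<le> \<kappa>1 * (\<sigma> / 2 * ?n ^ (k - 1))"
          using \<sigma>0 by (simp add: \<epsilon>_def mult.assoc[symmetric] mult_right_mono)
        moreover have "\<kappa>1 * (\<sigma> / 2 * ?n ^ (k - 1)) \<le> \<kappa>1 * real (card \<A>)"
          using c\<A> \<kappa> by (intro mult_left_mono) auto
        ultimately have cF: "\<epsilon> * ?n ^ (k - 1) \<le> real (card F)" by linarith
        have "0 < \<epsilon> * ?n ^ (k - 1)" using \<epsilon>0 n0 by simp
        then have "F \<noteq> {}" using cF by auto
        then have dD: "distinct D" by (auto simp: F_def)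
        have DU: "set D \<subseteq> U" "length D = L" using D(1) by (auto simp: tuples_def)
        have "\<exists>w. length w = k * L \<and> distinct w \<and> set w \<subseteq> U \<union> set D \<and> good_walk k E \<phi> w"
        proof (rule path[rule_format, OF S1 UV _ cF _ dD])
          show "F \<subseteq> {S. S \<subseteq> U \<and> card S = k - 1}" by (auto simp: F_def \<A>_def \<S>_def)
          show "D \<in> tuples V L" using DU UV by (auto simp: tuples_def)
        qed (use DU in \<open>auto simp: F_def alternating_def\<close>)
        then show False using no_exchange[of "{}"] DU by (auto simp: Un_absorb2)
      next
        assume "real (card \<S>) \<le> 2 * real (card \<B>)"
        then have c\<B>: "\<sigma> / 2 * ?n ^ (k - 1) \<le> real (card \<B>)" using c\<S> by simp
        have p0: "0 < \<sigma> / 2 * ?n ^ (k - 1)" using \<sigma>0 n0 by simp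
        then have ne: "\<B> \<noteq> {}" using c\<B> by auto
        have fin\<B>: "finite \<B>" using fin\<S> by (simp add: \<B>_def)
        have finT: "finite T" using T by (simp add: tiling_def)
        let ?R = "\<lambda>A p. tile_pair \<phi> h A (nbhd V E A) (fst p) (snd p)"
        have "\<exists>p\<in>T \<times> T. (\<rho> ^ 2 / 2 * ?n ^ 2) / ?n ^ 2 * real (card \<B>) \<le> real (card {A \<in> \<B>. ?R A p})"
        proof (rule popular_one[OF fin\<B> _ ne])
          show "finite (T \<times> T)" using finT by simp
          show "0 < \<rho> ^ 2 / 2 * ?n ^ 2" using \<kappa> n0 by simp
          have "card T \<le> card V" using bound[OF T] card_mono[OF fin WV] by simp
          then have "card T * card T \<le> card V * card V" by (rule mult_le_mono) fact
          then show "real (card (T \<times> T)) \<le> ?n ^ 2"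
            by (simp add: card_cartesian_product power2_eq_square flip: of_nat_mult)
          fix A assume A: "A \<in> \<B>"
          have AV: "A \<subseteq> V" "card A = k - 1" using A UV by (auto simp: \<B>_def \<S>_def)
          show "\<rho> ^ 2 / 2 * ?n ^ 2 \<le> real (card {p \<in> T \<times> T. ?R A p})"
            unfolding \<rho>_def
          proof (rule many_tile_pairs[OF S AV h \<gamma> T[unfolded L_def] WV])
            show "\<eta> \<le> (\<gamma> / (8 * real h)) ^ 2 / 4"
              unfolding \<eta>_def \<rho>_def by (rule min.coboundedI2[OF min.coboundedI2[OF min.cobounded1]])
            let ?N = "nbhd V E A"
            have finN: "finite ?N" using fin by (simp add: nbhd_def)
            \<comment> \<open>At most \<open>\<gamma> / 2 * card V\<close> of the neighbors lie in
              \<open>Z\<close> and \<open>\<gamma> / 4 * card V\<close> in \<open>U\<close>; the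
              tiles contain the rest.\<close>
            have "(1/2 + \<gamma>) * ?n \<le> real (card ?N)" using S AV by (simp add: setting_def)
            moreover have "card ?N \<le> card (Z \<union> (?N \<inter> U) \<union> (\<Union>x\<in>T. ?N \<inter> set x))"
              using finN Z fin finite_subset[OF Z(1) fin] finT
              by (intro card_mono) (auto simp: U_def W_def nbhd_def)
            moreover have "card (Z \<union> (?N \<inter> U) \<union> (\<Union>x\<in>T. ?N \<inter> set x))
                \<le> card Z + card (?N \<inter> U) + card (\<Union>x\<in>T. ?N \<inter> set x)"
              using card_Un_le[of "Z \<union> (?N \<inter> U)" "\<Union>x\<in>T. ?N \<inter> set x"] card_Un_le[of Z "?N \<inter> U"] by linarith
            moreover have "card (\<Union>x\<in>T. ?N \<inter> set x) \<le> (\<Sum>x\<in>T. card (?N \<inter> set x))"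
              by (rule card_UN_le[OF finT])
            moreover have "real (card (?N \<inter> U)) < \<gamma> / 4 * ?n" using A by (auto simp: \<A>_def \<B>_def)
            ultimately have "(1/2 + \<gamma>) * ?n \<le> \<gamma> / 2 * ?n + \<gamma> / 4 * ?n + real (\<Sum>x\<in>T. card (?N \<inter> set x))"
              using Z(2) by linarith
            then have "(1/2 + \<gamma>/4) * ?n \<le> real (\<Sum>x\<in>T. card (?N \<inter> set x))" by (simp add: algebra_simps)
            then show "(1/2 + \<gamma>/4) * ?n \<le> (\<Sum>x\<in>T. real (card (?N \<inter> set x)))" by simp
          qed
        qed
        then obtain x y where xy: "x \<in> T" "y \<in> T"
          "(\<rho> ^ 2 / 2 * ?n ^ 2) / ?n ^ 2 * real (card \<B>) \<le> real (card {A \<in> \<B>. ?R A (x, y)})" by blast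
        define \<C> where "\<C> = {A \<in> \<B>. ?R A (x, y)}"
        have eq: "(\<rho> ^ 2 / 2 * ?n ^ 2) / ?n ^ 2 = \<rho> ^ 2 / 2" using n0 by simp
        have c\<C>: "\<rho> ^ 2 / 2 * real (card \<B>) \<le> real (card \<C>)" using xy(3) unfolding eq \<C>_def .
        have "0 < \<rho> ^ 2 / 2 * real (card \<B>)" using \<kappa> c\<B> p0 by simp
        then have ne\<C>: "\<C> \<noteq> {}" using c\<C> by auto
        have fin\<C>: "finite \<C>" using fin\<B> by (simp add: \<C>_def)
        have xy_ne: "x \<noteq> y" using ne\<C> by (auto simp: \<C>_def tile_pair_def)
        have dis: "set x \<inter> set y = {}" and lx: "length x = L" "length y = L" "set x \<subseteq> W" "set y \<subseteq> W"
          using T xy(1,2) xy_ne unfolding tiling_def by auto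
        let ?XY = "set x \<union> set y"
        let ?R2 = "\<lambda>A D. distinct D \<and> set D \<subseteq> nbhd V E A \<and> alternating \<phi> A D"
        \<comment> \<open>For the fixed pair of tiles the list \<open>D\<close> still depends on
          \<open>A\<close>, but only boundedly many lists exist, so a second averaging makes it
          uniform.\<close>
        have "\<exists>D\<in>tuples ?XY L. 1 / real (2 * L) ^ L * real (card \<C>) \<le> real (card {A \<in> \<C>. ?R2 A D})"
        proof (rule popular_one[OF fin\<C> finite_tuples ne\<C>])
          have "card ?XY \<le> 2 * L" using card_Un_le[of "set x" "set y"] card_length[of x] card_length[of y] lx by linarith
          then have "card ?XY ^ L \<le> (2 * L) ^ L" by (rule power_mono) simp
          then show "real (card (tuples ?XY L)) \<le> real (2 * L) ^ L"
            by (simp only: card_tuples finite_Un finite_set simp_thms of_nat_power[symmetric] of_nat_le_iff)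
          fix A assume A: "A \<in> \<C>"
          then have "\<exists>D\<in>tuples ?XY (2 * h). ?R2 A D"
            using fin by (intro tile_pair_alternating[OF _ dis _ h]) (auto simp: \<C>_def nbhd_def)
          then have "{D \<in> tuples ?XY L. ?R2 A D} \<noteq> {}" by (auto simp: L_def)
          moreover have "finite {D \<in> tuples ?XY L. ?R2 A D}" using finite_tuples[of ?XY] by simp
          ultimately have "0 < card {D \<in> tuples ?XY L. ?R2 A D}" by (simp only: card_gt_0_iff simp_thms)
          then show "1 \<le> real (card {D \<in> tuples ?XY L. ?R2 A D})" by linarith
        qed auto
        then obtain D where D: "D \<in> tuples ?XY L"
          "1 / real (2 * L) ^ L * real (card \<C>) \<le> real (card {A \<in> \<C>. ?R2 A D})" by blast
        define F where "F = {A \<in> \<C>. ?R2 A D}"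
        have "1 / real (2 * L) ^ L * (\<rho> ^ 2 / 2 * real (card \<B>)) \<le> 1 / real (2 * L) ^ L * real (card \<C>)"
          using c\<C> by (rule mult_left_mono) simp
        then have "\<kappa>2 * real (card \<B>) \<le> real (card F)" using D(2) by (simp add: F_def \<kappa>2_def)
        moreover have "\<epsilon> * ?n ^ (k - 1) \<le> \<kappa>2 * (\<sigma> / 2 * ?n ^ (k - 1))"
          using \<sigma>0 by (simp add: \<epsilon>_def mult.assoc[symmetric] mult_right_mono)
        moreover have "\<kappa>2 * (\<sigma> / 2 * ?n ^ (k - 1)) \<le> \<kappa>2 * real (card \<B>)"
          using c\<B> \<kappa> by (intro mult_left_mono) auto
        ultimately have cF: "\<epsilon> * ?n ^ (k - 1) \<le> real (card F)" by linarith
        have "0 < \<epsilon> * ?n ^ (k - 1)" using \<epsilon>0 n0 by simp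
        then have "F \<noteq> {}" using cF by auto
        then have dD: "distinct D" by (auto simp: F_def)
        have DU: "set D \<subseteq> ?XY" "length D = L" using D(1) by (auto simp: tuples_def)
        have "\<exists>w. length w = k * L \<and> distinct w \<and> set w \<subseteq> U \<union> set D \<and> good_walk k E \<phi> w"
        proof (rule path[rule_format, OF S1 UV _ cF _ dD])
          show "F \<subseteq> {S. S \<subseteq> U \<and> card S = k - 1}" by (auto simp: F_def \<C>_def \<B>_def \<S>_def)
          show "D \<in> tuples V L" using DU lx WV by (auto simp: tuples_def)
        qed (use DU in \<open>auto simp: F_def alternating_def\<close>)
        then obtain w where w: "length w = k * L" "distinct w" "set w \<subseteq> U \<union> set D" "good_walk k E \<phi> w" by blast
        have "card {x, y} < 3" using xy_ne by simp
        then show False using no_exchange[of "{x, y}" w] xy(1,2) w DU by blast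
      qed
    qed
    then show ?thesis using T unfolding U_def W_def by blast
  qed
  then show ?thesis using \<eta>0 unfolding L_def by blast
qed

section \<open>The absorbing path\<close>

text \<open>With \<open>\<eta> = c ^ 2 / 4\<close>, \<open>sqrt n\<close> is at least
  \<open>2 / c\<close>, so \<open>ln n = 2 * ln (sqrt n) \<le> 2 * sqrt n \<le> c * n\<close>. It
  lets the logarithmic loss of the selection be absorbed by decreasing
  \<open>\<eta>\<close>.\<close>

lemma ln_le_small_linear:
  fixes c :: real
  assumes "0 < c"
  shows "\<exists>\<eta>>0. \<forall>n::nat. 1 \<le> \<eta> * real n \<longrightarrow> ln (real n) \<le> c * real n"
proof (intro exI conjI allI impI)
  show "0 < c ^ 2 / 4" using assms by simp
  fix n :: nat assume n: "1 \<le> c ^ 2 / 4 * real n"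
  have n0: "0 < real n" using n by (cases "n = 0") auto
  have "1 \<le> sqrt (c ^ 2 / 4 * real n)" using n by simp
  also have "\<dots> = c / 2 * sqrt (real n)"
    using assms by (simp add: real_sqrt_mult real_sqrt_divide)
  finally have s: "2 \<le> c * sqrt (real n)" by simp
  have "ln (real n) = 2 * ln (sqrt (real n))" using n0 by (simp add: ln_sqrt)
  also have "\<dots> \<le> 2 * sqrt (real n)" using ln_le_minus_one[of "sqrt (real n)"] n0 by simp
  also have "\<dots> \<le> c * sqrt (real n) * sqrt (real n)" using s by (intro mult_right_mono) auto
  also have "\<dots> = c * real n" by simp
  finally show "ln (real n) \<le> c * real n" .
qed

text \<open>The easy case of Hall's theorem: every set of candidates is at least as large as all of
  \<open>W\<close>, so choosing one after another never gets stuck.\<close>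

lemma greedy_injection:
  assumes "finite W" "\<And>v. v \<in> W \<Longrightarrow> finite (C v)" "\<And>v. v \<in> W \<Longrightarrow> card W \<le> card (C v)"
  shows "\<exists>g. inj_on g W \<and> (\<forall>v\<in>W. g v \<in> C v)"
  using assms
proof (induction W rule: finite_induct)
  case empty
  then show ?case by simp
next
  case (insert v W)
  have "\<exists>g. inj_on g W \<and> (\<forall>v\<in>W. g v \<in> C v)"
  proof (rule insert.IH)
    fix u assume u: "u \<in> W"
    show "finite (C u)" using insert.prems(1) u by simp
    have "card (insert v W) \<le> card (C u)" using insert.prems(2) u by simp
    then show "card W \<le> card (C u)" using insert.hyps by simp
  qed
  then obtain g where g: "inj_on g W" "\<forall>u\<in>W. g u \<in> C u" by blast
  have "card (g ` W) \<le> card W" by (rule card_image_le[OF insert.hyps(1)])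
  also have "\<dots> < card (C v)" using insert.prems(2)[of v] insert.hyps by simp
  finally have "\<not> C v \<subseteq> g ` W" using card_mono[of "g ` W" "C v"] insert.hyps(1) by auto
  then obtain c where c: "c \<in> C v" "c \<notin> g ` W" by blast
  have "inj_on (g(v := c)) (insert v W)" using g(1) c(2) insert.hyps(2) by (auto simp: inj_on_def)
  moreover have "\<forall>u\<in>insert v W. (g(v := c)) u \<in> C u" using g(2) c(1) by auto
  ultimately show ?case by blast
qed

text \<open>\<open>B f\<close> is the path in which every absorber \<open>x \<in> X\<close> has \<open>f x\<close> inserted in its middle.\<close>

definition insertion_scheme ::
  "nat \<Rightarrow> 'a set set \<Rightarrow> ('a set \<Rightarrow> nat) \<Rightarrow> nat \<Rightarrow> 'a list set \<Rightarrow> (('a list \<Rightarrow> 'a list) \<Rightarrow> 'a list) \<Rightarrow> bool" where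
  "insertion_scheme k E \<phi> h X B \<longleftrightarrow>
     (\<forall>f. (\<forall>x\<in>X. f x = [] \<or> (\<exists>v. f x = [v] \<and> absorber k E \<phi> v x)) \<longrightarrow>
        good_walk k E \<phi> (B f) \<and> set (B f) = set (B (\<lambda>_. [])) \<union> (\<Union>x\<in>X. set (f x)) \<and>
        length (B f) = length (B (\<lambda>_. [])) + (\<Sum>x\<in>X. length (f x)) \<and>
        take h (B f) = take h (B (\<lambda>_. [])) \<and> lastn h (B f) = lastn h (B (\<lambda>_. [])))"

text \<open>Absorbers are appended one by one, each through a connector. Insertions leave the first
  and last \<open>h\<close> entries of an absorber unchanged, so the same connectors fit for every
  \<open>f\<close>.\<close>

lemma absorber_chain:
  assumes k: "2 \<le> k" and h: "h = 2 * k - 2" and fin: "finite F"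
    and F: "\<And>x. x \<in> F \<Longrightarrow> length x = 2 * h \<and> distinct x \<and> set x \<subseteq> V \<and> good_walk k E \<phi> x"
    and dis: "\<And>x y. x \<in> F \<Longrightarrow> y \<in> F \<Longrightarrow> x \<noteq> y \<Longrightarrow> set x \<inter> set y = {}"
    and small: "real (2 * card F * (2 * h + m)) \<le> t"
    and conn: "\<And>Z a b. finite Z \<Longrightarrow> real (card Z) \<le> t \<Longrightarrow> a \<in> tuples V h \<Longrightarrow> b \<in> tuples V h \<Longrightarrow>
       distinct (a @ b) \<Longrightarrow> good_walk k E \<phi> a \<Longrightarrow> good_walk k E \<phi> b \<Longrightarrow>
       \<exists>y\<in>tuples V m. connector k E \<phi> a b y \<and> set y \<inter> Z = {}"
    and Xs: "Xs \<noteq> []" "distinct Xs" "set Xs \<subseteq> F"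
  shows "\<exists>B. distinct (B (\<lambda>_. [])) \<and> set (B (\<lambda>_. [])) \<subseteq> V \<and> 2 * h \<le> length (B (\<lambda>_. [])) \<and>
      length (B (\<lambda>_. [])) \<le> length Xs * (2 * h + m) \<and>
      set (B (\<lambda>_. [])) \<inter> (\<Union>x\<in>F - set Xs. set x) = {} \<and>
      insertion_scheme k E \<phi> h (set Xs) B"
  using Xs
proof (induction Xs rule: rev_nonempty_induct)
  case (single x)
  then have x: "length x = 2 * h" "distinct x" "set x \<subseteq> V" "good_walk k E \<phi> x" and xF: "x \<in> F" using F by auto
  define B where "B f = take h x @ f x @ drop h x" for f :: "'a list \<Rightarrow> 'a list"
  have B0: "B (\<lambda>_. []) = x" by (simp add: B_def)
  have "good_walk k E \<phi> (B f) \<and> set (B f) = set x \<union> set (f x) \<and> length (B f) = length x + length (f x) \<and>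
      take h (B f) = take h x \<and> lastn h (B f) = lastn h x"
    if f: "f x = [] \<or> (\<exists>v. f x = [v] \<and> absorber k E \<phi> v x)" for f
  proof (intro conjI)
    show "good_walk k E \<phi> (B f)" using f x(4) by (auto simp: B_def absorber_def h)
    have "set x = set (take h x) \<union> set (drop h x)" by (metis append_take_drop_id set_append)
    then show "set (B f) = set x \<union> set (f x)" by (auto simp: B_def)
    show "length (B f) = length x + length (f x)" using x(1) by (simp add: B_def)
    show "take h (B f) = take h x" using x(1) by (simp add: B_def)
    have "lastn h ((take h x @ f x) @ drop h x) = drop h x" by (rule lastn_append) (use x(1) in simp)
    moreover have "lastn h (take h x @ drop h x) = drop h x" by (rule lastn_append) (use x(1) in simp)
    ultimately show "lastn h (B f) = lastn h x" by (simp add: B_def)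
  qed
  moreover have "set x \<inter> (\<Union>y\<in>F - {x}. set y) = {}" using dis xF by blast
  ultimately show ?case using x by (intro exI[of _ B]) (auto simp: B0 insertion_scheme_def)
next
  case (snoc x Xs)
  let ?e = "\<lambda>_::'a list. [] :: 'a list"
  have Xs: "distinct Xs" "set Xs \<subseteq> F" "x \<in> F" "x \<notin> set Xs" using snoc.prems by auto
  obtain B where B: "distinct (B ?e)" "set (B ?e) \<subseteq> V" "2 * h \<le> length (B ?e)"
      "length (B ?e) \<le> length Xs * (2 * h + m)"
      "set (B ?e) \<inter> (\<Union>x\<in>F - set Xs. set x) = {}"
    and "insertion_scheme k E \<phi> h (set Xs) B"
    using snoc.IH[OF Xs(1,2)] by (elim exE conjE) (rule that)
  note Bf = this(6)[unfolded insertion_scheme_def, rule_format]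
  have x: "length x = 2 * h" "distinct x" "set x \<subseteq> V" "good_walk k E \<phi> x" using F Xs(3) by auto
  define l r where "l = take h x" and "r = drop h x"
  have lr: "x = l @ r" "length l = h" "length r = h" using x(1) by (auto simp: l_def r_def)
  define c where "c = lastn h (B ?e)"
  have lc: "length c = h" "set c \<subseteq> set (B ?e)"
    using B(3) set_lastn_subset[of h "B ?e"] by (auto simp: c_def length_lastn)
  have xB: "set x \<inter> set (B ?e) = {}" using B(5) Xs by auto
  have dc: "distinct c" using B(1) by (simp add: c_def lastn_def)
  have gB: "good_walk k E \<phi> (B ?e)" using Bf[of ?e] by simp
  have Bc: "B ?e = take (length (B ?e) - h) (B ?e) @ c" unfolding c_def by (rule split_lastn)
  have gc: "good_walk k E \<phi> c" using good_walk_suffix gB Bc by metis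
  have gl: "good_walk k E \<phi> l" using good_walk_prefix x(4) lr(1) by metis
  \<comment> \<open>All absorbers are avoided, including those not yet appended, so that the path
    stays disjoint from the ones still to come.\<close>
  define Z where "Z = set (B ?e) \<union> (\<Union>x\<in>F. set x)"
  have finZ: "finite Z" using fin by (simp add: Z_def)
  have "card (\<Union>x\<in>F. set x) \<le> (\<Sum>x\<in>F. card (set x))" by (rule card_UN_le[OF fin])
  also have "\<dots> \<le> (\<Sum>x\<in>F. 2 * h)"
  proof (rule sum_mono)
    fix x assume "x \<in> F"
    then show "card (set x) \<le> 2 * h" using F card_length[of x] by force
  qed
  finally have u: "card (\<Union>x\<in>F. set x) \<le> card F * (2 * h)" by simp
  have "card (set Xs) \<le> card F" by (rule card_mono[OF fin Xs(2)])
  then have "length Xs \<le> card F" using distinct_card[OF Xs(1)] by simp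
  then have "length Xs * (2 * h + m) \<le> card F * (2 * h + m)" by (rule mult_le_mono1)
  then have "card (set (B ?e)) \<le> card F * (2 * h + m)" using card_length[of "B ?e"] B(4) by linarith
  moreover have "card Z \<le> card (set (B ?e)) + card (\<Union>x\<in>F. set x)" unfolding Z_def by (rule card_Un_le)
  moreover have "card F * (2 * h) \<le> card F * (2 * h + m)" by simp
  ultimately have "card Z \<le> 2 * card F * (2 * h + m)" using u by linarith
  then have cZ: "real (card Z) \<le> t" using small by linarith
  have "\<exists>y\<in>tuples V m. connector k E \<phi> c l y \<and> set y \<inter> Z = {}"
  proof (rule conn[OF finZ cZ _ _ _ gc gl])
    show "c \<in> tuples V h" using lc B(2) by (auto simp: tuples_def)
    show "l \<in> tuples V h" using lr x(3) by (auto simp: tuples_def)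
    show "distinct (c @ l)" using dc x(2) lr lc xB by auto
  qed
  then obtain y where y: "length y = m" "set y \<subseteq> V" "connector k E \<phi> c l y" "set y \<inter> Z = {}"
    by (auto simp: tuples_def)
  have dy: "distinct y" and gy: "good_walk k E \<phi> (c @ y @ l)" using y(3) by (auto simp: connector_def)
  define B' where "B' f = B f @ y @ (l @ f x @ r)" for f
  have B'e: "B' ?e = B ?e @ y @ x" using lr by (simp add: B'_def)
  have main: "good_walk k E \<phi> (B' f) \<and> set (B' f) = set (B' ?e) \<union> (\<Union>x\<in>set (Xs @ [x]). set (f x)) \<and>
         length (B' f) = length (B' ?e) + (\<Sum>x\<in>set (Xs @ [x]). length (f x)) \<and>
         take h (B' f) = take h (B' ?e) \<and> lastn h (B' f) = lastn h (B' ?e)"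
    if f: "\<forall>x\<in>set (Xs @ [x]). f x = [] \<or> (\<exists>v. f x = [v] \<and> absorber k E \<phi> v x)" for f
  proof (intro conjI)
    have b: "good_walk k E \<phi> (B f)" "set (B f) = set (B ?e) \<union> (\<Union>x\<in>set Xs. set (f x))"
       "length (B f) = length (B ?e) + (\<Sum>x\<in>set Xs. length (f x))"
       "take h (B f) = take h (B ?e)" "lastn h (B f) = c"
      using Bf[of f] f by (auto simp: c_def)
    have fx: "f x = [] \<or> (\<exists>v. f x = [v] \<and> absorber k E \<phi> v x)" using f by simp
    have t: "take (2 * k - 2) x = l" "drop (2 * k - 2) x = r" by (simp_all add: l_def r_def h)
    from fx have gx: "good_walk k E \<phi> (l @ f x @ r)"
    proof (elim disjE exE conjE)
      assume "f x = []"
      then show ?thesis using x(4)[unfolded lr(1)] by simp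
    next
      fix v assume "f x = [v]" "absorber k E \<phi> v x"
      then show ?thesis unfolding absorber_def t by simp
    qed
    define p where "p = take (length (B f) - h) (B f)"
    have pc: "B f = p @ c" using split_lastn[of "B f" h] b(5) by (simp add: p_def)
    \<comment> \<open>Both gluings happen along the lists \<open>c\<close> and \<open>l\<close> of
      length \<open>h\<close>, neither of which depends on \<open>f\<close>.\<close>
    have "good_walk k E \<phi> (p @ c @ (y @ l))"
      by (rule good_walk_glue[OF b(1)[unfolded pc] gy _ k]) (use lc h in simp)
    then have "good_walk k E \<phi> ((p @ c @ y) @ l)" by simp
    then have "good_walk k E \<phi> ((p @ c @ y) @ l @ (f x @ r))"
      by (rule good_walk_glue[OF _ gx _ k]) (use lr(2) h in simp)
    then show "good_walk k E \<phi> (B' f)" by (simp add: B'_def pc)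
    show "set (B' f) = set (B' ?e) \<union> (\<Union>x\<in>set (Xs @ [x]). set (f x))"
      using b(2) by (auto simp: B'_def)
    show "length (B' f) = length (B' ?e) + (\<Sum>x\<in>set (Xs @ [x]). length (f x))"
      using b(3) Xs(4) by (simp add: B'_def)
    show "take h (B' f) = take h (B' ?e)" using b(3,4) B(3) by (simp add: B'_def)
    have "lastn h (z @ r) = r" for z by (rule lastn_append) (rule lr)
    from this[of "B f @ y @ l @ f x"] this[of "B ?e @ y @ l"]
    show "lastn h (B' f) = lastn h (B' ?e)" by (simp add: B'_def)
  qed
  show ?case
  proof (rule exI[of _ B'], intro conjI)
    show "distinct (B' ?e)" unfolding B'e using B(1) dy x(2) y(4) xB Xs(3) by (auto simp: Z_def)
    show "set (B' ?e) \<subseteq> V" unfolding B'e using B(2) y(2) x(3) by auto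
    show "2 * h \<le> length (B' ?e)" unfolding B'e using B(3) by simp
    show "length (B' ?e) \<le> length (Xs @ [x]) * (2 * h + m)" unfolding B'e using B(4) y(1) x(1) by simp
    show "set (B' ?e) \<inter> (\<Union>z\<in>F - set (Xs @ [x]). set z) = {}"
    proof -
      have "set x \<inter> set z = {}" if "z \<in> F - set (Xs @ [x])" for z using dis[of x z] Xs(3) that by auto
      moreover have "set y \<inter> set z = {}" if "z \<in> F" for z using y(4) that by (auto simp: Z_def)
      moreover have "set (B ?e) \<inter> set z = {}" if "z \<in> F - set (Xs @ [x])" for z using B(5) that by auto
      ultimately show ?thesis unfolding B'e by (simp add: Int_Un_distrib2) blast
    qed
    show "insertion_scheme k E \<phi> h (set (Xs @ [x])) B'" unfolding insertion_scheme_def using main by blast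
  qed
qed

lemma absorbing_path:
  fixes \<mu> :: real
  assumes k: "2 \<le> k" and \<gamma>: "0 < \<gamma>" and \<mu>: "0 < \<mu>" and h: "h = 2 * k - 2"
  shows "\<exists>\<zeta> \<eta>. 0 < \<zeta> \<and> 0 < \<eta> \<and> (\<forall>(V :: 'a set) E \<phi>. setting k \<gamma> \<eta> V E \<phi> \<longrightarrow>
     (\<exists>A. distinct A \<and> set A \<subseteq> V \<and> good_walk k E \<phi> A \<and> 2 * h \<le> length A \<and>
        real (length A) \<le> \<mu> * real (card V) \<and>
        (\<forall>W. W \<subseteq> V - set A \<longrightarrow> real (card W) \<le> \<zeta> * real (card V) \<longrightarrow>
           (\<exists>A'. distinct A' \<and> set A' = set A \<union> W \<and> good_walk k E \<phi> A' \<and>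
              take h A' = take h A \<and> lastn h A' = lastn h A))))"
proof -
  obtain m \<beta>c \<eta>c where mk: "k \<le> m" and \<beta>c: "0 < \<beta>c" and \<eta>c: "0 < \<eta>c"
    and conn: "\<forall>(V :: 'a set) E \<phi> (Z :: 'a set) a b.
     setting k \<gamma> \<eta>c V E \<phi> \<longrightarrow> finite Z \<longrightarrow> real (card Z) \<le> \<eta>c * real (card V) \<longrightarrow>
     a \<in> tuples V (2 * k - 2) \<longrightarrow> b \<in> tuples V (2 * k - 2) \<longrightarrow> distinct (a @ b) \<longrightarrow>
     good_walk k E \<phi> a \<longrightarrow> good_walk k E \<phi> b \<longrightarrow>
     \<beta>c * real (card V) ^ m \<le> real (card {y \<in> tuples V m. connector k E \<phi> a b y \<and> set y \<inter> Z = {}})"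
    using many_connectors[OF k \<gamma>] by (elim exE conjE) (rule that)
  define M where "M = 2 * h"
  have M1: "1 \<le> M" using k by (simp add: M_def h)
  obtain \<beta> \<eta>a where \<beta>: "0 < \<beta>" and \<eta>a: "0 < \<eta>a"
    and abs: "\<forall>(V :: 'a set) E \<phi> v. setting k \<gamma> \<eta>a V E \<phi> \<longrightarrow> v \<in> V \<longrightarrow>
     \<beta> * real (card V) ^ (2 * (2 * k - 2)) \<le> real (card {x \<in> tuples V (2 * (2 * k - 2)). absorber k E \<phi> v x})"
    using many_absorbers[OF k \<gamma>] by (elim exE conjE) (rule that)
  \<comment> \<open>The terms bound the length of the path, the sets that connectors have to avoid,
    and the vertices consumed by the selection. The divisor in \<open>\<kappa>\<close> makes
    \<open>\<kappa> * card V\<close> absorbers with their connectors respect all three.\<close>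
  define \<kappa>0 where "\<kappa>0 = min (min \<mu> \<eta>c) (\<beta> / (2 * real M))"
  have \<kappa>00: "0 < \<kappa>0" using \<mu> \<eta>c \<beta> M1 by (simp add: \<kappa>0_def)
  define \<kappa> where "\<kappa> = \<kappa>0 / (2 * real (M + m))"
  have \<kappa>: "0 < \<kappa>" using \<kappa>00 M1 by (simp add: \<kappa>_def)
  obtain \<eta>l where \<eta>l: "0 < \<eta>l" "\<forall>n::nat. 1 \<le> \<eta>l * real n \<longrightarrow> ln (real n) \<le> \<beta> * \<kappa> / 16 * real n"
    using ln_le_small_linear[of "\<beta> * \<kappa> / 16"] \<beta> \<kappa> by auto
  \<comment> \<open>\<open>\<kappa> / 2\<close> ensures \<open>2 \<le> \<kappa> * card V\<close>, so
    rounding down in \<open>s\<close> loses at most half.\<close>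
  define \<eta> where "\<eta> = min (min \<eta>c \<eta>a) (min (\<kappa> / 2) \<eta>l)"
  have \<eta>0: "0 < \<eta>" using \<eta>c \<eta>a \<kappa> \<eta>l by (simp add: \<eta>_def)
  \<comment> \<open>The selection contains at least \<open>\<beta> * s / 4 - ln (card V)\<close>
    absorbers of each vertex; here \<open>\<beta> * s / 4\<close> is at least
    \<open>2 * \<zeta> * card V\<close> and the logarithm at most
    \<open>\<zeta> * card V\<close>.\<close>
  define \<zeta> where "\<zeta> = \<beta> * \<kappa> / 16"
  have \<zeta>0: "0 < \<zeta>" using \<beta> \<kappa> by (simp add: \<zeta>_def)
  have "\<exists>A. distinct A \<and> set A \<subseteq> V \<and> good_walk k E \<phi> A \<and> 2 * h \<le> length A \<and>
        real (length A) \<le> \<mu> * real (card V) \<and>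
        (\<forall>W. W \<subseteq> V - set A \<longrightarrow> real (card W) \<le> \<zeta> * real (card V) \<longrightarrow>
           (\<exists>A'. distinct A' \<and> set A' = set A \<union> W \<and> good_walk k E \<phi> A' \<and>
              take h A' = take h A \<and> lastn h A' = lastn h A))"
    if S: "setting k \<gamma> \<eta> V E \<phi>" for V :: "'a set" and E \<phi>
  proof -
    let ?n = "real (card V)"
    have fin: "finite V" using S by (rule setting_finite)
    have n1: "1 \<le> \<eta> * ?n" using S by (simp add: setting_def)
    have n0: "0 < ?n" using n1 \<eta>0 by (cases "?n = 0") auto
    then have V0: "V \<noteq> {}" by auto
    have Sc: "setting k \<gamma> \<eta>c V E \<phi>" and Sa: "setting k \<gamma> \<eta>a V E \<phi>"
      using S by (auto elim!: setting_mono simp: \<eta>_def)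
    have le: "1 \<le> c * ?n" if "\<eta> \<le> c" for c
      using n1 mult_right_mono[OF that, of ?n] by simp
    have \<kappa>n: "2 \<le> \<kappa> * ?n" using le[of "\<kappa> / 2"] by (simp add: \<eta>_def)
    have lnn: "ln ?n \<le> \<zeta> * ?n" using \<eta>l(2) le[of \<eta>l] by (simp add: \<eta>_def \<zeta>_def)
    define s where "s = nat \<lfloor>\<kappa> * ?n\<rfloor>"
    have s: "real s \<le> \<kappa> * ?n" "\<kappa> * ?n < real s + 1" using \<kappa>n by (auto simp: s_def)
    have s2: "\<kappa> * ?n / 2 \<le> real s" using s(2) \<kappa>n by linarith
    have s1: "1 \<le> s" using s(2) \<kappa>n by linarith
    have "real s * (2 * real (M + m)) \<le> \<kappa> * ?n * (2 * real (M + m))" using s(1) by (rule mult_right_mono) simp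
    also have "\<dots> = \<kappa>0 * ?n" using M1 by (simp add: \<kappa>_def field_simps)
    finally have sb: "real s * (2 * real (M + m)) \<le> \<kappa>0 * ?n" .
    define G where "G v = {x \<in> tuples V M. absorber k E \<phi> v x}" for v
    have sM: "real s * real M \<le> \<beta> / (2 * real M) * ?n"
    proof -
      have "real s * real M \<le> real s * (2 * real (M + m))" by (intro mult_left_mono) auto
      also have "\<dots> \<le> \<kappa>0 * ?n" by (rule sb)
      also have "\<dots> \<le> \<beta> / (2 * real M) * ?n" by (intro mult_right_mono) (auto simp: \<kappa>0_def)
      finally show ?thesis .
    qed
    obtain F where F: "finite F" "card F = s" "F \<subseteq> (\<Union>v\<in>V. G v)"
      "\<And>x y. x \<in> F \<Longrightarrow> y \<in> F \<Longrightarrow> x \<noteq> y \<Longrightarrow> set x \<inter> set y = {}"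
      "\<And>v. v \<in> V \<Longrightarrow> \<beta> * real s / 4 - ln ?n \<le> real (card (F \<inter> G v))"
    proof (rule disjoint_selection[of V V \<beta> M G "\<beta> / (2 * real M)" s])
      fix v assume "v \<in> V"
      then show "\<beta> * ?n ^ M \<le> real (card (G v))" using abs Sa by (simp add: G_def M_def h)
    qed (use fin V0 \<beta> M1 sM in \<open>auto simp: G_def\<close>)
    have cnt: "\<zeta> * ?n \<le> real (card (F \<inter> G v))" if "v \<in> V" for v
    proof -
      have "\<beta> * (\<kappa> * ?n / 2) / 4 \<le> \<beta> * real s / 4" using s2 \<beta> by (intro divide_right_mono mult_left_mono) auto
      moreover have "\<beta> * (\<kappa> * ?n / 2) / 4 = 2 * (\<zeta> * ?n)" by (simp add: \<zeta>_def)
      ultimately show ?thesis using F(5)[OF that] lnn by linarith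
    qed
    obtain Xs where Xs: "set Xs = F" "distinct Xs" using finite_distinct_list[OF F(1)] by blast
    have lXs: "length Xs = s" using distinct_card[OF Xs(2)] Xs(1) F(2) by simp
    then have Xs0: "Xs \<noteq> []" using s1 by auto
    have Fp: "length x = 2 * h \<and> distinct x \<and> set x \<subseteq> V \<and> good_walk k E \<phi> x" if "x \<in> F" for x
      using that F(3) by (auto simp: G_def tuples_def absorber_def M_def)
    let ?e = "\<lambda>_::'a list. [] :: 'a list"
    have "\<exists>B. distinct (B ?e) \<and> set (B ?e) \<subseteq> V \<and> 2 * h \<le> length (B ?e) \<and>
      length (B ?e) \<le> length Xs * (2 * h + m) \<and>
      set (B ?e) \<inter> (\<Union>x\<in>F - set Xs. set x) = {} \<and>
      insertion_scheme k E \<phi> h (set Xs) B"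
    proof (rule absorber_chain[OF k h F(1) Fp F(4), where t = "\<eta>c * ?n"])
      have "real (2 * card F * (2 * h + m)) = real s * (2 * real (M + m))" by (simp add: F(2) M_def)
      also have "\<dots> \<le> \<kappa>0 * ?n" by (rule sb)
      also have "\<dots> \<le> \<eta>c * ?n" by (intro mult_right_mono) (auto simp: \<kappa>0_def)
      finally show "real (2 * card F * (2 * h + m)) \<le> \<eta>c * ?n" .
      fix Z :: "'a set" and a b
      assume "finite Z" "real (card Z) \<le> \<eta>c * ?n" "a \<in> tuples V h" "b \<in> tuples V h"
        "distinct (a @ b)" "good_walk k E \<phi> a" "good_walk k E \<phi> b"
      then have "\<beta>c * ?n ^ m \<le> real (card {y \<in> tuples V m. connector k E \<phi> a b y \<and> set y \<inter> Z = {}})"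
        using conn Sc unfolding h by blast
      moreover have "0 < \<beta>c * ?n ^ m" using \<beta>c n0 by simp
      ultimately have "0 < real (card {y \<in> tuples V m. connector k E \<phi> a b y \<and> set y \<inter> Z = {}})" by linarith
      then have "{y \<in> tuples V m. connector k E \<phi> a b y \<and> set y \<inter> Z = {}} \<noteq> {}"
        by (metis card.empty of_nat_0 less_irrefl)
      then show "\<exists>y\<in>tuples V m. connector k E \<phi> a b y \<and> set y \<inter> Z = {}" by blast
    qed (use Xs Xs0 in auto)
    then obtain B where B: "distinct (B ?e)" "set (B ?e) \<subseteq> V" "2 * h \<le> length (B ?e)"
        "length (B ?e) \<le> length Xs * (2 * h + m)"
      and Bs: "insertion_scheme k E \<phi> h F B"
      unfolding Xs(1) by (elim exE conjE) (rule that)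
    note Bf = Bs[unfolded insertion_scheme_def, rule_format]
    have gB: "good_walk k E \<phi> (B ?e)" using Bf[of ?e] by simp
    have "real (length (B ?e)) \<le> real (s * (M + m))"
      using B(4) lXs by (simp only: M_def of_nat_le_iff)
    also have "\<dots> \<le> real s * (2 * real (M + m))" unfolding of_nat_mult by (intro mult_left_mono) auto
    also have "\<dots> \<le> \<kappa>0 * ?n" by (rule sb)
    also have "\<dots> \<le> \<mu> * ?n" by (intro mult_right_mono) (auto simp: \<kappa>0_def)
    finally have len: "real (length (B ?e)) \<le> \<mu> * ?n" .
    have "\<exists>A'. distinct A' \<and> set A' = set (B ?e) \<union> W \<and> good_walk k E \<phi> A' \<and>
              take h A' = take h (B ?e) \<and> lastn h A' = lastn h (B ?e)"
      if W: "W \<subseteq> V - set (B ?e)" "real (card W) \<le> \<zeta> * ?n" for W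
    proof -
      have finW: "finite W" by (rule finite_subset[OF W(1)]) (use fin in simp)
      \<comment> \<open>Each leftover vertex gets an absorber of its own, since \<open>W\<close> is
        no larger than the number of absorbers chosen for each of its vertices.\<close>
      have "\<exists>g. inj_on g W \<and> (\<forall>v\<in>W. g v \<in> F \<inter> G v)"
      proof (rule greedy_injection[OF finW])
        fix v assume "v \<in> W"
        then have "v \<in> V" using W by auto
        then have "real (card W) \<le> real (card (F \<inter> G v))" using cnt W(2) by force
        then show "card W \<le> card (F \<inter> G v)" by simp
      qed (use F(1) in simp)
      then obtain g where g: "inj_on g W" "\<And>v. v \<in> W \<Longrightarrow> g v \<in> F \<and> g v \<in> G v" by blast
      define f where "f x = (if x \<in> g ` W then [inv_into W g x] else [])" for x
      have fg: "f (g v) = [v]" if "v \<in> W" for v using that g(1) by (simp add: f_def)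
      have f_ok: "\<forall>x\<in>F. f x = [] \<or> (\<exists>v. f x = [v] \<and> absorber k E \<phi> v x)"
      proof
        fix x assume "x \<in> F"
        show "f x = [] \<or> (\<exists>v. f x = [v] \<and> absorber k E \<phi> v x)"
        proof (cases "x \<in> g ` W")
          case True
          then obtain v where "v \<in> W" "x = g v" by auto
          then have "f x = [v]" "absorber k E \<phi> v x" using fg g(2) by (auto simp: G_def)
          then show ?thesis by blast
        qed (simp add: f_def)
      qed
      have gF: "g ` W \<subseteq> F" using g(2) by auto
      have uW: "(\<Union>x\<in>F. set (f x)) = W"
      proof
        show "(\<Union>x\<in>F. set (f x)) \<subseteq> W" by (auto simp: f_def inv_into_into split: if_splits)
        show "W \<subseteq> (\<Union>x\<in>F. set (f x))" using fg g(2) by force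
      qed
      have "(\<Sum>x\<in>F. length (f x)) = (\<Sum>x\<in>g ` W. 1)"
        using F(1) gF by (intro sum.mono_neutral_cong_right) (auto simp: f_def)
      also have "\<dots> = card W" using card_image[OF g(1)] by simp
      finally have sW: "(\<Sum>x\<in>F. length (f x)) = card W" .
      have b: "good_walk k E \<phi> (B f)" "set (B f) = set (B ?e) \<union> W" "length (B f) = length (B ?e) + card W"
        "take h (B f) = take h (B ?e)" "lastn h (B f) = lastn h (B ?e)"
        using Bf[of f] f_ok uW sW by auto
      \<comment> \<open>Distinctness of the new path follows by counting, as its length and its
        vertex set both grow by \<open>card W\<close>.\<close>
      have "card (set (B f)) = card (set (B ?e)) + card W"
        unfolding b(2) using finW W(1) by (intro card_Un_disjoint) auto
      then have "card (set (B f)) = length (B f)" using b(3) distinct_card[OF B(1)] by simp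
      then have "distinct (B f)" by (rule card_distinct)
      then show ?thesis using b by blast
    qed
    then show ?thesis using B gB len by (intro exI[of _ "B ?e"]) auto
  qed
  then show ?thesis using \<zeta>0 \<eta>0 by blast
qed

section \<open>The reservoir and the spanning closed walk\<close>

definition linkable :: "nat \<Rightarrow> 'a set \<Rightarrow> 'a set set \<Rightarrow> ('a set \<Rightarrow> nat) \<Rightarrow> 'a list \<Rightarrow> 'a list \<Rightarrow> bool" where
  "linkable k V E \<phi> a b \<longleftrightarrow> a \<in> tuples V (2 * k - 2) \<and> b \<in> tuples V (2 * k - 2) \<and> distinct (a @ b) \<and>
     good_walk k E \<phi> a \<and> good_walk k E \<phi> b"

text \<open>The order of quantifiers matters: \<open>\<rho>\<close>, which bounds the set
  \<open>Z\<close> to be avoided, must not depend on \<open>\<mu>\<close>. The absorbing path takes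
  the place of \<open>Z\<close>, and only its absorbing capacity determines
  \<open>\<mu>\<close>.\<close>

lemma reservoir:
  assumes k: "2 \<le> k" and \<gamma>: "0 < \<gamma>"
  shows "\<exists>\<rho>>0. \<forall>\<mu>>0. \<exists>\<zeta> \<eta>. 0 < \<zeta> \<and> 0 < \<eta> \<and> (\<forall>(V :: 'a set) E \<phi> (Z :: 'a set).
     setting k \<gamma> \<eta> V E \<phi> \<longrightarrow> finite Z \<longrightarrow> real (card Z) \<le> \<rho> * real (card V) \<longrightarrow>
     (\<exists>R. finite R \<and> (\<forall>y\<in>R. set y \<subseteq> V - Z) \<and> (\<forall>x\<in>R. \<forall>y\<in>R. x \<noteq> y \<longrightarrow> set x \<inter> set y = {}) \<and>
        real (card (\<Union>y\<in>R. set y)) \<le> \<mu> * real (card V) \<and>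
        (\<forall>a b. linkable k V E \<phi> a b \<longrightarrow> \<zeta> * real (card V) \<le> real (card {y \<in> R. connector k E \<phi> a b y}))))"
proof -
  obtain m \<beta> \<eta>c where mk: "k \<le> m" and \<beta>: "0 < \<beta>" and \<eta>c: "0 < \<eta>c"
    and conn: "\<forall>(V :: 'a set) E \<phi> (Z :: 'a set) a b.
     setting k \<gamma> \<eta>c V E \<phi> \<longrightarrow> finite Z \<longrightarrow> real (card Z) \<le> \<eta>c * real (card V) \<longrightarrow>
     a \<in> tuples V (2 * k - 2) \<longrightarrow> b \<in> tuples V (2 * k - 2) \<longrightarrow> distinct (a @ b) \<longrightarrow>
     good_walk k E \<phi> a \<longrightarrow> good_walk k E \<phi> b \<longrightarrow>
     \<beta> * real (card V) ^ m \<le> real (card {y \<in> tuples V m. connector k E \<phi> a b y \<and> set y \<inter> Z = {}})"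
    using many_connectors[OF k \<gamma>] by (elim exE conjE) (rule that)
  have m1: "1 \<le> m" using mk k by simp
  have "\<exists>\<zeta> \<eta>. 0 < \<zeta> \<and> 0 < \<eta> \<and> (\<forall>(V :: 'a set) E \<phi> (Z :: 'a set).
     setting k \<gamma> \<eta> V E \<phi> \<longrightarrow> finite Z \<longrightarrow> real (card Z) \<le> \<eta>c * real (card V) \<longrightarrow>
     (\<exists>R. finite R \<and> (\<forall>y\<in>R. set y \<subseteq> V - Z) \<and> (\<forall>x\<in>R. \<forall>y\<in>R. x \<noteq> y \<longrightarrow> set x \<inter> set y = {}) \<and>
        real (card (\<Union>y\<in>R. set y)) \<le> \<mu> * real (card V) \<and>
        (\<forall>a b. linkable k V E \<phi> a b \<longrightarrow> \<zeta> * real (card V) \<le> real (card {y \<in> R. connector k E \<phi> a b y}))))"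
    if \<mu>: "0 < \<mu>" for \<mu> :: real
  proof -
    define h where "h = 2 * k - 2"
    have h1: "1 \<le> h" using k by (simp add: h_def)
    define \<kappa>0 where "\<kappa>0 = min \<mu> (\<beta> / (2 * real m))"
    have \<kappa>00: "0 < \<kappa>0" using \<mu> \<beta> m1 by (simp add: \<kappa>0_def)
    define \<kappa> where "\<kappa> = \<kappa>0 / real m"
    have \<kappa>: "0 < \<kappa>" using \<kappa>00 m1 by (simp add: \<kappa>_def)
    define \<zeta> where "\<zeta> = \<beta> * \<kappa> / 16"
    have \<zeta>0: "0 < \<zeta>" using \<beta> \<kappa> by (simp add: \<zeta>_def)
    \<comment> \<open>The selection is indexed by pairs of ends, of which there are at most
      \<open>card V ^ (2 * h)\<close>; this costs \<open>2 * h * ln (card V)\<close>.\<close>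
    obtain \<eta>l where \<eta>l: "0 < \<eta>l" "\<forall>n::nat. 1 \<le> \<eta>l * real n \<longrightarrow> ln (real n) \<le> \<zeta> / real (2 * h) * real n"
      using ln_le_small_linear[of "\<zeta> / real (2 * h)"] \<zeta>0 h1 by auto
    define \<eta> where "\<eta> = min \<eta>c (min (\<kappa> / 2) \<eta>l)"
    have \<eta>0: "0 < \<eta>" using \<eta>c \<kappa> \<eta>l by (simp add: \<eta>_def)
    have "\<exists>R. finite R \<and> (\<forall>y\<in>R. set y \<subseteq> V - Z) \<and> (\<forall>x\<in>R. \<forall>y\<in>R. x \<noteq> y \<longrightarrow> set x \<inter> set y = {}) \<and>
          real (card (\<Union>y\<in>R. set y)) \<le> \<mu> * real (card V) \<and>
          (\<forall>a b. linkable k V E \<phi> a b \<longrightarrow> \<zeta> * real (card V) \<le> real (card {y \<in> R. connector k E \<phi> a b y}))"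
      if S: "setting k \<gamma> \<eta> V E \<phi>" and Z: "finite Z" "real (card Z) \<le> \<eta>c * real (card V)"
      for V :: "'a set" and E \<phi> and Z :: "'a set"
    proof -
      let ?n = "real (card V)"
      have fin: "finite V" using S by (rule setting_finite)
      have n1: "1 \<le> \<eta> * ?n" using S by (simp add: setting_def)
      have n0: "0 < ?n" using n1 \<eta>0 by (cases "?n = 0") auto
      then have V0: "V \<noteq> {}" by auto
      have Sc: "setting k \<gamma> \<eta>c V E \<phi>" using S by (auto elim!: setting_mono simp: \<eta>_def)
      have le: "1 \<le> c * ?n" if "\<eta> \<le> c" for c
        using n1 mult_right_mono[OF that, of ?n] by simp
      have \<kappa>n: "2 \<le> \<kappa> * ?n" using le[of "\<kappa> / 2"] by (simp add: \<eta>_def)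
      have "ln ?n \<le> \<zeta> / real (2 * h) * ?n" using \<eta>l(2) le[of \<eta>l] by (simp add: \<eta>_def)
      then have lnn: "real (2 * h) * ln ?n \<le> \<zeta> * ?n" using h1 by (simp add: field_simps)
      define s where "s = nat \<lfloor>\<kappa> * ?n\<rfloor>"
      have s: "real s \<le> \<kappa> * ?n" "\<kappa> * ?n < real s + 1" using \<kappa>n by (auto simp: s_def)
      have s2: "\<kappa> * ?n / 2 \<le> real s" using s(2) \<kappa>n by linarith
      have "real s * real m \<le> \<kappa> * ?n * real m" using s(1) by (rule mult_right_mono) simp
      also have "\<dots> = \<kappa>0 * ?n" using m1 by (simp add: \<kappa>_def)
      finally have sb: "real s * real m \<le> \<kappa>0 * ?n" .
      have sm: "real s * real m \<le> \<beta> / (2 * real m) * ?n" and s\<mu>: "real s * real m \<le> \<mu> * ?n"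
        using sb mult_right_mono[of \<kappa>0 "\<beta> / (2 * real m)" ?n] mult_right_mono[of \<kappa>0 \<mu> ?n]
        by (auto simp: \<kappa>0_def)
      define I where "I = {(a, b). linkable k V E \<phi> a b}"
      define G where "G p = {y \<in> tuples V m. connector k E \<phi> (fst p) (snd p) y \<and> set y \<inter> Z = {}}" for p
      have IT: "I \<subseteq> tuples V h \<times> tuples V h" by (auto simp: I_def linkable_def h_def)
      have finI: "finite I" by (rule finite_subset[OF IT]) (simp add: finite_tuples[OF fin])
      show ?thesis
      proof (cases "I = {}")
        case True
        then show ?thesis using \<mu> by (intro exI[of _ "{}"]) (auto simp: I_def)
      next
        case False
        obtain R where R: "finite R" "card R = s" "R \<subseteq> (\<Union>p\<in>I. G p)"
          "\<And>x y. x \<in> R \<Longrightarrow> y \<in> R \<Longrightarrow> x \<noteq> y \<Longrightarrow> set x \<inter> set y = {}"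
          "\<And>p. p \<in> I \<Longrightarrow> \<beta> * real s / 4 - ln (real (card I)) \<le> real (card (R \<inter> G p))"
        proof (rule disjoint_selection[of V I \<beta> m G "\<beta> / (2 * real m)" s])
          fix p assume "p \<in> I"
          then show "\<beta> * ?n ^ m \<le> real (card (G p))"
            using conn Sc Z unfolding G_def I_def linkable_def by (cases p) simp
        qed (use fin V0 finI False \<beta> m1 sm in \<open>auto simp: G_def\<close>)
        have "card I \<le> card (tuples V h \<times> tuples V h)"
          using finite_tuples[OF fin] IT by (intro card_mono) auto
        also have "\<dots> = card V ^ (2 * h)" by (simp add: card_cartesian_product card_tuples[OF fin] flip: power_add mult_2)
        finally have "real (card I) \<le> ?n ^ (2 * h)" by (simp flip: of_nat_power)
        moreover have "0 < real (card I)" using finI False by (simp add: card_gt_0_iff)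
        ultimately have "ln (real (card I)) \<le> ln (?n ^ (2 * h))" by (intro ln_mono) auto
        also have "\<dots> = real (2 * h) * ln ?n" using n0 by (simp add: ln_realpow)
        finally have lnI: "ln (real (card I)) \<le> \<zeta> * ?n" using lnn by linarith
        have "\<beta> * (\<kappa> * ?n / 2) / 4 \<le> \<beta> * real s / 4" using s2 \<beta> by (intro divide_right_mono mult_left_mono) auto
        moreover have "\<beta> * (\<kappa> * ?n / 2) / 4 = 2 * (\<zeta> * ?n)" by (simp add: \<zeta>_def)
        ultimately have cnt: "\<zeta> * ?n \<le> real (card (R \<inter> G p))" if "p \<in> I" for p
          using R(5)[OF that] lnI by linarith
        have Rl: "length y = m \<and> set y \<subseteq> V - Z" if "y \<in> R" for y
          using that R(3) by (auto simp: G_def tuples_def)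
        show ?thesis
        proof (intro exI[of _ R] conjI ballI impI allI)
          have "card (\<Union>y\<in>R. set y) \<le> (\<Sum>y\<in>R. card (set y))" by (rule card_UN_le[OF R(1)])
          also have "\<dots> \<le> (\<Sum>y\<in>R. m)"
          proof (rule sum_mono)
            fix y assume "y \<in> R"
            then show "card (set y) \<le> m" using Rl card_length[of y] by force
          qed
          finally have "card (\<Union>y\<in>R. set y) \<le> s * m" using R(2) by simp
          then have "real (card (\<Union>y\<in>R. set y)) \<le> real s * real m" by (metis of_nat_le_iff of_nat_mult)
          then show "real (card (\<Union>y\<in>R. set y)) \<le> \<mu> * ?n" using s\<mu> by linarith
          fix a b assume "linkable k V E \<phi> a b"
          then have ab: "(a, b) \<in> I" by (simp add: I_def)
          have "\<zeta> * ?n \<le> real (card (R \<inter> G (a, b)))" by (rule cnt[OF ab])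
          also have "\<dots> \<le> real (card {y \<in> R. connector k E \<phi> a b y})"
            using R(1) by (auto intro!: card_mono simp: G_def)
          finally show "\<zeta> * ?n \<le> real (card {y \<in> R. connector k E \<phi> a b y})" .
        qed (use R Rl in auto)
      qed
    qed
    then show ?thesis using \<zeta>0 \<eta>0 by blast
  qed
  then show ?thesis using \<eta>c by blast
qed

lemma good_walk_join:
  assumes k: "2 \<le> k" and P: "good_walk k E \<phi> P" "2 * k - 2 \<le> length P" and x: "good_walk k E \<phi> x" "2 * k - 2 \<le> length x"
    and y: "connector k E \<phi> (lastn (2 * k - 2) P) (take (2 * k - 2) x) y"
  shows "good_walk k E \<phi> (P @ y @ x)"
proof -
  let ?h = "2 * k - 2"
  let ?p = "take (length P - ?h) P" and ?c = "lastn ?h P" and ?l = "take ?h x" and ?r = "drop ?h x"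
  have Pc: "P = ?p @ ?c" by (rule split_lastn)
  have "good_walk k E \<phi> (?p @ ?c @ (y @ ?l))"
    by (rule good_walk_glue) (use P y Pc k in \<open>auto simp: connector_def length_lastn\<close>)
  then have "good_walk k E \<phi> (((?p @ ?c) @ y) @ ?l)" by simp
  then have "good_walk k E \<phi> ((P @ y) @ ?l)" unfolding Pc[symmetric] .
  then have "good_walk k E \<phi> ((P @ y) @ ?l @ ?r)"
    by (rule good_walk_glue) (use x k in auto)
  then show ?thesis by simp
qed

lemma connect_tiles:
  assumes k: "2 \<le> k" and A: "distinct A" "good_walk k E \<phi> A" "2 * k - 2 \<le> length A" "set A \<subseteq> V"
    and R: "finite R" "\<And>y. y \<in> R \<Longrightarrow> set y \<subseteq> V - set A" "\<And>x y. x \<in> R \<Longrightarrow> y \<in> R \<Longrightarrow> x \<noteq> y \<Longrightarrow> set x \<inter> set y = {}"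
    and conn: "\<And>a b. linkable k V E \<phi> a b \<Longrightarrow> K < card {y \<in> R. connector k E \<phi> a b y}"
    and T: "\<And>x. x \<in> set Ts \<Longrightarrow> 2 * k - 2 \<le> length x \<and> distinct x \<and> good_walk k E \<phi> x \<and>
        set x \<subseteq> V - set A - (\<Union>y\<in>R. set y)"
      "\<And>x y. x \<in> set Ts \<Longrightarrow> y \<in> set Ts \<Longrightarrow> x \<noteq> y \<Longrightarrow> set x \<inter> set y = {}"
      "distinct Ts" "length Ts \<le> K"
  shows "\<exists>Q R0. R0 \<subseteq> R \<and> card R0 = length Ts \<and> distinct (A @ Q) \<and> good_walk k E \<phi> (A @ Q) \<and>
     set Q = (\<Union>x\<in>set Ts. set x) \<union> (\<Union>y\<in>R0. set y)"
  using T
proof (induction Ts rule: rev_induct)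
  case Nil
  show ?case using A by (intro exI[of _ "[]"] exI[of _ "{}"]) auto
next
  case (snoc x Ts)
  have "\<exists>Q R0. R0 \<subseteq> R \<and> card R0 = length Ts \<and> distinct (A @ Q) \<and> good_walk k E \<phi> (A @ Q) \<and>
     set Q = (\<Union>x\<in>set Ts. set x) \<union> (\<Union>y\<in>R0. set y)"
    by (rule snoc.IH) (use snoc.prems in auto)
  then obtain Q R0 where Q: "R0 \<subseteq> R" "card R0 = length Ts" "distinct (A @ Q)" "good_walk k E \<phi> (A @ Q)"
     "set Q = (\<Union>x\<in>set Ts. set x) \<union> (\<Union>y\<in>R0. set y)" by blast
  let ?h = "2 * k - 2"
  have x: "?h \<le> length x" "distinct x" "good_walk k E \<phi> x" "set x \<subseteq> V - set A - (\<Union>y\<in>R. set y)"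
    using snoc.prems(1)[of x] by auto
  have xT: "set x \<inter> set z = {}" if "z \<in> set Ts" for z
    using snoc.prems(2)[of x z] snoc.prems(3) that by auto
  have QV: "set Q \<subseteq> V"
  proof
    fix z assume "z \<in> set Q"
    then consider t where "t \<in> set Ts" "z \<in> set t" | y where "y \<in> R" "z \<in> set y" using Q(1,5) by blast
    then show "z \<in> V" using snoc.prems(1) R(2) by cases fastforce+
  qed
  have xAQ: "set x \<inter> set (A @ Q) = {}"
  proof -
    have "set x \<inter> set A = {}" "set x \<inter> (\<Union>y\<in>R0. set y) = {}" using x(4) Q(1) by auto
    moreover have "set x \<inter> (\<Union>x\<in>set Ts. set x) = {}" using xT by blast
    ultimately show ?thesis unfolding set_append Q(5) by blast
  qed
  let ?c = "lastn ?h (A @ Q)"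
  have c: "length ?c = ?h" "set ?c \<subseteq> set (A @ Q)" using A(3) set_lastn_subset[of ?h "A @ Q"] by (auto simp: length_lastn)
  have "linkable k V E \<phi> ?c (take ?h x)" unfolding linkable_def
  proof (intro conjI)
    show "?c \<in> tuples V ?h" using c A(4) QV by (auto simp: tuples_def)
    show "take ?h x \<in> tuples V ?h" using x set_take_subset[of ?h x] by (auto simp: tuples_def)
    have "distinct ?c" unfolding lastn_def using Q(3) by (rule distinct_drop)
    moreover have "distinct (take ?h x)" using x(2) by simp
    ultimately show "distinct (?c @ take ?h x)"
      using c(2) xAQ set_take_subset[of ?h x] unfolding distinct_append by blast
    show "good_walk k E \<phi> ?c" using Q(4) split_lastn[of "A @ Q" ?h] good_walk_suffix by metis
    show "good_walk k E \<phi> (take ?h x)" using x(3) append_take_drop_id[of ?h x] good_walk_prefix by metis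
  qed
  then have "card R0 < card {y \<in> R. connector k E \<phi> ?c (take ?h x) y}"
    using conn snoc.prems(4) Q(2) by fastforce
  then have "\<not> {y \<in> R. connector k E \<phi> ?c (take ?h x) y} \<subseteq> R0"
    using card_mono[OF finite_subset[OF Q(1) R(1)]] by (meson not_less)
  then obtain y where y: "y \<in> R" "connector k E \<phi> ?c (take ?h x) y" "y \<notin> R0" by blast
  have dy: "distinct y" using y(2) by (simp add: connector_def)
  have "set y \<inter> set z = {}" if "z \<in> R0" for z using R(3)[OF y(1)] that Q(1) y(3) by auto
  then have "set y \<inter> (\<Union>y\<in>R0. set y) = {}" by blast
  moreover have "set y \<inter> set t = {}" if "t \<in> set Ts" for t using snoc.prems(1)[of t] that y(1) by auto
  then have "set y \<inter> (\<Union>x\<in>set Ts. set x) = {}" by blast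
  moreover have "set y \<inter> set A = {}" using R(2)[OF y(1)] by auto
  ultimately have yAQ: "set y \<inter> set (A @ Q) = {}" unfolding set_append Q(5) by blast
  have xy: "set x \<inter> set y = {}" using x(4) y(1) by auto
  have "distinct (A @ (Q @ y @ x))" using Q(3) dy x(2) xAQ yAQ xy by auto
  moreover have "good_walk k E \<phi> ((A @ Q) @ y @ x)"
    by (rule good_walk_join[OF k Q(4) _ x(3,1) y(2)]) (use A(3) in simp)
  moreover have "card (insert y R0) = length (Ts @ [x])"
    using Q(2) y(3) finite_subset[OF Q(1) R(1)] by simp
  moreover have "set (Q @ y @ x) = (\<Union>x\<in>set (Ts @ [x]). set x) \<union> (\<Union>y\<in>insert y R0. set y)"
    using Q(5) by auto
  ultimately show ?case using Q(1) y(1) by (intro exI[of _ "Q @ y @ x"] exI[of _ "insert y R0"]) auto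
qed

lemma cyclic_good_walk:
  assumes k: "3 \<le> k" and \<gamma>: "0 < \<gamma>"
  shows "\<exists>\<eta>>0. \<forall>(V :: 'a set) E \<phi>. setting k \<gamma> \<eta> V E \<phi> \<longrightarrow>
    (\<exists>vs. distinct vs \<and> set vs = V \<and> 2 * (2 * k - 2) \<le> length vs \<and> good_walk k E \<phi> (vs @ take (2 * k - 2) vs))"
proof -
  define h where "h = 2 * k - 2"
  have k2: "2 \<le> k" using k by simp
  obtain \<rho> where \<rho>: "0 < \<rho>" and res: "\<forall>\<mu>>0. \<exists>\<zeta> \<eta>. 0 < \<zeta> \<and> 0 < \<eta> \<and> (\<forall>(V :: 'a set) E \<phi> (Z :: 'a set).
     setting k \<gamma> \<eta> V E \<phi> \<longrightarrow> finite Z \<longrightarrow> real (card Z) \<le> \<rho> * real (card V) \<longrightarrow>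
     (\<exists>R. finite R \<and> (\<forall>y\<in>R. set y \<subseteq> V - Z) \<and> (\<forall>x\<in>R. \<forall>y\<in>R. x \<noteq> y \<longrightarrow> set x \<inter> set y = {}) \<and>
        real (card (\<Union>y\<in>R. set y)) \<le> \<mu> * real (card V) \<and>
        (\<forall>a b. linkable k V E \<phi> a b \<longrightarrow> \<zeta> * real (card V) \<le> real (card {y \<in> R. connector k E \<phi> a b y}))))"
    using reservoir[OF k2 \<gamma>] by (elim exE conjE) (rule that)
  have "0 < min (\<gamma> / 4) \<rho>" using \<gamma> \<rho> by simp
  from absorbing_path[OF k2 \<gamma> this h_def] obtain \<zeta>1 \<eta>1 where \<zeta>1: "0 < \<zeta>1" and \<eta>1: "0 < \<eta>1"
    and absorb: "\<forall>(V :: 'a set) E \<phi>. setting k \<gamma> \<eta>1 V E \<phi> \<longrightarrow>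
     (\<exists>A. distinct A \<and> set A \<subseteq> V \<and> good_walk k E \<phi> A \<and> 2 * h \<le> length A \<and>
        real (length A) \<le> min (\<gamma> / 4) \<rho> * real (card V) \<and>
        (\<forall>W. W \<subseteq> V - set A \<longrightarrow> real (card W) \<le> \<zeta>1 * real (card V) \<longrightarrow>
           (\<exists>A'. distinct A' \<and> set A' = set A \<union> W \<and> good_walk k E \<phi> A' \<and>
              take h A' = take h A \<and> lastn h A' = lastn h A)))"
    by (elim exE conjE) (rule that)
  define \<mu> where "\<mu> = min (\<gamma> / 4) (\<zeta>1 / 2)"
  have "0 < \<mu>" using \<gamma> \<zeta>1 by (simp add: \<mu>_def)
  from res[THEN spec, THEN mp, OF this] obtain \<zeta>2 \<eta>2 where \<zeta>2: "0 < \<zeta>2" and \<eta>2: "0 < \<eta>2"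
    and res2: "\<forall>(V :: 'a set) E \<phi> (Z :: 'a set).
     setting k \<gamma> \<eta>2 V E \<phi> \<longrightarrow> finite Z \<longrightarrow> real (card Z) \<le> \<rho> * real (card V) \<longrightarrow>
     (\<exists>R. finite R \<and> (\<forall>y\<in>R. set y \<subseteq> V - Z) \<and> (\<forall>x\<in>R. \<forall>y\<in>R. x \<noteq> y \<longrightarrow> set x \<inter> set y = {}) \<and>
        real (card (\<Union>y\<in>R. set y)) \<le> \<mu> * real (card V) \<and>
        (\<forall>a b. linkable k V E \<phi> a b \<longrightarrow> \<zeta>2 * real (card V) \<le> real (card {y \<in> R. connector k E \<phi> a b y})))"
    by (elim exE conjE) (rule that)
  \<comment> \<open>Tiles of length \<open>2 * q\<close> number at most
    \<open>card V / (2 * q)\<close>, hence fewer than the \<open>\<zeta>2 * card V\<close>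
    connectors of a pair of ends. The summand \<open>k\<close> makes a tile at least
    \<open>h\<close> long.\<close>
  define q where "q = nat \<lceil>1 / \<zeta>2\<rceil> + k"
  have q1: "1 \<le> q" and hq: "h \<le> 2 * q" using k by (auto simp: q_def h_def)
  have "1 / \<zeta>2 \<le> real q" unfolding q_def by linarith
  then have q\<zeta>: "1 \<le> \<zeta>2 * real q" using \<zeta>2 by (simp add: field_simps)
  have "0 < \<zeta>1 / 2" using \<zeta>1 by simp
  from almost_cover[OF k \<gamma> q1 this] obtain \<eta>3 where \<eta>3: "0 < \<eta>3"
    and cover: "\<forall>(V :: 'a set) E \<phi> Z. setting k \<gamma> \<eta>3 V E \<phi> \<longrightarrow> Z \<subseteq> V \<longrightarrow>
     real (card Z) \<le> \<gamma> / 2 * real (card V) \<longrightarrow>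
     (\<exists>T. tiling k E \<phi> (V - Z) (2 * q) T \<and> real (card (V - Z - (\<Union>x\<in>T. set x))) \<le> \<zeta>1 / 2 * real (card V))"
    by (elim exE conjE) (rule that)
  define \<eta> where "\<eta> = min \<eta>1 (min \<eta>2 \<eta>3)"
  have \<eta>0: "0 < \<eta>" using \<eta>1 \<eta>2 \<eta>3 by (simp add: \<eta>_def)
  have "\<exists>vs. distinct vs \<and> set vs = V \<and> 2 * h \<le> length vs \<and> good_walk k E \<phi> (vs @ take h vs)"
    if S: "setting k \<gamma> \<eta> V E \<phi>" for V :: "'a set" and E \<phi>
  proof -
    let ?n = "real (card V)"
    have fin: "finite V" using S by (rule setting_finite)
    have n1: "1 \<le> \<eta> * ?n" using S by (simp add: setting_def)
    have n0: "0 < ?n" using n1 \<eta>0 by (cases "?n = 0") auto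
    have S1: "setting k \<gamma> \<eta>1 V E \<phi>" and S2: "setting k \<gamma> \<eta>2 V E \<phi>" and S3: "setting k \<gamma> \<eta>3 V E \<phi>"
      using S by (auto elim!: setting_mono simp: \<eta>_def)
    obtain A where A: "distinct A" "set A \<subseteq> V" "good_walk k E \<phi> A" "2 * h \<le> length A"
        "real (length A) \<le> min (\<gamma> / 4) \<rho> * ?n"
      and absA: "\<forall>W. W \<subseteq> V - set A \<longrightarrow> real (card W) \<le> \<zeta>1 * ?n \<longrightarrow>
           (\<exists>A'. distinct A' \<and> set A' = set A \<union> W \<and> good_walk k E \<phi> A' \<and>
              take h A' = take h A \<and> lastn h A' = lastn h A)"
      using absorb[rule_format, OF S1] by (elim exE conjE) (rule that)
    have lA: "real (length A) \<le> \<gamma> / 4 * ?n" "real (length A) \<le> \<rho> * ?n"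
      by (rule order_trans[OF A(5) mult_right_mono]; simp)+
    have cA: "card (set A) = length A" using distinct_card[OF A(1)] .
    obtain R where R: "finite R" "\<forall>y\<in>R. set y \<subseteq> V - set A" "\<forall>x\<in>R. \<forall>y\<in>R. x \<noteq> y \<longrightarrow> set x \<inter> set y = {}"
        "real (card (\<Union>y\<in>R. set y)) \<le> \<mu> * ?n"
      and Rc: "\<forall>a b. linkable k V E \<phi> a b \<longrightarrow> \<zeta>2 * ?n \<le> real (card {y \<in> R. connector k E \<phi> a b y})"
      using res2[rule_format, OF S2 finite_set lA(2)[folded cA]] by (elim exE conjE) (rule that)
    define RR where "RR = (\<Union>y\<in>R. set y)"
    have RR: "RR \<subseteq> V" "RR \<inter> set A = {}" "finite RR" using R(1,2) by (auto simp: RR_def)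
    have cRR: "real (card RR) \<le> \<gamma> / 4 * ?n" "real (card RR) \<le> \<zeta>1 / 2 * ?n"
      unfolding RR_def by (rule order_trans[OF R(4) mult_right_mono]; simp add: \<mu>_def)+
    define Z where "Z = set A \<union> RR"
    have ZV: "Z \<subseteq> V" using A(2) RR by (auto simp: Z_def)
    have "card Z \<le> card (set A) + card RR" unfolding Z_def by (rule card_Un_le)
    then have cZ: "real (card Z) \<le> \<gamma> / 2 * ?n" using lA(1) cA cRR(1) by simp
    obtain T where T: "tiling k E \<phi> (V - Z) (2 * q) T" "real (card (V - Z - (\<Union>x\<in>T. set x))) \<le> \<zeta>1 / 2 * ?n"
      using cover[rule_format, OF S3 ZV cZ] by blast
    have finT: "finite T" using T(1) by (simp add: tiling_def)
    obtain Ts where Ts: "set Ts = T" "distinct Ts" using finite_distinct_list[OF finT] by blast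
    have lTs: "length Ts = card T" using distinct_card[OF Ts(2)] Ts(1) by simp
    have "2 * q * card T \<le> card (V - Z)" by (rule tiling_card[OF T(1)]) (use fin in simp)
    also have "\<dots> \<le> card V" using fin by (intro card_mono) auto
    finally have qT: "real (2 * q * card T) \<le> ?n" by (rule of_nat_mono)
    have "\<zeta>2 * real (2 * q * card T) \<le> \<zeta>2 * ?n" using qT \<zeta>2 by (intro mult_left_mono) auto
    moreover have "2 * real (card T) * 1 \<le> 2 * real (card T) * (\<zeta>2 * real q)" using q\<zeta> by (intro mult_left_mono) auto
    ultimately have "2 * real (card T) \<le> \<zeta>2 * ?n" by (simp add: algebra_simps)
    moreover have "0 < \<zeta>2 * ?n" using \<zeta>2 n0 by simp
    ultimately have cT: "real (card T) < \<zeta>2 * ?n" by linarith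
    have Rc': "card T < card {y \<in> R. connector k E \<phi> a b y}" if "linkable k V E \<phi> a b" for a b
    proof -
      have "\<zeta>2 * ?n \<le> real (card {y \<in> R. connector k E \<phi> a b y})" using Rc that by blast
      then show ?thesis using cT by linarith
    qed
    have "\<exists>Q R0. R0 \<subseteq> R \<and> card R0 = length Ts \<and> distinct (A @ Q) \<and> good_walk k E \<phi> (A @ Q) \<and>
       set Q = (\<Union>x\<in>set Ts. set x) \<union> (\<Union>y\<in>R0. set y)"
    proof (rule connect_tiles[OF k2 A(1,3) _ A(2) R(1) _ _ Rc'])
      show "2 * k - 2 \<le> length A" using A(4) by (simp add: h_def)
      fix x assume "x \<in> set Ts"
      then have "length x = 2 * q" "distinct x" "good_walk k E \<phi> x" "set x \<subseteq> V - Z"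
        using T(1) Ts(1) by (auto simp: tiling_def)
      then show "2 * k - 2 \<le> length x \<and> distinct x \<and> good_walk k E \<phi> x \<and> set x \<subseteq> V - set A - (\<Union>y\<in>R. set y)"
        using hq by (auto simp: h_def Z_def RR_def)
    qed (use R(2,3) T(1) Ts lTs in \<open>auto simp: tiling_def\<close>)
    then obtain Q R0 where Q: "R0 \<subseteq> R" "card R0 = length Ts" "distinct (A @ Q)" "good_walk k E \<phi> (A @ Q)"
       "set Q = (\<Union>x\<in>set Ts. set x) \<union> (\<Union>y\<in>R0. set y)" by blast
    have QV: "set Q \<subseteq> V"
    proof -
      have "(\<Union>x\<in>set Ts. set x) \<subseteq> V" unfolding Ts(1) using T(1) by (auto simp: tiling_def)
      moreover have "(\<Union>y\<in>R0. set y) \<subseteq> RR" unfolding RR_def using Q(1) by blast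
      ultimately show ?thesis unfolding Q(5) using RR(1) by blast
    qed
    let ?c = "lastn h (A @ Q)" and ?b = "take h A"
    have len: "2 * h \<le> length (A @ Q)" using A(4) by simp
    have cb: "length ?c = h" "length ?b = h" using A(4) by (auto simp: length_lastn)
    have s1: "A @ Q = ?b @ drop h (A @ Q)" using append_take_drop_id[of h "A @ Q"] A(4) by simp
    have e: "lastn h (drop h (A @ Q)) = ?c" using A(4) by (simp add: lastn_def)
    have s2: "drop h (A @ Q) = take (length (drop h (A @ Q)) - h) (drop h (A @ Q)) @ ?c"
      by (rule split_lastn[of "drop h (A @ Q)" h, unfolded e])
    obtain u where split: "A @ Q = ?b @ u @ ?c"
      using trans[OF s1 arg_cong[OF s2, of "(@) ?b"]] by (rule that)
    have "linkable k V E \<phi> ?c ?b" unfolding linkable_def h_def[symmetric]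
    proof (intro conjI)
      show "?c \<in> tuples V h" using cb set_lastn_subset[of h "A @ Q"] A(2) QV by (auto simp: tuples_def)
      show "?b \<in> tuples V h" using cb set_take_subset[of h A] A(2) by (auto simp: tuples_def)
      have "distinct (?b @ u @ ?c)" unfolding split[symmetric] by (rule Q(3))
      then show "distinct (?c @ ?b)" by auto
      show "good_walk k E \<phi> ?c" using Q(4) split_lastn[of "A @ Q" h] good_walk_suffix by metis
      show "good_walk k E \<phi> ?b" using A(3) append_take_drop_id[of h A] good_walk_prefix by metis
    qed
    \<comment> \<open>One junction more than there are tiles: the reservoir also closes the path,
      from the end of \<open>A @ Q\<close> back to the start of \<open>A\<close>.\<close>
    then have "card R0 < card {y \<in> R. connector k E \<phi> ?c ?b y}" using Rc' Q(2) lTs by simp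
    then have "\<not> {y \<in> R. connector k E \<phi> ?c ?b y} \<subseteq> R0"
      using card_mono[OF finite_subset[OF Q(1) R(1)]] by (meson not_less)
    then obtain y where y: "y \<in> R" "connector k E \<phi> ?c ?b y" "y \<notin> R0" by blast
    have dy: "distinct y" using y(2) by (simp add: connector_def)
    have yR: "set y \<subseteq> RR" using y(1) by (auto simp: RR_def)
    have yA: "set y \<inter> set A = {}" using yR RR(2) by blast
    have yQ: "set y \<inter> set Q = {}"
    proof -
      have "set y \<inter> set z = {}" if "z \<in> R0" for z using R(3)[rule_format, OF y(1), of z] that Q(1) y(3) by auto
      moreover have "set y \<inter> set x = {}" if "x \<in> set Ts" for x
      proof -
        have "set x \<subseteq> V - Z" using T(1) Ts(1) that by (simp add: tiling_def)
        then show ?thesis using yR by (auto simp: Z_def)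
      qed
      ultimately show ?thesis unfolding Q(5) by blast
    qed
    have gb: "good_walk k E \<phi> ?b" using A(3) append_take_drop_id[of h A] good_walk_prefix by metis
    have cyc: "good_walk k E \<phi> ((A @ Q) @ y @ ?b)"
      by (rule good_walk_join[OF k2 Q(4) _ gb]) (use len cb y(2) in \<open>auto simp: h_def\<close>)
    define W where "W = V - set (A @ Q @ y)"
    have "W \<subseteq> (V - Z - (\<Union>x\<in>T. set x)) \<union> RR" unfolding W_def Z_def using Q(5) Ts(1) by auto
    then have "card W \<le> card ((V - Z - (\<Union>x\<in>T. set x)) \<union> RR)" using fin RR(3) by (intro card_mono) auto
    also have "\<dots> \<le> card (V - Z - (\<Union>x\<in>T. set x)) + card RR" by (rule card_Un_le)
    finally have cW: "real (card W) \<le> \<zeta>1 * ?n" using T(2) cRR(2) by simp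
    have WA: "W \<subseteq> V - set A" by (auto simp: W_def)
    obtain A' where A': "distinct A'" "set A' = set A \<union> W" "good_walk k E \<phi> A'"
      "take h A' = take h A" "lastn h A' = lastn h A" using absA[rule_format, OF WA cW] by (elim exE conjE) (rule that)
    \<comment> \<open>\<open>A'\<close> and \<open>A\<close> agree in their last \<open>h\<close>
      entries, so \<open>A'\<close> replaces \<open>A\<close> by gluing along \<open>c\<close>; they
      agree in the first \<open>h\<close> entries as well, so the closing overlap remains
      correct.\<close>
    define c where "c = lastn h A"
    define p where "p = take (length A - h) A"
    define p' where "p' = take (length A' - h) A'"
    have Ac: "A = p @ c" "A' = p' @ c" using split_lastn[of A h] split_lastn[of A' h] A'(5) by (auto simp: c_def p_def p'_def)
    have lc: "length c = h" using A(4) by (simp add: c_def length_lastn)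
    have "good_walk k E \<phi> (p @ (c @ Q @ y @ ?b))" using cyc by (simp add: Ac(1))
    then have g1: "good_walk k E \<phi> (c @ (Q @ y @ ?b))" by (rule good_walk_suffix)
    have g2: "good_walk k E \<phi> (p' @ c)" using A'(3) Ac(2) by simp
    have "good_walk k E \<phi> (p' @ c @ (Q @ y @ ?b))"
      by (rule good_walk_glue[OF g2 g1 _ k2]) (use lc in \<open>simp add: h_def\<close>)
    then have g: "good_walk k E \<phi> ((A' @ Q @ y) @ ?b)" by (simp add: Ac(2))
    have "length A \<le> length A'"
    proof -
      have "finite W" using fin by (simp add: W_def)
      then have "card (set A) \<le> card (set A')" unfolding A'(2) by (intro card_mono) auto
      then show ?thesis using distinct_card[OF A(1)] distinct_card[OF A'(1)] by simp
    qed
    then have lA': "2 * h \<le> length A'" using A(4) by simp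
    have tk: "take h (A' @ Q @ y) = ?b" using lA' A'(4) by simp
    have "distinct (A' @ Q @ y)"
      using A'(1,2) Q(3) dy yA yQ by (auto simp: W_def)
    moreover have "set (A' @ Q @ y) = V" using A'(2) A(2) QV yR RR(1) by (auto simp: W_def)
    moreover have "2 * h \<le> length (A' @ Q @ y)" using lA' by simp
    ultimately show ?thesis using g tk by (intro exI[of _ "A' @ Q @ y"]) simp
  qed
  then show ?thesis using \<eta>0 unfolding h_def by blast
qed

section \<open>Tight Hamilton cycles\<close>

lemma win_cyclic:
  assumes "p + k \<le> length vs + h" "h \<le> length vs"
  shows "win k (vs @ take h vs) p = window k vs p"
proof -
  have "(vs @ take h vs) ! (p + i) = vs ! ((p + i) mod length vs)" if "i < k" for i
  proof (cases "p + i < length vs")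
    case True
    then show ?thesis by (simp add: nth_append)
  next
    case False
    then have "p + i - length vs < h" using that assms by linarith
    moreover have "(p + i) mod length vs = p + i - length vs"
      using False that assms by (simp add: mod_if)
    ultimately show ?thesis using False by (simp add: nth_append)
  qed
  moreover have "{p..<p + k} = (+) p ` {..<k}"
    by (simp add: lessThan_atLeast0 image_add_atLeastLessThan add.commute)
  ultimately show ?thesis unfolding win_def window_def by (auto simp: image_image)
qed

lemma add_mod_inject:
  fixes i i' j n :: nat
  assumes "(j + i) mod n = (j + i') mod n" "i < n" "i' < n"
  shows "i = i'"
proof -
  have *: "i = i'" if "(j + i) mod n = (j + i') mod n" "i \<le> i'" "i' < n" for i i'
  proof -
    have "n dvd (j + i') - (j + i)" using that mod_eq_dvd_iff_nat[of "j + i" "j + i'" n] by simp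
    then have "n dvd i' - i" by simp
    then show ?thesis using that dvd_imp_le[of n "i' - i"] by (cases "i = i'") auto
  qed
  show ?thesis using *[of i i'] *[of i' i] assms by (cases "i \<le> i'") auto
qed

text \<open>\<open>k < length vs\<close> makes \<open>k + 1\<close> cyclically consecutive positions
  distinct; the windows are the first and the last \<open>k\<close> of these.\<close>

lemma card_window_Int:
  assumes "distinct vs" "k < length vs" "1 \<le> k"
  shows "card (window k vs j \<inter> window k vs (Suc j)) = k - 1"
proof -
  let ?f = "\<lambda>i. vs ! ((j + i) mod length vs)"
  have inj: "inj_on ?f {..k}"
  proof (rule inj_onI)
    fix i i' assume i: "i \<in> {..k}" "i' \<in> {..k}" and eq: "?f i = ?f i'"
    have "0 < length vs" using assms(2) by linarith
    then have "(j + i) mod length vs = (j + i') mod length vs"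
      using eq nth_eq_iff_index_eq[OF assms(1)] by simp
    then show "i = i'" by (rule add_mod_inject) (use i assms in auto)
  qed
  have w1: "window k vs j = ?f ` {..<k}" by (auto simp: window_def)
  have "window k vs (Suc j) = ?f ` (Suc ` {..<k})" unfolding image_image by (auto simp: window_def)
  then have w2: "window k vs (Suc j) = ?f ` {1..k}"
    by (simp add: lessThan_atLeast0 image_Suc_atLeastLessThan atLeastLessThanSuc_atLeastAtMost)
  have "window k vs j \<inter> window k vs (Suc j) = ?f ` ({..<k} \<inter> {1..k})"
    unfolding w1 w2 by (rule inj_on_image_Int[OF inj, symmetric]) auto
  moreover have "{..<k} \<inter> {1..k} = {1..<k}" by auto
  moreover have "inj_on ?f {1..<k}" by (rule inj_on_subset[OF inj]) auto
  ultimately show ?thesis by (simp add: card_image)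
qed

lemma window_add_length: "window k vs (p + length vs) = window k vs p"
proof -
  have "(p + length vs + i) mod length vs = (p + i) mod length vs" for i
    by (metis add.assoc add.commute mod_add_self2)
  then show ?thesis by (simp add: window_def)
qed

text \<open>If the starting positions are at least \<open>k\<close> apart in both directions around
  the cycle, the windows occupy different positions modulo the length.\<close>

lemma windows_near:
  assumes "p < q" "q < length vs" "distinct vs" "window k vs p \<inter> window k vs q \<noteq> {}"
  shows "q < p + k \<or> p + length vs < q + k"
proof (rule ccontr)
  let ?n = "length vs"
  assume "\<not> ?thesis"
  then have far: "p + k \<le> q" "q + k \<le> p + ?n" by auto
  obtain i i' where i: "i < k" "i' < k" "vs ! ((p + i) mod ?n) = vs ! ((q + i') mod ?n)"
    using assms(4) by (auto simp: window_def)
  have "0 < ?n" using assms(2) by linarith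
  then have "(p + i) mod ?n = (q + i') mod ?n"
    using i(3) nth_eq_iff_index_eq[OF assms(3)] by simp
  then have "(p + i) mod ?n = (p + (q + i' - p)) mod ?n" using far by simp
  then have "(p + i) mod ?n = ((p + i) + (q + i' - p - i)) mod ?n" using far i by simp
  then have "?n dvd (q + i' - p - i)"
    using mod_eq_dvd_iff_nat[of "p + i" "(p + i) + (q + i' - p - i)" ?n] by simp
  moreover have "0 < q + i' - p - i" "q + i' - p - i < ?n" using far i by linarith+
  ultimately show False using nat_dvd_not_less by blast
qed

text \<open>Appending the first \<open>2 * k - 2\<close> vertices unrolls the cycle far enough that
  any two intersecting windows appear as two windows of the list starting less than \<open>k\<close>
  apart.\<close>

lemma hamilton_cycle_of_cyclic_walk:
  assumes k: "2 \<le> k" and H: "kgraph k V E" and vs: "distinct vs" "set vs = V" "2 * (2 * k - 2) \<le> length vs"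
    and g: "good_walk k E \<phi> (vs @ take (2 * k - 2) vs)"
  shows "\<exists>C. hamilton_cycle k (k - 1) V E C \<and> properly_colored C \<phi>"
proof -
  let ?n = "length vs" and ?h = "2 * k - 2"
  let ?x = "vs @ take ?h vs"
  have hn: "?h \<le> ?n" and kn: "k < ?n" using vs(3) k by auto
  have lx: "length ?x = ?n + ?h" using hn by simp
  have win: "win k ?x p = window k vs p" if "p + k \<le> ?n + ?h" for p by (rule win_cyclic[OF that hn])
  define C where "C = {window k vs j |j. j < ?n}"
  have CE: "C \<subseteq> E"
  proof
    fix e assume "e \<in> C"
    then obtain j where j: "e = window k vs j" "j < ?n" by (auto simp: C_def)
    then have "j + k \<le> ?n + ?h" using k by simp
    then show "e \<in> E" using g win[of j] j(1) lx unfolding good_walk_def walk_def by metis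
  qed
  have kl: "k - (k - 1) = 1" using k by simp
  have "kl_cycle k (k - 1) V C"
    unfolding kl_cycle_def kl
  proof (intro conjI exI[of _ vs])
    show "kgraph k V C" using H CE by (auto simp: kgraph_def)
    show "C = {window k vs (j * 1) |j. j < ?n div 1}" by (simp add: C_def)
    show "\<forall>j<?n div 1. card (window k vs (j * 1) \<inter> window k vs (Suc j * 1)) = k - 1"
      using card_window_Int[OF vs(1) kn] k by simp
  qed (use k vs in auto)
  moreover have "properly_colored C \<phi>"
  proof -
    have *: "\<phi> (window k vs p) \<noteq> \<phi> (window k vs q)"
      if pq: "p < q" "q < ?n" "window k vs p \<inter> window k vs q \<noteq> {}" for p q
      using windows_near[OF pq(1,2) vs(1) pq(3)]
    proof
      assume q: "q < p + k"
      have b: "q + k \<le> ?n + ?h" using pq k by simp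
      then have "\<phi> (win k ?x p) \<noteq> \<phi> (win k ?x q)"
        using g pq q lx unfolding good_walk_def separated_def by metis
      then show ?thesis using win[of p] win[of q] b pq by simp
    next
      assume q: "p + ?n < q + k"
      \<comment> \<open>The pair wraps around, so the window at \<open>p\<close> is replaced by its
        copy at \<open>p + ?n\<close>. Here \<open>p \<le> k - 2\<close>, hence the copy ends within
        the \<open>2 * k - 2\<close> appended entries.\<close>
      have b: "p + ?n + k \<le> ?n + ?h" using pq q k by linarith
      have "q < p + ?n" using pq by simp
      then have "\<phi> (win k ?x q) \<noteq> \<phi> (win k ?x (p + ?n))"
        using g q b lx unfolding good_walk_def separated_def by metis
      moreover have "q + k \<le> ?n + ?h" using pq k by simp
      ultimately show ?thesis using win[of "p + ?n"] win[of q] b by (simp add: window_add_length eq_commute)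
    qed
    show ?thesis
      unfolding properly_colored_def
    proof (intro ballI impI)
      fix e f assume e: "e \<in> C" "f \<in> C" "e \<noteq> f" "e \<inter> f \<noteq> {}"
      obtain p q where p: "e = window k vs p" "p < ?n" and q: "f = window k vs q" "q < ?n"
        using e(1,2) by (auto simp: C_def)
      have "p \<noteq> q" using e(3) p q by auto
      then consider "p < q" | "q < p" by linarith
      then show "\<phi> e \<noteq> \<phi> f"
      proof cases
        case 1
        then show ?thesis using *[of p q] p q e(4) by simp
      next
        case 2
        then show ?thesis using *[of q p] p q e(4) by (simp add: Int_commute eq_commute)
      qed
    qed
  qed
  ultimately show ?thesis using CE unfolding hamilton_cycle_def by blast
qed

lemma card_color_nbhd_le_deg:
  assumes "kgraph k V E"
  shows "card {u \<in> nbhd V E S. \<phi> (insert u S) = i} \<le> deg (color_class E \<phi> i) S"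
proof -
  have "E \<subseteq> Pow V" "finite V" using assms by (auto simp: kgraph_def)
  then have "finite E" by (meson finite_Pow_iff finite_subset)
  then have fc: "finite {e \<in> color_class E \<phi> i. S \<subseteq> e}" by (simp add: color_class_def)
  have "inj_on (\<lambda>u. insert u S) {u \<in> nbhd V E S. \<phi> (insert u S) = i}"
    by (auto simp: inj_on_def nbhd_def)
  moreover have "(\<lambda>u. insert u S) ` {u \<in> nbhd V E S. \<phi> (insert u S) = i} \<subseteq> {e \<in> color_class E \<phi> i. S \<subseteq> e}"
    by (auto simp: nbhd_def color_class_def)
  ultimately show ?thesis unfolding deg_def using fc by (rule card_inj_on_le)
qed

lemma setting_of_degrees:
  assumes H: "kgraph k V E" and k: "1 \<le> k"
    and mn: "(1/2 + \<gamma>) * real (card V) \<le> real (min_deg (k - 1) V E)"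
    and mx: "\<And>i. real (max_deg (k - 1) V (color_class E \<phi> i)) \<le> \<eta> * real (card V)"
    and n: "1 \<le> \<eta> * real (card V)"
  shows "setting k \<gamma> \<eta> V E \<phi>"
  unfolding setting_def
proof (intro conjI allI impI)
  have fin: "finite V" using H by (simp add: kgraph_def)
  have finD: "finite {deg F S |S. S \<subseteq> V \<and> card S = k - 1}" for F :: "'a set set"
  proof -
    have "{deg F S |S. S \<subseteq> V \<and> card S = k - 1} \<subseteq> deg F ` Pow V" by auto
    then show ?thesis using fin finite_subset by blast
  qed
  show "finite V" by (rule fin)
  show "\<forall>e\<in>E. e \<subseteq> V \<and> card e = k" using H by (simp add: kgraph_def)
  fix S assume S: "S \<subseteq> V" "card S = k - 1"
  have "min_deg (k - 1) V E \<le> deg E S"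
    unfolding min_deg_def using S by (intro Min_le[OF finD]) blast
  also have "\<dots> \<le> card (nbhd V E S)" by (rule deg_le_card_nbhd[OF H S k])
  finally show "(1/2 + \<gamma>) * real (card V) \<le> real (card (nbhd V E S))" using mn by linarith
  fix i
  have "card {u \<in> nbhd V E S. \<phi> (insert u S) = i} \<le> deg (color_class E \<phi> i) S"
    by (rule card_color_nbhd_le_deg[OF H])
  also have "\<dots> \<le> max_deg (k - 1) V (color_class E \<phi> i)"
    unfolding max_deg_def using S by (intro Max_ge[OF finD]) blast
  finally show "real (card {u \<in> nbhd V E S. \<phi> (insert u S) = i}) \<le> \<eta> * real (card V)" using mx[of i] by linarith
qed (rule n)

theorem theorem1p2:
  fixes k :: nat and \<gamma> :: real
  assumes "k \<ge> 3" and "\<gamma> > 0"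
  shows "\<exists>c::real. \<exists>n\<^sub>0::nat. c > 0 \<and> n\<^sub>0 > 0 \<and>
    (\<forall>(V :: 'a set) (E :: 'a set set) (\<phi> :: 'a set \<Rightarrow> nat) (n :: nat).
       kgraph k V E \<longrightarrow> card V = n \<longrightarrow> n \<ge> n\<^sub>0 \<longrightarrow>
       real (min_deg (k - 1) V E) \<ge> (1/2 + \<gamma>) * real n \<longrightarrow>
       (\<forall>i. real (max_deg (k - 1) V (color_class E \<phi> i)) \<le> c * real n) \<longrightarrow>
       (\<exists>C. hamilton_cycle k (k - 1) V E C \<and> properly_colored C \<phi>))"
proof -
  obtain \<eta> where \<eta>: "0 < \<eta>" and cyc: "\<forall>(V :: 'a set) E \<phi>. setting k \<gamma> \<eta> V E \<phi> \<longrightarrow>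
    (\<exists>vs. distinct vs \<and> set vs = V \<and> 2 * (2 * k - 2) \<le> length vs \<and> good_walk k E \<phi> (vs @ take (2 * k - 2) vs))"
    using cyclic_good_walk[OF assms] by (elim exE conjE) (rule that)
  \<comment> \<open>Large enough for \<open>1 \<le> \<eta> * n\<close>, the size condition in
    \<open>setting\<close>; the constant \<open>c\<close> of the theorem is
    \<open>\<eta>\<close>.\<close>
  define n0 where "n0 = Suc (nat \<lceil>1 / \<eta>\<rceil>)"
  have "\<exists>C. hamilton_cycle k (k - 1) V E C \<and> properly_colored C \<phi>"
    if H: "kgraph k V E" and n: "card V = n" "n0 \<le> n"
      and mn: "(1/2 + \<gamma>) * real n \<le> real (min_deg (k - 1) V E)"
      and mx: "\<forall>i. real (max_deg (k - 1) V (color_class E \<phi> i)) \<le> \<eta> * real n"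
    for V :: "'a set" and E \<phi> n
  proof -
    have "1 / \<eta> \<le> real n0" unfolding n0_def by linarith
    then have "1 / \<eta> \<le> real n" using n(2) by linarith
    then have "1 \<le> \<eta> * real n" using \<eta> by (simp add: field_simps)
    then have "setting k \<gamma> \<eta> V E \<phi>"
      using assms(1) n(1) mn mx by (intro setting_of_degrees[OF H]) auto
    then obtain vs where "distinct vs" "set vs = V" "2 * (2 * k - 2) \<le> length vs"
      "good_walk k E \<phi> (vs @ take (2 * k - 2) vs)" using cyc by blast
    then show ?thesis using assms(1) by (intro hamilton_cycle_of_cyclic_walk[OF _ H]) auto
  qed
  moreover have "0 < n0" by (simp add: n0_def)
  ultimately show ?thesis using \<eta> by blast
qed

end
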